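(* Let $S$ be a set of $n$ jobs with processing times $p_j\ge 0$ and a partial order $\prec$ on $S$ (precedence constraints), and let $w_A\ge 0$ ($A\subseteq S$) be non-negative weights. Suppose that a non-decreasing, concave function $h\colon[0,\infty)\to[0,\infty)$ and the function $g\colon A\mapsto\sum_{B\subseteq A}w_B$ on $2^S$ are given by value oracles. Then there is an algorithm running in strongly polynomial time in $n$ that computes a $2$-approximation for the problem $1\mid prec\mid\sum w_A h(C_A)$.
   Context: In $1\mid prec\mid\sum w_A h(C_A)$ the jobs of $S$ are to be processed one at a time on a single machine in an order $\pi$ that respects the precedence constraints (if $i\prec j$ then $i$ is before $j$ in $\pi$). The completion time $C_j$ of a job $j$ is the sum of its own processing time and the processing times of all jobs preceding it in $\pi$; for non-empty $A\subseteq S$, $C_A=\max_{j\in A}C_j$ is the first time at which all jobs of $A$ have been completed (and one may take $w_\emptyset=0$). The objective is to minimize $\sum_{A\subseteq S}w_A h(C_A)$ over feasible orders. A $2$-approximation is a feasible order whose objective value is at most twice the minimum. Strongly polynomial time means that the number of oracle calls and elementary arithmetic operations is bounded by a polynomial in $n$. *)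

theory Defs
  imports
    "HOL-Analysis.Analysis"
    "HOL-Combinatorics.Multiset_Permutations"
    "HOL-Computational_Algebra.Polynomial"
begin

section \<open>The scheduling problem\<close>

definition precedes :: "'a list \<Rightarrow> 'a \<Rightarrow> 'a \<Rightarrow> bool" where
  "precedes \<pi> i j \<longleftrightarrow> (\<exists>a b. a < b \<and> b < length \<pi> \<and> \<pi> ! a = i \<and> \<pi> ! b = j)"

definition feasible_orders :: "'a set \<Rightarrow> ('a \<Rightarrow> 'a \<Rightarrow> bool) \<Rightarrow> 'a list set" where
  "feasible_orders S prec =
     {\<pi> \<in> permutations_of_set S. \<forall>i\<in>S. \<forall>j\<in>S. prec i j \<longrightarrow> precedes \<pi> i j}"

definition completion_time :: "('a \<Rightarrow> real) \<Rightarrow> 'a list \<Rightarrow> 'a \<Rightarrow> real" where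
  "completion_time p \<pi> j = p j + (\<Sum>i | precedes \<pi> i j. p i)"

definition set_completion_time :: "('a \<Rightarrow> real) \<Rightarrow> 'a list \<Rightarrow> 'a set \<Rightarrow> real" where
  "set_completion_time p \<pi> A = Max (completion_time p \<pi> ` A)"

text \<open>
  The completion time of the empty set is undefined, so the empty set does not contribute
  to the objective, whatever its weight is.
\<close>

definition objective ::
  "'a set \<Rightarrow> ('a \<Rightarrow> real) \<Rightarrow> ('a set \<Rightarrow> real) \<Rightarrow> (real \<Rightarrow> real) \<Rightarrow> 'a list \<Rightarrow> real" where
  "objective S p w h \<pi> = (\<Sum>A\<in>Pow S - {{}}. w A * h (set_completion_time p \<pi> A))"

definition is_approximation ::
  "real \<Rightarrow> 'a set \<Rightarrow> ('a \<Rightarrow> real) \<Rightarrow> ('a \<Rightarrow> 'a \<Rightarrow> bool) \<Rightarrow> ('a set \<Rightarrow> real) \<Rightarrow> (real \<Rightarrow> real)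
    \<Rightarrow> 'a list \<Rightarrow> bool" where
  "is_approximation \<alpha> S p prec w h \<pi> \<longleftrightarrow>
     \<pi> \<in> feasible_orders S prec \<and>
     objective S p w h \<pi> \<le> \<alpha> * Min (objective S p w h ` feasible_orders S prec)"

definition subset_weight :: "('a set \<Rightarrow> real) \<Rightarrow> 'a set \<Rightarrow> real" where
  "subset_weight w A = (\<Sum>B\<in>Pow A. w B)"


section \<open>The model of computation\<close>

text \<open>
  Algorithms are programs of a while language over a random access machine with natural
  number cells and real number cells. Every variable is an array of arbitrary arity: a cell
  is addressed by a name and a list of indices, the empty list giving a plain variable.
  Natural numbers serve as indices, counters and Boolean flags, and can only be added and
  subtracted (with truncation at zero), so that in \<open>T\<close> steps their bit length grows at most
  linearly in \<open>T\<close>. Real cells store arbitrary reals exactly, and admit the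
  four arithmetic operations and comparison, but neither rounding nor any other
  conversion to natural numbers. The only numerical constants are natural numbers.

  The expression \<open>Query_h e\<close> calls the oracle for \<open>h\<close>. The expression \<open>Query_g x es\<close> calls
  the oracle for \<open>g\<close> on the set of jobs \<open>j\<close> whose cell \<open>x[es, j]\<close> is non-zero.
\<close>

type_synonym vname = string

datatype nexp =
    NConst nat
  | NVar vname "nexp list"
  | NPlus nexp nexp
  | NMinus nexp nexp

datatype rexp =
    Of_Nat nexp
  | RVar vname "nexp list"
  | RPlus rexp rexp
  | RMinus rexp rexp
  | RTimes rexp rexp
  | RDivide rexp rexp
  | Query_h rexp
  | Query_g vname "nexp list"

datatype bexp =
    NLess nexp nexp
  | RLess rexp rexp
  | BNot bexp
  | BAnd bexp bexp

datatype com =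
    SKIP
  | NAssign vname "nexp list" nexp
  | RAssign vname "nexp list" rexp
  | Seq com com
  | Cond bexp com com
  | While bexp com

record state =
  nats :: "vname \<Rightarrow> nat list \<Rightarrow> nat"
  reals :: "vname \<Rightarrow> nat list \<Rightarrow> real"

record oracle_env =
  jobs :: "nat set"
  oracle_g :: "nat set \<Rightarrow> real"
  oracle_h :: "real \<Rightarrow> real"

fun nval :: "state \<Rightarrow> nexp \<Rightarrow> nat" where
  "nval s (NConst k) = k"
| "nval s (NVar x es) = nats s x (map (nval s) es)"
| "nval s (NPlus a b) = nval s a + nval s b"
| "nval s (NMinus a b) = nval s a - nval s b"

fun rval :: "oracle_env \<Rightarrow> state \<Rightarrow> rexp \<Rightarrow> real" where
  "rval \<Omega> s (Of_Nat e) = real (nval s e)"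
| "rval \<Omega> s (RVar x es) = reals s x (map (nval s) es)"
| "rval \<Omega> s (RPlus a b) = rval \<Omega> s a + rval \<Omega> s b"
| "rval \<Omega> s (RMinus a b) = rval \<Omega> s a - rval \<Omega> s b"
| "rval \<Omega> s (RTimes a b) = rval \<Omega> s a * rval \<Omega> s b"
| "rval \<Omega> s (RDivide a b) = rval \<Omega> s a / rval \<Omega> s b"
| "rval \<Omega> s (Query_h e) = oracle_h \<Omega> (rval \<Omega> s e)"
| "rval \<Omega> s (Query_g x es) =
     oracle_g \<Omega> {j \<in> jobs \<Omega>. nats s x (map (nval s) es @ [j]) \<noteq> 0}"

fun bval :: "oracle_env \<Rightarrow> state \<Rightarrow> bexp \<Rightarrow> bool" where
  "bval \<Omega> s (NLess a b) \<longleftrightarrow> nval s a < nval s b"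
| "bval \<Omega> s (RLess a b) \<longleftrightarrow> rval \<Omega> s a < rval \<Omega> s b"
| "bval \<Omega> s (BNot b) \<longleftrightarrow> \<not> bval \<Omega> s b"
| "bval \<Omega> s (BAnd a b) \<longleftrightarrow> bval \<Omega> s a \<and> bval \<Omega> s b"

text \<open>
  Every node of an evaluated expression costs one step, so that all arithmetic operations,
  comparisons, memory accesses and oracle calls are counted.
\<close>

fun ncost :: "nexp \<Rightarrow> nat" where
  "ncost (NConst k) = 1"
| "ncost (NVar x es) = 1 + sum_list (map ncost es)"
| "ncost (NPlus a b) = 1 + ncost a + ncost b"
| "ncost (NMinus a b) = 1 + ncost a + ncost b"

fun rcost :: "rexp \<Rightarrow> nat" where
  "rcost (Of_Nat e) = 1 + ncost e"
| "rcost (RVar x es) = 1 + sum_list (map ncost es)"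
| "rcost (RPlus a b) = 1 + rcost a + rcost b"
| "rcost (RMinus a b) = 1 + rcost a + rcost b"
| "rcost (RTimes a b) = 1 + rcost a + rcost b"
| "rcost (RDivide a b) = 1 + rcost a + rcost b"
| "rcost (Query_h e) = 1 + rcost e"
| "rcost (Query_g x es) = 1 + sum_list (map ncost es)"

fun bcost :: "bexp \<Rightarrow> nat" where
  "bcost (NLess a b) = 1 + ncost a + ncost b"
| "bcost (RLess a b) = 1 + rcost a + rcost b"
| "bcost (BNot b) = 1 + bcost b"
| "bcost (BAnd a b) = 1 + bcost a + bcost b"

definition nassign :: "vname \<Rightarrow> nat list \<Rightarrow> nat \<Rightarrow> state \<Rightarrow> state" where
  "nassign x ks v s = s\<lparr>nats := (nats s)(x := (nats s x)(ks := v))\<rparr>"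

definition rassign :: "vname \<Rightarrow> nat list \<Rightarrow> real \<Rightarrow> state \<Rightarrow> state" where
  "rassign x ks v s = s\<lparr>reals := (reals s)(x := (reals s x)(ks := v))\<rparr>"

text \<open>
  \<open>exec \<Omega> c s k t\<close>: with the oracles \<open>\<Omega>\<close>, the program \<open>c\<close> started in the state \<open>s\<close> terminates
  in the state \<open>t\<close> after \<open>k\<close> steps.
\<close>

inductive exec :: "oracle_env \<Rightarrow> com \<Rightarrow> state \<Rightarrow> nat \<Rightarrow> state \<Rightarrow> bool"
  for \<Omega> :: oracle_env where
  Skip: "exec \<Omega> SKIP s 1 s"
| NAssign: "exec \<Omega> (NAssign x es e) s (1 + sum_list (map ncost es) + ncost e)
     (nassign x (map (nval s) es) (nval s e) s)"
| RAssign: "exec \<Omega> (RAssign x es e) s (1 + sum_list (map ncost es) + rcost e)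
     (rassign x (map (nval s) es) (rval \<Omega> s e) s)"
| Seq: "exec \<Omega> c1 s k1 s' \<Longrightarrow> exec \<Omega> c2 s' k2 t \<Longrightarrow> exec \<Omega> (Seq c1 c2) s (k1 + k2) t"
| CondTrue: "bval \<Omega> s b \<Longrightarrow> exec \<Omega> c1 s k t \<Longrightarrow> exec \<Omega> (Cond b c1 c2) s (1 + bcost b + k) t"
| CondFalse: "\<not> bval \<Omega> s b \<Longrightarrow> exec \<Omega> c2 s k t \<Longrightarrow> exec \<Omega> (Cond b c1 c2) s (1 + bcost b + k) t"
| WhileFalse: "\<not> bval \<Omega> s b \<Longrightarrow> exec \<Omega> (While b c) s (1 + bcost b) s"
| WhileTrue: "bval \<Omega> s b \<Longrightarrow> exec \<Omega> c s k1 s' \<Longrightarrow> exec \<Omega> (While b c) s' k2 t \<Longrightarrow>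
     exec \<Omega> (While b c) s (1 + bcost b + k1 + k2) t"

inductive_cases SkipE: "exec \<Omega> SKIP s k t"
inductive_cases NAssignE: "exec \<Omega> (NAssign x es e) s k t"
inductive_cases RAssignE: "exec \<Omega> (RAssign x es e) s k t"
inductive_cases SeqE: "exec \<Omega> (Seq c1 c2) s k t"
inductive_cases CondE: "exec \<Omega> (Cond b c1 c2) s k t"
inductive_cases WhileE: "exec \<Omega> (While b c) s k t"

lemma exec_deterministic:
  "exec \<Omega> c s k t \<Longrightarrow> exec \<Omega> c s k' t' \<Longrightarrow> k' = k \<and> t' = t"
proof (induction arbitrary: k' t' rule: exec.induct)
  case (Skip s)
  then show ?case by (rule SkipE) simp
next
  case (NAssign x es e s)
  then show ?case by (rule NAssignE) simp
next
  case (RAssign x es e s)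
  then show ?case by (rule RAssignE) simp
next
  case (Seq c1 s k1 s' c2 k2 t)
  from Seq.prems obtain l1 l2 u where
    "exec \<Omega> c1 s l1 u" "exec \<Omega> c2 u l2 t'" "k' = l1 + l2"
    by (rule SeqE)
  with Seq.IH show ?case by metis
next
  case (CondTrue s b c1 k t c2)
  from CondTrue.prems obtain l where
    "exec \<Omega> c1 s l t'" "k' = 1 + bcost b + l"
    by (rule CondE) (use CondTrue.hyps in simp_all)
  with CondTrue.IH show ?case by metis
next
  case (CondFalse s b c2 k t c1)
  from CondFalse.prems obtain l where
    "exec \<Omega> c2 s l t'" "k' = 1 + bcost b + l"
    by (rule CondE) (use CondFalse.hyps in simp_all)
  with CondFalse.IH show ?case by metis
next
  case (WhileFalse s b c)
  from WhileFalse.prems show ?case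
    by (rule WhileE) (use WhileFalse.hyps in simp_all)
next
  case (WhileTrue s b c k1 s' k2 t)
  from WhileTrue.prems obtain l1 l2 u where
    "exec \<Omega> c s l1 u" "exec \<Omega> (While b c) u l2 t'" "k' = 1 + bcost b + l1 + l2"
    by (rule WhileE) (use WhileTrue.hyps in simp_all)
  with WhileTrue.IH show ?case by metis
qed


section \<open>Input and output\<close>

text \<open>
  For an instance with the set \<open>{..<n}\<close> of jobs, the variable \<open>n\<close> holds the number of jobs,
  \<open>p[j]\<close> the processing time of \<open>j\<close>, and \<open>prec[i, j]\<close> the truth value of \<open>i \<prec> j\<close>; all other
  cells are zero. The weights and \<open>h\<close> are accessible through the oracles only. On termination
  \<open>out[k]\<close> is the job in position \<open>k\<close> of the computed order.
\<close>

definition initial_state :: "nat \<Rightarrow> (nat \<Rightarrow> real) \<Rightarrow> (nat \<Rightarrow> nat \<Rightarrow> bool) \<Rightarrow> state" where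
  "initial_state n p prec =
     \<lparr>nats = (\<lambda>x ks. if x = ''n'' \<and> ks = [] then n
                     else if x = ''prec'' \<and> (\<exists>i<n. \<exists>j<n. ks = [i, j] \<and> prec i j) then 1
                     else 0),
      reals = (\<lambda>x ks. if x = ''p'' \<and> (\<exists>j<n. ks = [j]) then p (hd ks) else 0)\<rparr>"

definition oracles :: "nat \<Rightarrow> (nat set \<Rightarrow> real) \<Rightarrow> (real \<Rightarrow> real) \<Rightarrow> oracle_env" where
  "oracles n g h = \<lparr>jobs = {..<n}, oracle_g = g, oracle_h = h\<rparr>"

definition output_order :: "nat \<Rightarrow> state \<Rightarrow> nat list" where
  "output_order n s = map (\<lambda>k. nats s ''out'' [k]) [0..<n]"

end

theory Submission
  imports Defs
begin

text \<open>
  With \<open>f A = h (p(A))\<close> submodular and \<open>g\<close> supermodular, the objective of an order with prefix sets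
  \<open>A\<^sub>k\<close> is a constant plus \<open>\<Sum>k. (f A\<^bsub>k+1\<^esub> - f A\<^sub>k) * (g S - g A\<^sub>k)\<close>. As in Sidney's decomposition one
  repeatedly schedules an order ideal of largest density \<open>g/f\<close> and contracts it; a block costs at most
  twice what any order must pay for it. An order has only \<open>n\<close> steps, so the area estimate behind
  the factor \<open>2\<close> has relative slack \<open>1/n\<close>, and ideals that are densest up to a factor \<open>1 + 1/(3n)\<close>
  suffice. Submodular function minimization is therefore not needed.

  Nearly densest ideals are found as follows. The concave function \<open>h\<close> is replaced by its chords on a
  polynomial grid: every chord is nearly above \<open>h\<close> everywhere, and below \<open>h\<close> on its own interval.
  For a chord, the problem is to maximize \<open>g(A)\<close> over an affine function of \<open>p(A)\<close>; its dual is a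
  packing problem over the base polytope of \<open>g\<close>, which multiplicative weights solve within
  \<open>1 + \<epsilon>\<close> in a number of iterations that depends on \<open>n\<close> and \<open>\<epsilon>\<close> only. Each iteration
  uses the vertex computed by the greedy algorithm, and one of the threshold sets met on the way is
  nearly densest.
\<close>

section \<open>Structured programs\<close>

text \<open>The factor 2 is an area ratio: scheduling a block next costs at most a rectangle, the
  increase of \<open>f\<close> times the weight still open. What any order pays for the block beyond
  the cost left after contraction contains a triangle, for the gain of the block itself, because no
  ideal is much denser, and a strip, for the gain of all later jobs. Each is at least half of its
  part of the rectangle. The obstacle in the search is that inputs are arbitrary reals that cannot
  be rounded: neither binary search for the density nor a geometric grid between the smallest and
  the largest number has a number of steps bounded in \<open>n\<close>. Lengths are therefore
  measured in units of a single job: the processing time of an ideal outside the scheduled part is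
  at least its longest job and at most \<open>n\<close> times it, so \<open>n\<close> grids suffice.
  No density is guessed either; that of the best set seen serves afterwards as the bound in the
  packing argument. Precedence constraints are absorbed by replacing each set by the largest ideal
  in it, which keeps the gain supermodular.\<close>

text \<open>
  The only loops run from \<open>0\<close> to the unmodified input size plus a constant, so that the running time
  is polynomial for syntactic reasons.
\<close>

datatype prog =
    PN vname "nexp list" nexp
  | PR vname "nexp list" rexp
  | PSeq prog prog (infixr ";;" 60)
  | PIf bexp prog
  | PFor vname nat prog

primrec com_of :: "prog \<Rightarrow> com" where
  "com_of (PN x es e) = NAssign x es e"
| "com_of (PR x es e) = RAssign x es e"
| "com_of (a ;; b) = Seq (com_of a) (com_of b)"
| "com_of (PIf b a) = Cond b (com_of a) SKIP"
| "com_of (PFor x d a) = Seq (NAssign x [] (NConst 0))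
     (While (NLess (NVar x []) (NPlus (NVar ''n'' []) (NConst d)))
       (Seq (com_of a) (NAssign x [] (NPlus (NVar x []) (NConst 1)))))"

text \<open>The semantics is a total function, so programs are verified by rewriting and by
  invariants of \<open>fold\<close>. The number of rounds is fixed on entry, which agrees with the
  \<open>While\<close> loop as long as the body changes neither the cell \<open>n\<close> nor the
  counter; \<open>wf_prog\<close> demands this.\<close>

primrec run :: "oracle_env \<Rightarrow> prog \<Rightarrow> state \<Rightarrow> state" where
  "run \<Omega> (PN x es e) = (\<lambda>s. nassign x (map (nval s) es) (nval s e) s)"
| "run \<Omega> (PR x es e) = (\<lambda>s. rassign x (map (nval s) es) (rval \<Omega> s e) s)"
| "run \<Omega> (a ;; b) = (\<lambda>s. run \<Omega> b (run \<Omega> a s))"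
| "run \<Omega> (PIf b a) = (\<lambda>s. if bval \<Omega> s b then run \<Omega> a s else s)"
| "run \<Omega> (PFor x d a) = (\<lambda>s. nassign x [] (nats s ''n'' [] + d)
     (fold (\<lambda>i u. run \<Omega> a (nassign x [] i u)) [0..<nats s ''n'' [] + d] s))"

primrec nmods :: "prog \<Rightarrow> vname list" where
  "nmods (PN x es e) = [x]"
| "nmods (PR x es e) = []"
| "nmods (a ;; b) = nmods a @ nmods b"
| "nmods (PIf b a) = nmods a"
| "nmods (PFor x d a) = x # nmods a"

primrec rmods :: "prog \<Rightarrow> vname list" where
  "rmods (PN x es e) = []"
| "rmods (PR x es e) = [x]"
| "rmods (a ;; b) = rmods a @ rmods b"
| "rmods (PIf b a) = rmods a"
| "rmods (PFor x d a) = rmods a"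

primrec wf_prog :: "prog \<Rightarrow> bool" where
  "wf_prog (PN x es e) \<longleftrightarrow> x \<noteq> ''n''"
| "wf_prog (PR x es e) \<longleftrightarrow> True"
| "wf_prog (a ;; b) \<longleftrightarrow> wf_prog a \<and> wf_prog b"
| "wf_prog (PIf b a) \<longleftrightarrow> wf_prog a"
| "wf_prog (PFor x d a) \<longleftrightarrow> x \<noteq> ''n'' \<and> x \<notin> set (nmods a) \<and> wf_prog a"

text \<open>For \<open>PFor\<close>, \<open>[:d, 1:]\<close> is the number of rounds; a round costs
  10 on top of the body, 6 for the test and 4 for the increment, and 8 covers the initialization and
  the last test. For \<open>PIf\<close>, one unit is left for \<open>SKIP\<close>.\<close>

primrec time_bound :: "prog \<Rightarrow> nat poly" where
  "time_bound (PN x es e) = [:1 + sum_list (map ncost es) + ncost e:]"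
| "time_bound (PR x es e) = [:1 + sum_list (map ncost es) + rcost e:]"
| "time_bound (a ;; b) = time_bound a + time_bound b"
| "time_bound (PIf b a) = [:2 + bcost b:] + time_bound a"
| "time_bound (PFor x d a) = [:8:] + [:d, 1:] * ([:10:] + time_bound a)"

section \<open>Frame rules and the running time bound\<close>

lemma nats_nassign: "nats (nassign x ks v s) y ls = (if y = x \<and> ls = ks then v else nats s y ls)"
  by (simp add: nassign_def)

lemma nats_nassign_other: "y \<noteq> x \<Longrightarrow> nats (nassign x ks v s) y = nats s y"
  by (simp add: nassign_def)

lemma reals_rassign: "reals (rassign x ks v s) y ls = (if y = x \<and> ls = ks then v else reals s y ls)"
  by (simp add: rassign_def)

lemma reals_rassign_other: "y \<noteq> x \<Longrightarrow> reals (rassign x ks v s) y = reals s y"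
  by (simp add: rassign_def)

lemma reals_nassign [simp]: "reals (nassign x ks v s) = reals s"
  by (simp add: nassign_def)

lemma nats_rassign [simp]: "nats (rassign x ks v s) = nats s"
  by (simp add: rassign_def)

lemma fold_invariant:
  assumes "I 0 s" and "\<And>i u. i < m \<Longrightarrow> I i u \<Longrightarrow> I (Suc i) (F i u)"
  shows "I m (fold F [0..<m] s)"
  using assms by (induction m) auto

lemma nats_run_other: "x \<notin> set (nmods a) \<Longrightarrow> nats (run \<Omega> a s) x = nats s x"
proof (induction a arbitrary: s)
  case (PFor y d a)
  have "nats (fold (\<lambda>i u. run \<Omega> a (nassign y [] i u)) [0..<m] s) x = nats s x" for m
    by (rule fold_invariant[where I = "\<lambda>i u. nats u x = nats s x"])
      (use PFor in \<open>auto simp: nats_nassign_other\<close>)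
  then show ?case using PFor.prems by (simp add: nats_nassign_other)
qed (auto simp: nats_nassign_other)

lemma reals_run_other: "x \<notin> set (rmods a) \<Longrightarrow> reals (run \<Omega> a s) x = reals s x"
proof (induction a arbitrary: s)
  case (PFor y d a)
  have "reals (fold (\<lambda>i u. run \<Omega> a (nassign y [] i u)) [0..<m] s) x = reals s x" for m
    by (rule fold_invariant[where I = "\<lambda>i u. reals u x = reals s x"])
      (use PFor in \<open>auto\<close>)
  then show ?case by simp
qed (auto simp: reals_rassign_other)

lemma wf_prog_n: "wf_prog a \<Longrightarrow> ''n'' \<notin> set (nmods a)"
  by (induction a) auto

lemma exec_run:
  assumes "wf_prog a"
  shows "\<exists>k. exec \<Omega> (com_of a) s k (run \<Omega> a s) \<and> k \<le> poly (time_bound a) (nats s ''n'' [])"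
  using assms
proof (induction a arbitrary: s)
  case (PN x es e)
  show ?case using exec.NAssign[of \<Omega> x es e s] by auto
next
  case (PR x es e)
  show ?case using exec.RAssign[of \<Omega> x es e s] by auto
next
  case (PSeq a b)
  obtain k1 where 1: "exec \<Omega> (com_of a) s k1 (run \<Omega> a s)" "k1 \<le> poly (time_bound a) (nats s ''n'' [])"
    using PSeq by force
  obtain k2 where 2: "exec \<Omega> (com_of b) (run \<Omega> a s) k2 (run \<Omega> b (run \<Omega> a s))"
    "k2 \<le> poly (time_bound b) (nats (run \<Omega> a s) ''n'' [])"
    using PSeq by force
  have "nats (run \<Omega> a s) ''n'' = nats s ''n''"
    using PSeq.prems wf_prog_n by (intro nats_run_other) auto
  then show ?case using exec.Seq[OF 1(1) 2(1)] 1(2) 2(2) by (auto intro!: exI[of _ "k1 + k2"])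
next
  case (PIf b a)
  obtain k where k: "exec \<Omega> (com_of a) s k (run \<Omega> a s)" "k \<le> poly (time_bound a) (nats s ''n'' [])"
    using PIf by force
  show ?case
  proof (cases "bval \<Omega> s b")
    case True
    with exec.CondTrue[OF True k(1), of SKIP] k(2) show ?thesis
      by (auto intro!: exI[of _ "1 + bcost b + k"])
  next
    case False
    with exec.CondFalse[OF False exec.Skip, of "com_of a"] show ?thesis
      by (auto intro!: exI[of _ "1 + bcost b + 1"])
  qed
next
  case (PFor x d a)
  let ?N = "nats s ''n'' []"
  let ?b = "NLess (NVar x []) (NPlus (NVar ''n'' []) (NConst d))"
  let ?c = "Seq (com_of a) (NAssign x [] (NPlus (NVar x []) (NConst 1)))"
  let ?F = "\<lambda>i u. run \<Omega> a (nassign x [] i u)"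
  let ?\<sigma> = "\<lambda>i. fold ?F [0..<i] s"
  let ?T = "poly (time_bound a) ?N"
  have x: "x \<noteq> ''n''" "x \<notin> set (nmods a)" "wf_prog a" using PFor.prems by auto
  have n: "nats (?\<sigma> i) ''n'' = nats s ''n''" for i
    by (rule fold_invariant[where I = "\<lambda>i u. nats u ''n'' = nats s ''n''"])
      (use x wf_prog_n in \<open>auto simp: nats_nassign_other nats_run_other\<close>)
  \<comment> \<open>The state before test number \<open>i\<close> is the \<open>fold\<close> state
    with the counter overwritten by \<open>i\<close>. The induction goes down from the last test, as
    the bound counts the rounds that remain.\<close>
  have loop: "\<exists>k. exec \<Omega> (While ?b ?c) (nassign x [] i (?\<sigma> i)) k (nassign x [] (?N + d) (?\<sigma> (?N + d)))
      \<and> k \<le> 6 + (?N + d - i) * (10 + ?T)" if "i \<le> ?N + d" for i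
    using that
  proof (induction i rule: inc_induct)
    case base
    have "\<not> bval \<Omega> (nassign x [] (?N + d) (?\<sigma> (?N + d))) ?b"
      using x n by (simp add: nats_nassign nats_nassign_other)
    from exec.WhileFalse[OF this, of ?c] show ?case by fastforce
  next
    case (step i)
    let ?u = "nassign x [] i (?\<sigma> i)"
    have b: "bval \<Omega> ?u ?b" using x n step by (simp add: nats_nassign nats_nassign_other)
    obtain k1 where k1: "exec \<Omega> (com_of a) ?u k1 (run \<Omega> a ?u)" "k1 \<le> ?T"
      using PFor.IH[OF x(3), of ?u] x n by (auto simp: nats_nassign_other)
    have s: "?\<sigma> (Suc i) = run \<Omega> a ?u" by simp
    have xi: "nats (run \<Omega> a ?u) x = nats ?u x" by (rule nats_run_other) (fact x)
    have "nval (run \<Omega> a ?u) (NPlus (NVar x []) (NConst 1)) = Suc i"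
      using xi by (simp add: nats_nassign)
    then have "exec \<Omega> (NAssign x [] (NPlus (NVar x []) (NConst 1))) (run \<Omega> a ?u) 4
        (nassign x [] (Suc i) (?\<sigma> (Suc i)))"
      using exec.NAssign[of \<Omega> x "[]" "NPlus (NVar x []) (NConst 1)" "run \<Omega> a ?u"] s
      by (simp add: eval_nat_numeral)
    from exec.Seq[OF k1(1) this] have "exec \<Omega> ?c ?u (k1 + 4) (nassign x [] (Suc i) (?\<sigma> (Suc i)))" .
    moreover obtain k2 where "exec \<Omega> (While ?b ?c) (nassign x [] (Suc i) (?\<sigma> (Suc i))) k2
         (nassign x [] (?N + d) (?\<sigma> (?N + d)))" "k2 \<le> 6 + (?N + d - Suc i) * (10 + ?T)"
      using step.IH by blast
    ultimately have "exec \<Omega> (While ?b ?c) ?u (1 + bcost ?b + (k1 + 4) + k2)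
        (nassign x [] (?N + d) (?\<sigma> (?N + d)))"
      using exec.WhileTrue[OF b] by blast
    moreover have "?N + d - i = Suc (?N + d - Suc i)" using step by simp
    then have "1 + bcost ?b + (k1 + 4) + k2 \<le> 6 + (?N + d - i) * (10 + ?T)"
      using k1(2) \<open>k2 \<le> _\<close> by (simp del: diff_Suc_1)
    ultimately show ?case by blast
  qed
  obtain k where "exec \<Omega> (While ?b ?c) (nassign x [] 0 s) k (nassign x [] (?N + d) (?\<sigma> (?N + d)))"
    "k \<le> 6 + (?N + d) * (10 + ?T)"
    using loop[of 0] by auto
  moreover have "exec \<Omega> (NAssign x [] (NConst 0)) s 2 (nassign x [] 0 s)"
    using exec.NAssign[of \<Omega> x "[]" "NConst 0" s] by (simp add: eval_nat_numeral)
  ultimately have "exec \<Omega> (com_of (PFor x d a)) s (2 + k) (run \<Omega> (PFor x d a) s)"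
    by (simp del: add_2_eq_Suc) (rule exec.Seq)
  moreover have "2 + k \<le> poly (time_bound (PFor x d a)) ?N"
    using \<open>k \<le> _\<close> by (simp add: algebra_simps)
  ultimately show ?case by blast
qed

section \<open>Invariants of loops and of nested loops\<close>

lemma run_For_invariant:
  assumes "I 0 s"
    and "\<And>i u. i < nats s ''n'' [] + d \<Longrightarrow> I i u \<Longrightarrow> I (Suc i) (run \<Omega> a (nassign x [] i u))"
    and "\<And>i v u. I i u \<Longrightarrow> I i (nassign x [] v u)"
  shows "I (nats s ''n'' [] + d) (run \<Omega> (PFor x d a) s)"
  unfolding run.simps by (rule assms(3), rule fold_invariant) (use assms in auto)

text \<open>One loop makes n + d rounds only; nesting the loops over \<open>xs\<close> multiplies
  this to a larger polynomial number of runs of the same body.\<close>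

definition repeat :: "vname list \<Rightarrow> nat \<Rightarrow> prog \<Rightarrow> prog" where
  "repeat xs d a = foldr (\<lambda>x. PFor x d) xs a"

lemma run_repeat_invariant:
  assumes "I 0 s" and n: "\<And>i u. I i u \<Longrightarrow> nats u ''n'' [] = N"
    and step: "\<And>i u. I i u \<Longrightarrow> I (Suc i) (run \<Omega> a u)"
    and ins: "\<And>i x v u. x \<in> set xs \<Longrightarrow> I i u \<Longrightarrow> I i (nassign x [] v u)"
  shows "I ((N + d) ^ length xs) (run \<Omega> (repeat xs d a) s)"
proof -
  \<comment> \<open>The starting count is arbitrary because every outer round runs the whole inner
    nest again.\<close>
  have "I (i + (N + d) ^ length xs) (run \<Omega> (repeat xs d a) u)" if "I i u" for i u
    using ins that
  proof (induction xs arbitrary: i u)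
    case Nil
    then show ?case using step by (simp add: repeat_def)
  next
    case (Cons x xs)
    have IH: "I (j + (N + d) ^ length xs) (run \<Omega> (repeat xs d a) v)" if "I j v" for j v
      using Cons that by auto
    have "I (i + (nats u ''n'' [] + d) * (N + d) ^ length xs) (run \<Omega> (PFor x d (repeat xs d a)) u)"
    proof (rule run_For_invariant[where I = "\<lambda>j u. I (i + j * (N + d) ^ length xs) u"])
      fix j v assume "I (i + j * (N + d) ^ length xs) v"
      with Cons.prems(1) have "I (i + j * (N + d) ^ length xs) (nassign x [] j v)" by simp
      from IH[OF this] show "I (i + Suc j * (N + d) ^ length xs)
          (run \<Omega> (repeat xs d a) (nassign x [] j v))"
        by (simp add: algebra_simps)
    qed (use Cons.prems in auto)
    then show ?case using n[OF Cons.prems(2)] by (simp add: repeat_def)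
  qed
  from this[OF assms(1)] show ?thesis by simp
qed

section \<open>Concave functions and staircases\<close>

text \<open>Clearing the denominator keeps the chord inequality valid on intervals of length 0,
  where all three points coincide.\<close>

lemma concave_chord:
  fixes h :: "real \<Rightarrow> real"
  assumes "concave_on {0..} h" "0 \<le> x" "x \<le> y" "y \<le> z"
  shows "h x * (z - y) + h z * (y - x) \<le> h y * (z - x)"
proof (cases "x < z")
  case True
  have "concave_on {x..z} h"
    using assms convex_on_subset unfolding concave_on_def by fastforce
  from concave_onD_Icc'[OF this, of y] True assms
  have "(h z - h x) / (z - x) * (y - x) + h x \<le> h y" by auto
  then have "((h z - h x) / (z - x) * (y - x) + h x) * (z - x) \<le> h y * (z - x)"
    using True by (intro mult_right_mono) auto
  moreover have "((h z - h x) / (z - x) * (y - x) + h x) * (z - x) = (h z - h x) * (y - x) + h x * (z - x)"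
    using True by (simp add: field_simps)
  ultimately show ?thesis by (simp add: algebra_simps)
next
  case False
  then have "y = x" "z = x" using assms by auto
  then show ?thesis by simp
qed

text \<open>The points \<open>a\<close> and \<open>b\<close> lie symmetrically between
  \<open>x\<close> and \<open>y\<close>, so their chord inequalities have mirrored coefficients and
  add up to the claim times \<open>y - x\<close>. This yields the submodularity of
  \<open>f\<close>.\<close>

lemma concave_exchange:
  fixes h :: "real \<Rightarrow> real"
  assumes "concave_on {0..} h" "0 \<le> x" "x \<le> a" "a \<le> y" "a + b = x + y"
  shows "h x + h y \<le> h a + h b"
proof (cases "x < y")
  case True
  have b: "b = x + y - a" using assms by simp
  have "(h x + h y) * (y - x) \<le> (h a + h b) * (y - x)"
    using concave_chord[OF assms(1,2), of a y] concave_chord[OF assms(1,2), of b y] assms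
    unfolding b by (simp add: algebra_simps)
  then show ?thesis using True by simp
next
  case False
  then have "a = x" "b = x" "y = x" using assms by auto
  then show ?thesis by simp
qed

text \<open>
  A staircase with \<open>n\<close> steps around a right triangle with legs \<open>F\<close> exceeds it by an area of at least
  \<open>F\<^sup>2 / (2 n)\<close>; this pays for the error \<open>\<epsilon>\<close>.
\<close>

lemma discrete_triangle_bound:
  fixes e \<phi> d r :: "nat \<Rightarrow> real"
  assumes n: "0 < n" and e0: "e 0 = 0" and en: "e n = F"
    and e_mono: "\<And>k. k < n \<Longrightarrow> e k \<le> e (Suc k)"
    and \<phi>0: "\<phi> 0 = 0" and \<phi>_mono: "\<And>k. k < n \<Longrightarrow> \<phi> k \<le> \<phi> (Suc k)"
    and \<rho>: "0 \<le> \<rho>" and \<epsilon>: "0 \<le> \<epsilon>" "3 * real n * \<epsilon> \<le> 1" and D: "0 \<le> D"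
    and d: "\<And>k. k < n \<Longrightarrow> 0 \<le> d k" "\<And>k. k < n \<Longrightarrow> \<rho> * (F - (1 + \<epsilon>) * e k) \<le> d k"
    and r: "\<And>k. k < n \<Longrightarrow> 0 \<le> r k" "\<And>k. k < n \<Longrightarrow> D - \<rho> * ((1 + \<epsilon>) * \<phi> k + \<epsilon> * F) \<le> r k"
  shows "F * (\<rho> * F + D) / 2 \<le> (\<Sum>k<n. (\<phi> (Suc k) - \<phi> k) * d k + (e (Suc k) - e k) * (d k + r k))"
proof -
  define s where "s = 1 + \<epsilon>"
  \<comment> \<open>At \<open>e k = E\<close> the lower bound for \<open>d k\<close> reaches 0;
    \<open>m\<close> stops there, so that \<open>E - m k\<close> is never negative and the bound can
    be summed by parts.\<close>
  define E where "E = F / s"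
  define m where "m k = min (e k) E" for k
  have s: "1 \<le> s" using \<epsilon> by (simp add: s_def)
  have e_nonneg: "0 \<le> e k" if "k \<le> n" for k
    using that by (induction k) (auto simp: e0 intro: order_trans[OF _ e_mono])
  then have F: "0 \<le> F" using en by auto
  have E: "0 \<le> E" "E \<le> F" "s * E = F"
    using F s mult_left_mono[OF s F] by (auto simp: E_def field_simps)
  have "1 * \<epsilon> \<le> real n * \<epsilon>" using n \<epsilon> by (intro mult_right_mono) auto
  then have \<epsilon>1: "\<epsilon> \<le> 1 / 3" using \<epsilon> by auto
  have \<epsilon>n: "3 * \<epsilon> \<le> 1 / real n" using \<epsilon> n by (simp add: field_simps)
  \<comment> \<open>For a step \<open>x = e (Suc k) - e k\<close>, the product
    \<open>x * e k\<close> is half the difference of the squares minus \<open>x\<^sup>2 / 2\<close>.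
    The excess \<open>s * x\<^sup>2 / 2\<close> of the staircase over the triangle is bounded below
    by its tangent at the equal step \<open>F / n\<close>, after which everything
    telescopes.\<close>
  let ?t1 = "\<lambda>k. (e (Suc k) - e k) * F - s / 2 * ((e (Suc k))\<^sup>2 - (e k)\<^sup>2)
     + s * F / n * (e (Suc k) - e k) - s * F\<^sup>2 / (2 * n\<^sup>2)"
  have 1: "\<rho> * ?t1 k \<le> (e (Suc k) - e k) * d k" if "k < n" for k
  proof -
    have "0 \<le> s / 2 * ((e (Suc k) - e k) - F / n)\<^sup>2" using s by simp
    then have "?t1 k \<le> (e (Suc k) - e k) * (F - s * e k)"
      by (simp add: power2_eq_square algebra_simps add_divide_distrib diff_divide_distrib)
    then have "\<rho> * ?t1 k \<le> \<rho> * ((e (Suc k) - e k) * (F - s * e k))"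
      using \<rho> by (rule mult_left_mono)
    also have "\<dots> = (e (Suc k) - e k) * (\<rho> * (F - s * e k))" by simp
    also have "\<dots> \<le> (e (Suc k) - e k) * d k"
      using d(2)[OF that] e_mono[OF that] by (intro mult_left_mono) (auto simp: s_def)
    finally show ?thesis .
  qed
  have "(\<Sum>k<n. ?t1 k) = F * (\<Sum>k<n. e (Suc k) - e k) - s / 2 * (\<Sum>k<n. (e (Suc k))\<^sup>2 - (e k)\<^sup>2)
     + s * F / n * (\<Sum>k<n. e (Suc k) - e k) - n * (s * F\<^sup>2 / (2 * n\<^sup>2))"
    by (simp add: sum.distrib sum_subtractf sum_distrib_left[symmetric] sum_distrib_right[symmetric]
        sum_divide_distrib[symmetric])
  also have "\<dots> = F\<^sup>2 * (1 - s / 2 + s / (2 * n))"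
    unfolding sum_lessThan_telescope[of e] sum_lessThan_telescope[of "\<lambda>k. (e k)\<^sup>2"]
    using n by (simp add: e0 en power2_eq_square field_simps)
  finally have s1: "\<rho> * F\<^sup>2 * (1 - s / 2 + s / (2 * n)) \<le> (\<Sum>k<n. (e (Suc k) - e k) * d k)"
    using sum_mono[of "{..<n}" "\<lambda>k. \<rho> * ?t1 k" "\<lambda>k. (e (Suc k) - e k) * d k"] 1
    by (simp add: sum_distrib_left[symmetric] mult.assoc)
  \<comment> \<open>Summation by parts: up to the nonnegative product of the increments of
    \<open>\<phi>\<close> and \<open>m\<close>, the terms with \<open>\<phi>\<close> are differences
    of \<open>\<phi> k * (E - m k)\<close>, which is 0 at both ends. What remains is a strip of
    width \<open>E\<close> and height \<open>D\<close>, up to the error.\<close>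
  let ?t2 = "\<lambda>k. \<rho> * s * (\<phi> (Suc k) * (E - m (Suc k)) - \<phi> k * (E - m k))
      + (D - \<rho> * \<epsilon> * F) * (m (Suc k) - m k)"
  have 2: "?t2 k \<le> (\<phi> (Suc k) - \<phi> k) * d k + (e (Suc k) - e k) * r k" if k: "k < n" for k
  proof -
    have m: "0 \<le> m (Suc k) - m k" "m (Suc k) - m k \<le> e (Suc k) - e k"
      using e_mono[OF k] by (auto simp: m_def)
    have dk: "\<rho> * s * (E - m k) \<le> d k"
    proof (cases "e k \<le> E")
      case True
      have "s * (E - m k) = F - s * e k" using True E by (simp add: m_def algebra_simps)
      then have "\<rho> * s * (E - m k) = \<rho> * (F - s * e k)" by (simp add: mult.assoc)
      also have "\<dots> \<le> d k" using d(2)[OF k] unfolding s_def .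
      finally show ?thesis .
    qed (use d(1)[OF k] in \<open>simp add: m_def\<close>)
    have "(\<phi> (Suc k) - \<phi> k) * (\<rho> * s * (E - m k)) \<le> (\<phi> (Suc k) - \<phi> k) * d k"
      using dk \<phi>_mono[OF k] by (intro mult_left_mono) auto
    moreover have "(m (Suc k) - m k) * (D - \<rho> * (s * \<phi> k + \<epsilon> * F)) \<le> (m (Suc k) - m k) * r k"
      using r(2)[OF k] m by (intro mult_left_mono) (auto simp: s_def)
    moreover have "(m (Suc k) - m k) * r k \<le> (e (Suc k) - e k) * r k"
      using r(1)[OF k] m by (intro mult_right_mono) auto
    moreover have "0 \<le> \<rho> * s * ((\<phi> (Suc k) - \<phi> k) * (m (Suc k) - m k))"
      using \<rho> s m \<phi>_mono[OF k] by simp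
    ultimately show ?thesis by (simp add: algebra_simps)
  qed
  have m0n: "m 0 = 0" "m n = E" using E by (auto simp: m_def e0 en)
  have "(\<Sum>k<n. ?t2 k) = \<rho> * s * (\<Sum>k<n. \<phi> (Suc k) * (E - m (Suc k)) - \<phi> k * (E - m k))
      + (D - \<rho> * \<epsilon> * F) * (\<Sum>k<n. m (Suc k) - m k)"
    by (simp only: sum.distrib sum_distrib_left)
  also have "(\<Sum>k<n. \<phi> (Suc k) * (E - m (Suc k)) - \<phi> k * (E - m k)) = 0"
    using sum_lessThan_telescope[of "\<lambda>k. \<phi> k * (E - m k)" n] by (simp add: \<phi>0 m0n)
  also have "(\<Sum>k<n. m (Suc k) - m k) = E"
    using sum_lessThan_telescope[of m n] by (simp add: m0n)
  finally have "(\<Sum>k<n. ?t2 k) = (D - \<rho> * \<epsilon> * F) * E" by simp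
  then have s2: "(D - \<rho> * \<epsilon> * F) * E \<le> (\<Sum>k<n. (\<phi> (Suc k) - \<phi> k) * d k + (e (Suc k) - e k) * r k)"
    using sum_mono[of "{..<n}" ?t2 "\<lambda>k. (\<phi> (Suc k) - \<phi> k) * d k + (e (Suc k) - e k) * r k"] 2
    by simp
  \<comment> \<open>Here the slack is spent: the staircase excess \<open>s / (2 * n)\<close> pays
    for the \<open>\<epsilon> / 2\<close> lost in the triangle and the \<open>\<epsilon>\<close>
    lost in the strip, which needs \<open>3 * n * \<epsilon> \<le> 1\<close>.\<close>
  have "(s - 1) / 2 + \<epsilon> \<le> s / (2 * n)"
  proof -
    have "1 / (2 * real n) \<le> s / (2 * n)" using s by (simp add: divide_right_mono)
    moreover have "3 * \<epsilon> / 2 \<le> 1 / (2 * real n)" using \<epsilon>n by simp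
    moreover have "(s - 1) / 2 + \<epsilon> = 3 * \<epsilon> / 2" by (simp add: s_def)
    ultimately show ?thesis by linarith
  qed
  then have "\<rho> * F\<^sup>2 * (1 / 2 + \<epsilon>) \<le> \<rho> * F\<^sup>2 * (1 - s / 2 + s / (2 * n))"
    using \<rho> by (intro mult_left_mono) (auto simp: diff_divide_distrib)
  moreover have "\<rho> * \<epsilon> * F * E \<le> \<rho> * \<epsilon> * F * F" using \<rho> \<epsilon> F E by (intro mult_left_mono) auto
  moreover have "D * F / 2 \<le> D * E"
    unfolding times_divide_eq_right[symmetric]
  proof (rule mult_left_mono)
    have "s * E \<le> 2 * E" using E \<epsilon>1 by (intro mult_right_mono) (auto simp: s_def)
    then show "F / 2 \<le> E" using E by simp
  qed (fact D)
  ultimately have "F * (\<rho> * F + D) / 2 \<le> \<rho> * F\<^sup>2 * (1 - s / 2 + s / (2 * n)) + (D - \<rho> * \<epsilon> * F) * E"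
    by (simp add: ring_distribs power2_eq_square mult.assoc add_divide_distrib mult.left_commute mult.commute)
  also have "\<dots> \<le> (\<Sum>k<n. (\<phi> (Suc k) - \<phi> k) * d k + (e (Suc k) - e k) * (d k + r k))"
    using add_mono[OF s1 s2] by (simp add: sum.distrib[symmetric] algebra_simps)
  finally show ?thesis .
qed

section \<open>Multiplicative weights over the base polytope of a supermodular function\<close>

text \<open>
  The elements are ordered by decreasing weight, ties being broken by index. The threshold of \<open>k\<close>
  is the initial segment up to \<open>k\<close>, including \<open>k\<close> for \<open>e = 1\<close> and excluding it for \<open>e = 0\<close>, which
  makes sorting unnecessary.
\<close>

definition threshold :: "nat \<Rightarrow> (nat \<Rightarrow> real) \<Rightarrow> nat \<Rightarrow> nat \<Rightarrow> nat set" where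
  "threshold N c k e = {i. i < N \<and> (c k < c i \<or> c k \<le> c i \<and> i < k + e)}"

text \<open>Coordinate \<open>k\<close> of the vertex that Edmonds' greedy algorithm finds in the
  base polytope, which consists of the vectors \<open>y\<close> with \<open>y A \<ge> G A\<close> on
  all sets and equality on the ground set. For supermodular \<open>G\<close> it minimizes the
  product with \<open>c\<close>: heavy elements come first and receive small marginal
  values.\<close>

definition greedy :: "nat \<Rightarrow> (nat set \<Rightarrow> real) \<Rightarrow> (nat \<Rightarrow> real) \<Rightarrow> nat \<Rightarrow> real" where
  "greedy N G c k = G (threshold N c k 1) - G (threshold N c k 0)"

lemma threshold_subset: "threshold N c k e \<subseteq> {..<N}"
  by (auto simp: threshold_def)

lemma threshold_cong:
  assumes "\<And>i. i < N \<Longrightarrow> c i = c' i" "k < N"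
  shows "threshold N c k e = threshold N c' k e"
  using assms by (auto simp: threshold_def)

text \<open>The thresholds form a chain, and dropping the lightest element of one, with the largest
  index among ties, gives the next smaller one. In the proof, closure under the thresholds of its
  own elements characterizes a member of the chain, so no sorted list appears.\<close>

lemma threshold_induct:
  assumes empty: "P {}"
    and step: "\<And>F m. F \<subseteq> {..<N} \<Longrightarrow> m \<in> F \<Longrightarrow> (\<forall>k\<in>F. c m \<le> c k) \<Longrightarrow> threshold N c m 1 = F \<Longrightarrow>
      threshold N c m 0 = F - {m} \<Longrightarrow> P (F - {m}) \<Longrightarrow> P F"
  shows "P {..<N}"
proof -
  have "P F" if "F \<subseteq> {..<N}" "\<forall>k\<in>F. threshold N c k 1 \<subseteq> F" for F
    using that
  proof (induction "card F" arbitrary: F)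
    case 0
    then have "F = {}" using finite_subset by fastforce
    then show ?case using empty by simp
  next
    case (Suc l)
    have fin: "finite F" using Suc.prems(1) finite_subset by blast
    have ne: "F \<noteq> {}" using Suc.hyps(2) by auto
    define v where "v = Min (c ` F)"
    have v: "v \<in> c ` F" "\<forall>k\<in>F. v \<le> c k" using fin ne by (auto simp: v_def)
    define m where "m = Max {i \<in> F. c i = v}"
    have "m \<in> {i \<in> F. c i = v}" unfolding m_def using fin v(1) by (intro Max_in) auto
    then have m: "m \<in> F" "c m = v" by auto
    have m_max: "i \<le> m" if "i \<in> F" "c i = v" for i
      unfolding m_def using that fin by (intro Max_ge) auto
    have T1: "threshold N c m 1 = F"
    proof
      show "threshold N c m 1 \<subseteq> F" using Suc.prems m by blast
      show "F \<subseteq> threshold N c m 1"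
        using Suc.prems(1) v(2) m m_max by (force simp: threshold_def less_Suc_eq_le)
    qed
    have T0: "threshold N c m 0 = F - {m}"
      unfolding T1[symmetric] by (auto simp: threshold_def)
    have "P (F - {m})"
    proof (rule Suc.hyps(1))
      show "\<forall>k\<in>F - {m}. threshold N c k 1 \<subseteq> F - {m}"
      proof
        fix k assume k: "k \<in> F - {m}"
        have "m \<notin> threshold N c k 1"
          using k v(2) m m_max[of k] by (force simp: threshold_def)
        then show "threshold N c k 1 \<subseteq> F - {m}" using Suc.prems(2) k by blast
      qed
    qed (use Suc m fin in auto)
    then show ?case using step[of F m] Suc.prems(1) m v T1 T0 by auto
  qed
  from this[of "{..<N}"] show ?thesis using threshold_subset by blast
qed

text \<open>By supermodularity, \<open>m\<close> adds at least as much to \<open>F - {m}\<close> as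
  to the part of this set in \<open>A\<close>. Hence the greedy vector lies in the base
  polytope.\<close>

lemma greedy_sum_ge:
  assumes G0: "G {} = 0" and A: "A \<subseteq> {..<N}"
    and super: "\<And>X Y. X \<subseteq> {..<N} \<Longrightarrow> Y \<subseteq> {..<N} \<Longrightarrow> G X + G Y \<le> G (X \<union> Y) + G (X \<inter> Y)"
  shows "G A \<le> (\<Sum>k\<in>A. greedy N G c k)"
proof -
  have "G ({..<N} \<inter> A) \<le> (\<Sum>k\<in>{..<N} \<inter> A. greedy N G c k)"
  proof (rule threshold_induct[where N = N and c = c and P = "\<lambda>F. G (F \<inter> A) \<le> (\<Sum>k\<in>F \<inter> A. greedy N G c k)"])
    fix F m assume F: "F \<subseteq> {..<N}" "m \<in> F" "threshold N c m 1 = F" "threshold N c m 0 = F - {m}"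
      and IH: "G ((F - {m}) \<inter> A) \<le> (\<Sum>k\<in>(F - {m}) \<inter> A. greedy N G c k)"
    have fin: "finite F" using F(1) finite_subset by blast
    show "G (F \<inter> A) \<le> (\<Sum>k\<in>F \<inter> A. greedy N G c k)"
    proof (cases "m \<in> A")
      case True
      have "G (F \<inter> A) + G (F - {m}) \<le> G ((F \<inter> A) \<union> (F - {m})) + G ((F \<inter> A) \<inter> (F - {m}))"
        using F(1) by (intro super) auto
      also have "(F \<inter> A) \<union> (F - {m}) = F" using True F(2) by auto
      also have "(F \<inter> A) \<inter> (F - {m}) = (F - {m}) \<inter> A" by auto
      finally have "G (F \<inter> A) \<le> greedy N G c m + G ((F - {m}) \<inter> A)"
        using F by (simp add: greedy_def)
      moreover have "F \<inter> A = insert m ((F - {m}) \<inter> A)" using True F(2) by auto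
      then have "(\<Sum>k\<in>F \<inter> A. greedy N G c k) = greedy N G c m + (\<Sum>k\<in>(F - {m}) \<inter> A. greedy N G c k)"
        using fin by simp
      ultimately show ?thesis using IH by simp
    next
      case False
      then have "F \<inter> A = (F - {m}) \<inter> A" by auto
      then show ?thesis using IH by simp
    qed
  qed (simp add: G0)
  moreover have "{..<N} \<inter> A = A" using A by auto
  ultimately show ?thesis by simp
qed

text \<open>Summation by parts along the chain writes the difference of both sides as a nonnegative
  combination of the slacks of the thresholds. So a density bound on the thresholds met by the
  algorithm is enough.\<close>

lemma greedy_weighted_le:
  assumes G0: "G {} = 0" and c: "\<And>k. k < N \<Longrightarrow> 0 \<le> c k"
    and le: "\<And>k. k < N \<Longrightarrow> G (threshold N c k 1) \<le> \<Lambda> * sum cap (threshold N c k 1)"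
  shows "(\<Sum>k<N. c k * greedy N G c k) \<le> \<Lambda> * (\<Sum>k<N. c k * cap k)"
proof -
  \<comment> \<open>\<open>v\<close> is a level below all weights in \<open>F\<close> at which the
    slack of \<open>F\<close> is still to be paid. The induction uses the level \<open>c m\<close>
    for \<open>F - {m}\<close>, and \<open>v = 0\<close> gives the claim.\<close>
  let ?P = "\<lambda>F. \<forall>v\<ge>0. (\<forall>k\<in>F. v \<le> c k) \<longrightarrow>
    v * (\<Lambda> * sum cap F - G F) \<le> (\<Sum>k\<in>F. c k * (\<Lambda> * cap k - greedy N G c k))"
  have "?P {..<N}"
  proof (rule threshold_induct[where N = N and c = c and P = ?P])
    show "?P {}" by (simp add: G0)
    fix F m assume F: "F \<subseteq> {..<N}" "m \<in> F" "\<forall>k\<in>F. c m \<le> c k" "threshold N c m 1 = F"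
      "threshold N c m 0 = F - {m}" and IH: "?P (F - {m})"
    have fin: "finite F" using F(1) finite_subset by blast
    have mN: "m < N" using F by auto
    show "?P F"
    proof (intro allI impI)
      fix v :: real assume v: "0 \<le> v" "\<forall>k\<in>F. v \<le> c k"
      have "v * (\<Lambda> * sum cap F - G F) \<le> c m * (\<Lambda> * sum cap F - G F)"
        using v F le[OF mN] by (intro mult_right_mono) auto
      also have "\<dots> = c m * (\<Lambda> * sum cap (F - {m}) - G (F - {m})) + c m * (\<Lambda> * cap m - greedy N G c m)"
        using F fin by (simp add: greedy_def sum.remove[of F m] algebra_simps)
      also have "\<dots> \<le> (\<Sum>k\<in>F - {m}. c k * (\<Lambda> * cap k - greedy N G c k)) + c m * (\<Lambda> * cap m - greedy N G c m)"
        using IH c[OF mN] F(3) by (intro add_right_mono) auto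
      also have "\<dots> = (\<Sum>k\<in>F. c k * (\<Lambda> * cap k - greedy N G c k))"
        using F(2) fin by (simp add: sum.remove[of F m])
      finally show "v * (\<Lambda> * sum cap F - G F) \<le> \<dots>" .
    qed
  qed
  then have "0 * (\<Lambda> * sum cap {..<N} - G {..<N}) \<le> (\<Sum>k<N. c k * (\<Lambda> * cap k - greedy N G c k))"
    using c by blast
  then show ?thesis by (simp add: algebra_simps sum_subtractf sum_distrib_left)
qed

text \<open>Dividing by this number turns the largest ratio into 1. The 0 in the maximum is the
  start value of the running maximum in the program.\<close>

definition rate :: "nat \<Rightarrow> (nat set \<Rightarrow> real) \<Rightarrow> (nat \<Rightarrow> real) \<Rightarrow> (nat \<Rightarrow> real) \<Rightarrow> real" where
  "rate N G cap c = Max (insert 0 ((\<lambda>k. greedy N G c k / cap k) ` {..<N}))"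

primrec weights :: "real \<Rightarrow> nat \<Rightarrow> (nat set \<Rightarrow> real) \<Rightarrow> (nat \<Rightarrow> real) \<Rightarrow> nat \<Rightarrow> nat \<Rightarrow> real" where
  "weights \<epsilon> N G cap 0 = (\<lambda>k. 1 / cap k)"
| "weights \<epsilon> N G cap (Suc t) = (\<lambda>k. weights \<epsilon> N G cap t k *
     (1 + \<epsilon> * (greedy N G (weights \<epsilon> N G cap t) k / cap k / rate N G cap (weights \<epsilon> N G cap t))))"

text \<open>
  Following Garg and Koenemann, each step is scaled such that some capacity ratio grows by exactly
  one, which makes the number of iterations independent of the numbers in the input.
\<close>

theorem multiplicative_weights:
  fixes G :: "nat set \<Rightarrow> real" and cap :: "nat \<Rightarrow> real"
  assumes G0: "G {} = 0" and G_mono: "\<And>X Y. X \<subseteq> Y \<Longrightarrow> Y \<subseteq> {..<N} \<Longrightarrow> G X \<le> G Y"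
    and super: "\<And>X Y. X \<subseteq> {..<N} \<Longrightarrow> Y \<subseteq> {..<N} \<Longrightarrow> G X + G Y \<le> G (X \<union> Y) + G (X \<inter> Y)"
    and cap: "\<And>k. k < N \<Longrightarrow> 0 < cap k"
    and \<epsilon>: "0 < \<epsilon>" "\<epsilon> \<le> 1 / 2" and \<Lambda>: "0 \<le> \<Lambda>"
    and K: "(real N)\<^sup>2 \<le> real K * \<epsilon>\<^sup>2"
    and le: "\<And>t k. t < K \<Longrightarrow> k < N \<Longrightarrow> G (threshold N (weights \<epsilon> N G cap t) k 1) \<le>
       \<Lambda> * sum cap (threshold N (weights \<epsilon> N G cap t) k 1)"
    and A: "A \<subseteq> {..<N}"
  shows "(1 - 2 * \<epsilon>) * G A \<le> \<Lambda> * sum cap A"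
\<comment> \<open>Without any gain the rate may be 0 and the scaling meaningless, but then the claim
  is trivial.\<close>
proof (cases "0 < G {..<N}")
  case False
  then have "G A \<le> 0" using G_mono[OF A] by auto
  then have "(1 - 2 * \<epsilon>) * G A \<le> 0" using \<epsilon> by (simp add: mult_nonneg_nonpos)
  also have "0 \<le> \<Lambda> * sum cap A"
    using A cap \<Lambda> by (intro mult_nonneg_nonneg sum_nonneg) (auto simp: less_imp_le)
  finally show ?thesis .
next
  case GN: True
  then have N: "0 < N" using G0 by (cases N) auto
  define c where "c = weights \<epsilon> N G cap"
  define y where "y t = greedy N G (c t)" for t
  define r where "r t = rate N G cap (c t)" for t
  define x where "x t k = y t k / cap k / r t" for t k
  have c_Suc: "c (Suc t) k = c t k * (1 + \<epsilon> * x t k)" for t k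
    by (simp add: c_def x_def y_def r_def)
  have y0: "0 \<le> y t k" for t k
    unfolding y_def greedy_def by (auto intro!: G_mono simp: threshold_def)
  have r_ge: "y t k / cap k \<le> r t" if "k < N" for t k
    unfolding r_def rate_def y_def using that by (intro Max_ge) auto
  have "G {..<N} \<le> (\<Sum>k<N. y t k)" for t
    unfolding y_def by (rule greedy_sum_ge) (use G0 super in auto)
  then have "\<exists>k<N. 0 < y t k" for t
    using GN by (metis (no_types, lifting) lessThan_iff linorder_not_less order_less_le_trans sum_nonpos)
  then have r: "0 < r t" for t
    using r_ge cap by (meson divide_pos_pos order_less_le_trans)
  have r_in: "\<exists>k<N. y t k / cap k = r t" for t
  proof -
    have "r t \<in> insert 0 ((\<lambda>k. y t k / cap k) ` {..<N})"
      unfolding r_def rate_def y_def by (intro Max_in) auto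
    then show ?thesis using r[of t] by auto
  qed
  have x0: "0 \<le> x t k" if "k < N" for t k
    unfolding x_def using y0 r[of t] cap[OF that] by simp
  have x1: "x t k \<le> 1" if "k < N" for t k
    unfolding x_def using r_ge[OF that, of t] r[of t] by (simp del: divide_divide_eq_left)
  have cpos: "0 < c t k" if "k < N" for t k
  proof (induction t)
    case 0
    then show ?case using cap[OF that] by (simp add: c_def)
  next
    case (Suc t)
    have "0 < 1 + \<epsilon> * x t k" using x0[OF that, of t] \<epsilon> by (simp add: add_pos_nonneg)
    then show ?case using Suc c_Suc by simp
  qed
  \<comment> \<open>The vectors \<open>y t\<close>, each taken \<open>1 / r t\<close> times, are
    added up: \<open>load k\<close> is the total use of capacity \<open>k\<close> relative to it,
    \<open>Z\<close> the total multiplicity, and \<open>D\<close> the potential.\<close>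
  define load where "load k = (\<Sum>t<K. x t k)" for k
  define Z where "Z = (\<Sum>t<K. 1 / r t)"
  define D where "D t = (\<Sum>k<N. c t k * cap k)" for t
  have D0: "D 0 = N"
  proof -
    have "c 0 k * cap k = 1" if "k < N" for k using cap[OF that] by (simp add: c_def)
    then show ?thesis by (simp add: D_def)
  qed
  \<comment> \<open>The greedy vertex is cheap under the current weights, so the growth of the
    potential is governed by \<open>\<Lambda>\<close>.\<close>
  have D_Suc: "D (Suc t) \<le> D t * exp (\<epsilon> * \<Lambda> / r t)" if "t < K" for t
  proof -
    have Dt: "0 \<le> D t" unfolding D_def using cpos cap by (intro sum_nonneg) (auto simp: less_imp_le)
    have "D (Suc t) = D t + \<epsilon> / r t * (\<Sum>k<N. c t k * y t k)"
    proof -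
      have "c (Suc t) k * cap k = c t k * cap k + \<epsilon> / r t * (c t k * y t k)" if "k < N" for k
        using cap[OF that] r[of t] by (simp add: c_Suc x_def field_simps)
      then show ?thesis by (simp add: D_def sum.distrib sum_distrib_left)
    qed
    also have "(\<Sum>k<N. c t k * y t k) \<le> \<Lambda> * D t"
      unfolding y_def D_def
      by (rule greedy_weighted_le) (use G0 cpos le[OF that] in \<open>auto simp: c_def less_imp_le\<close>)
    then have "D t + \<epsilon> / r t * (\<Sum>k<N. c t k * y t k) \<le> D t + \<epsilon> / r t * (\<Lambda> * D t)"
      using \<epsilon> r[of t] by (intro add_left_mono mult_left_mono) auto
    also have "\<dots> = D t * (1 + \<epsilon> * \<Lambda> / r t)" by (simp add: algebra_simps)
    also have "\<dots> \<le> D t * exp (\<epsilon> * \<Lambda> / r t)"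
      using Dt by (intro mult_left_mono exp_ge_add_one_self) auto
    finally show ?thesis .
  qed
  have D_le: "D t \<le> N * exp (\<epsilon> * \<Lambda> * (\<Sum>u<t. 1 / r u))" if "t \<le> K" for t
    using that
  proof (induction t)
    case 0
    then show ?case by (simp add: D0)
  next
    case (Suc t)
    have "D (Suc t) \<le> D t * exp (\<epsilon> * \<Lambda> / r t)" using D_Suc Suc by simp
    also have "\<dots> \<le> N * exp (\<epsilon> * \<Lambda> * (\<Sum>u<t. 1 / r u)) * exp (\<epsilon> * \<Lambda> / r t)"
      using Suc by (intro mult_right_mono) auto
    also have "\<dots> = N * exp (\<epsilon> * \<Lambda> * (\<Sum>u<Suc t. 1 / r u))"
      by (simp add: exp_add[symmetric] algebra_simps)
    finally show ?case .
  qed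
  \<comment> \<open>Since \<open>x t k \<le> 1\<close>, the bound
    \<open>ln (1 + z) \<ge> z - z\<^sup>2\<close> loses only a factor \<open>1 - \<epsilon>\<close>
    in the exponent. A heavily used capacity thus forces a large potential.\<close>
  have c_ge: "exp (\<epsilon> * (1 - \<epsilon>) * (\<Sum>u<t. x u k)) \<le> c t k * cap k" if k: "k < N" for t k
  proof (induction t)
    case 0
    then show ?case using cap[OF k] by (simp add: c_def)
  next
    case (Suc t)
    have "exp (\<epsilon> * (1 - \<epsilon>) * x t k) \<le> 1 + \<epsilon> * x t k"
    proof -
      have ex: "0 \<le> \<epsilon> * x t k" "\<epsilon> * x t k \<le> 1"
        using \<epsilon> x0[OF k, of t] x1[OF k, of t] mult_mono[of \<epsilon> 1 "x t k" 1] by auto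
      have "\<epsilon> * (1 - \<epsilon>) * x t k \<le> \<epsilon> * x t k - (\<epsilon> * x t k)\<^sup>2"
      proof -
        have "\<epsilon>\<^sup>2 * (x t k * x t k) \<le> \<epsilon>\<^sup>2 * (x t k * 1)"
          using x0[OF k, of t] x1[OF k, of t] by (intro mult_left_mono) auto
        then show ?thesis by (simp add: power2_eq_square algebra_simps)
      qed
      also have "\<dots> \<le> ln (1 + \<epsilon> * x t k)" using ln_one_plus_pos_lower_bound[OF ex] by simp
      finally have "exp (\<epsilon> * (1 - \<epsilon>) * x t k) \<le> exp (ln (1 + \<epsilon> * x t k))" by simp
      then show ?thesis using ex by simp
    qed
    then have "exp (\<epsilon> * (1 - \<epsilon>) * (\<Sum>u<t. x u k)) * exp (\<epsilon> * (1 - \<epsilon>) * x t k) \<le>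
        c t k * cap k * (1 + \<epsilon> * x t k)"
      using Suc cpos[OF k, of t] cap[OF k] by (intro mult_mono) auto
    then show ?case by (simp add: exp_add[symmetric] c_Suc algebra_simps)
  qed
  have load_le: "(1 - \<epsilon>) * load k \<le> N / \<epsilon> + \<Lambda> * Z" if k: "k < N" for k
  proof -
    have "exp (\<epsilon> * (1 - \<epsilon>) * load k) \<le> c K k * cap k" using c_ge[OF k, of K] by (simp add: load_def)
    also have "\<dots> \<le> D K"
      unfolding D_def using k cpos cap by (intro member_le_sum) (auto simp: less_imp_le)
    also have "\<dots> \<le> N * exp (\<epsilon> * \<Lambda> * Z)" using D_le[of K] by (simp add: Z_def)
    \<comment> \<open>Using \<open>N \<le> exp N\<close> instead of a logarithm of \<open>N\<close>
      keeps the required number of iterations at the rational expression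
      \<open>N\<^sup>2 / \<epsilon>\<^sup>2\<close>.\<close>
    also have "\<dots> \<le> exp N * exp (\<epsilon> * \<Lambda> * Z)"
      using exp_ge_add_one_self[of "real N"] by (intro mult_right_mono) (linarith, simp)
    finally have "\<epsilon> * (1 - \<epsilon>) * load k \<le> N + \<epsilon> * \<Lambda> * Z" by (simp add: exp_add[symmetric])
    then have "\<epsilon> * ((1 - \<epsilon>) * load k) / \<epsilon> \<le> (N + \<epsilon> * \<Lambda> * Z) / \<epsilon>"
      using \<epsilon> by (intro divide_right_mono) auto
    then show ?thesis using \<epsilon> by (simp add: add_divide_distrib)
  qed
  define M where "M = Max (load ` {..<N})"
  have M_in: "M \<in> load ` {..<N}" unfolding M_def using N by (intro Max_in) auto
  have M_ge: "load k \<le> M" if "k < N" for k unfolding M_def using that by (intro Max_ge) auto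
  \<comment> \<open>By the scaling, each round raises some load by exactly 1.\<close>
  have "real K \<le> (\<Sum>t<K. \<Sum>k<N. x t k)"
  proof -
    have "1 \<le> (\<Sum>k<N. x t k)" for t
    proof -
      obtain k where k: "k < N" "y t k / cap k = r t" using r_in by blast
      then have "x t k = 1" using r[of t] by (simp add: x_def)
      moreover have "x t k \<le> (\<Sum>k<N. x t k)" using k x0 by (intro member_le_sum) auto
      ultimately show ?thesis by simp
    qed
    from sum_mono[of "{..<K}", OF this] show ?thesis by simp
  qed
  also have "\<dots> = (\<Sum>k<N. load k)" unfolding load_def by (rule sum.swap)
  also have "\<dots> \<le> N * M" using sum_bounded_above[of "{..<N}" load M] M_ge by simp
  finally have KM: "real K \<le> N * M" .
  \<comment> \<open>The number of rounds makes the additive loss \<open>N / \<epsilon>\<close> at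
    most a second fraction \<open>\<epsilon>\<close> of the largest load, whence
    \<open>1 - 2 * \<epsilon>\<close>.\<close>
  have "N / \<epsilon> \<le> \<epsilon> * M"
  proof -
    have "(real N)\<^sup>2 \<le> N * M * \<epsilon>\<^sup>2" using K mult_right_mono[OF KM, of "\<epsilon>\<^sup>2"] by simp
    then have "real N * real N \<le> real N * (M * \<epsilon>\<^sup>2)" by (simp add: power2_eq_square algebra_simps)
    then have "N \<le> M * \<epsilon>\<^sup>2" using N by simp
    then show ?thesis using \<epsilon> by (simp add: field_simps power2_eq_square)
  qed
  moreover have "(1 - \<epsilon>) * M \<le> N / \<epsilon> + \<Lambda> * Z" using M_in load_le by auto
  ultimately have MZ: "(1 - 2 * \<epsilon>) * M \<le> \<Lambda> * Z" by (simp add: algebra_simps)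
  have "0 < K" using K N by (cases K) auto
  then have Z: "0 < Z" unfolding Z_def using r by (intro sum_pos) auto
  \<comment> \<open>Every \<open>y t\<close> dominates \<open>G\<close> on \<open>A\<close>, so the
    accumulated vector compares \<open>Z * G A\<close> with the loads on \<open>A\<close>.\<close>
  have "Z * G A = (\<Sum>t<K. G A / r t)" by (simp add: Z_def sum_distrib_right)
  also have "\<dots> \<le> (\<Sum>t<K. \<Sum>k\<in>A. cap k * x t k)"
  proof (rule sum_mono)
    fix t
    have "G A \<le> (\<Sum>k\<in>A. y t k)" unfolding y_def by (rule greedy_sum_ge) (use G0 super A in auto)
    then have "G A / r t \<le> (\<Sum>k\<in>A. y t k) / r t" using r[of t] by (intro divide_right_mono) auto
    also have "\<dots> = (\<Sum>k\<in>A. cap k * x t k)"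
      unfolding sum_divide_distrib
    proof (rule sum.cong)
      fix k assume "k \<in> A"
      then have "0 < cap k" using A cap by auto
      then show "y t k / r t = cap k * x t k" by (simp add: x_def)
    qed simp
    finally show "G A / r t \<le> (\<Sum>k\<in>A. cap k * x t k)" .
  qed
  also have "\<dots> = (\<Sum>k\<in>A. cap k * load k)"
    unfolding load_def sum_distrib_left by (rule sum.swap)
  also have "\<dots> \<le> (\<Sum>k\<in>A. cap k * M)"
    using A cap M_ge by (intro sum_mono mult_left_mono) (auto simp: less_imp_le subset_iff)
  also have "\<dots> = sum cap A * M" by (simp add: sum_distrib_right)
  finally have "(1 - 2 * \<epsilon>) * (Z * G A) \<le> (1 - 2 * \<epsilon>) * (sum cap A * M)"
    using \<epsilon> by (intro mult_left_mono) auto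
  also have "\<dots> = sum cap A * ((1 - 2 * \<epsilon>) * M)" by simp
  also have "\<dots> \<le> sum cap A * (\<Lambda> * Z)"
    using MZ A cap by (intro mult_left_mono sum_nonneg) (auto simp: less_imp_le)
  finally have "Z * ((1 - 2 * \<epsilon>) * G A) \<le> Z * (\<Lambda> * sum cap A)" by (simp add: mult_ac)
  then show ?thesis using Z by simp
qed

section \<open>The decomposition into nearly densest ideals\<close>

locale scheduling =
  fixes n :: nat and p :: "nat \<Rightarrow> real" and prec :: "nat \<Rightarrow> nat \<Rightarrow> bool"
    and w :: "nat set \<Rightarrow> real" and h :: "real \<Rightarrow> real"
  assumes p_nonneg: "j < n \<Longrightarrow> 0 \<le> p j"
    and prec_irrefl: "irreflp_on {..<n} prec" and prec_trans: "transp_on {..<n} prec"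
    and w_nonneg: "A \<subseteq> {..<n} \<Longrightarrow> 0 \<le> w A"
    and h_nonneg: "0 \<le> x \<Longrightarrow> 0 \<le> h x"
    and h_mono: "0 \<le> x \<Longrightarrow> x \<le> y \<Longrightarrow> h x \<le> h y"
    and h_concave: "concave_on {0..} h"
begin

abbreviation g :: "nat set \<Rightarrow> real" where "g \<equiv> subset_weight w"

section \<open>Order ideals, submodularity of \<open>f\<close> and supermodularity of
  \<open>g\<close>\<close>

definition f :: "nat set \<Rightarrow> real" where "f A = h (sum p A)"

definition ideal :: "nat set \<Rightarrow> bool" where
  "ideal X \<longleftrightarrow> X \<subseteq> {..<n} \<and> (\<forall>i<n. \<forall>j\<in>X. prec i j \<longrightarrow> i \<in> X)"

lemma ideal_subset: "ideal X \<Longrightarrow> X \<subseteq> {..<n}"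
  by (simp add: ideal_def)

lemma ideal_un: "ideal X \<Longrightarrow> ideal Y \<Longrightarrow> ideal (X \<union> Y)"
  and ideal_int: "ideal X \<Longrightarrow> ideal Y \<Longrightarrow> ideal (X \<inter> Y)"
  by (auto simp: ideal_def)

lemma finite_jobs: "A \<subseteq> {..<n} \<Longrightarrow> finite A"
  using finite_subset by blast

lemma sum_p_nonneg: "A \<subseteq> {..<n} \<Longrightarrow> 0 \<le> sum p A"
  using p_nonneg by (auto intro!: sum_nonneg)

lemma sum_p_mono: "A \<subseteq> B \<Longrightarrow> B \<subseteq> {..<n} \<Longrightarrow> sum p A \<le> sum p B"
  using p_nonneg finite_jobs by (intro sum_mono2) auto

lemma f_mono: "A \<subseteq> B \<Longrightarrow> B \<subseteq> {..<n} \<Longrightarrow> f A \<le> f B"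
  unfolding f_def using sum_p_mono sum_p_nonneg by (intro h_mono) auto

lemma f_submodular:
  assumes "A \<subseteq> {..<n}" "B \<subseteq> {..<n}"
  shows "f (A \<union> B) + f (A \<inter> B) \<le> f A + f B"
proof -
  have "sum p A + sum p B = sum p (A \<inter> B) + sum p (A \<union> B)"
    using sum.union_inter[of A B p] assms finite_jobs by simp
  then have "h (sum p (A \<inter> B)) + h (sum p (A \<union> B)) \<le> h (sum p A) + h (sum p B)"
    using assms by (intro concave_exchange[OF h_concave] sum_p_nonneg sum_p_mono) auto
  then show ?thesis by (simp add: f_def)
qed

lemma g_mono: "A \<subseteq> B \<Longrightarrow> B \<subseteq> {..<n} \<Longrightarrow> g A \<le> g B"
  unfolding subset_weight_def using finite_jobs w_nonneg by (intro sum_mono2) auto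

lemma g_supermodular:
  assumes "A \<subseteq> {..<n}" "B \<subseteq> {..<n}"
  shows "g A + g B \<le> g (A \<union> B) + g (A \<inter> B)"
proof -
  have fin: "finite (Pow A)" "finite (Pow B)" "finite (Pow (A \<union> B))"
    using assms finite_jobs by auto
  have "g A + g B = sum w (Pow A \<union> Pow B) + sum w (Pow A \<inter> Pow B)"
    unfolding subset_weight_def using fin by (simp add: sum.union_inter)
  also have "sum w (Pow A \<union> Pow B) \<le> g (A \<union> B)"
    unfolding subset_weight_def using fin w_nonneg assms by (intro sum_mono2) auto
  also have "Pow A \<inter> Pow B = Pow (A \<inter> B)" by auto
  finally show ?thesis by (simp add: subset_weight_def)
qed

section \<open>The objective as a sum over prefixes\<close>

text \<open>The variable part of the cost after \<open>U\<close> has been contracted, that is, moved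
  to the front: jobs of \<open>U\<close> in \<open>xs\<close> add nothing. The list is not
  shortened, so that one fixed order can be compared with all blocks in turn.\<close>

definition gcost :: "nat set \<Rightarrow> nat list \<Rightarrow> real" where
  "gcost U xs = (\<Sum>k<length xs. (f (U \<union> set (take (Suc k) xs)) - f (U \<union> set (take k xs))) *
     (g {..<n} - g (U \<union> set (take k xs))))"

lemma completion_time_nth:
  assumes "distinct xs" "k < length xs"
  shows "completion_time p xs (xs ! k) = sum p (set (take (Suc k) xs))"
proof -
  have "{i. precedes xs i (xs ! k)} = set (take k xs)"
  proof (intro set_eqI iffI)
    fix i assume "i \<in> {i. precedes xs i (xs ! k)}"
    then obtain a b where "a < b" "b < length xs" "xs ! a = i" "xs ! b = xs ! k"
      by (auto simp: precedes_def)
    moreover from this have "b = k" using assms by (simp add: nth_eq_iff_index_eq)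
    ultimately show "i \<in> set (take k xs)" by (force simp: in_set_conv_nth)
  next
    fix i assume "i \<in> set (take k xs)"
    then obtain a where "a < k" "xs ! a = i" by (auto simp: in_set_conv_nth)
    then show "i \<in> {i. precedes xs i (xs ! k)}" using assms by (auto simp: precedes_def)
  qed
  moreover have "xs ! k \<notin> set (take k xs)"
    using assms by (auto simp: in_set_conv_nth nth_eq_iff_index_eq)
  ultimately show ?thesis
    using assms by (simp add: completion_time_def take_Suc_conv_app_nth)
qed

text \<open>A set is complete from the position after its last job on, so \<open>h\<close> of its
  completion time telescopes over the positions up to this job. Summing over all positions, with
  zeros elsewhere, allows the exchange with the sum over \<open>A\<close>.\<close>

lemma h_set_completion_time:
  assumes xs: "xs \<in> permutations_of_set {..<n}" and A: "A \<subseteq> {..<n}" "A \<noteq> {}"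
  shows "h (set_completion_time p xs A) = h 0 + (\<Sum>k<n.
     if A \<subseteq> set (take k xs) then 0 else f (set (take (Suc k) xs)) - f (set (take k xs)))"
proof -
  have d: "distinct xs" "set xs = {..<n}" using xs by (auto simp: permutations_of_set_def)
  have len: "length xs = n" using d distinct_card by fastforce
  have sub: "set (take k xs) \<subseteq> {..<n}" for k using d set_take_subset by fastforce
  let ?I = "{k. k < n \<and> xs ! k \<in> A}"
  have fin: "finite ?I" by simp
  have pos: "\<exists>j<n. xs ! j = a" if "a \<in> A" for a
  proof -
    have "a \<in> set xs" using that A d by auto
    then show ?thesis using len by (simp add: in_set_conv_nth)
  qed
  then have "?I \<noteq> {}" using A by blast
  define l where "l = Max ?I"
  have l: "l < n" "xs ! l \<in> A" using Max_in[OF fin \<open>?I \<noteq> {}\<close>] by (auto simp: l_def)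
  have l_max: "k \<le> l" if "k < n" "xs ! k \<in> A" for k
    unfolding l_def using that by (intro Max_ge) auto
  have sub_iff: "A \<subseteq> set (take k xs) \<longleftrightarrow> l < k" if "k < n" for k
  proof
    assume "A \<subseteq> set (take k xs)"
    then obtain j where "j < k" "xs ! j = xs ! l" "j < length xs"
      using l(2) by (auto simp: in_set_conv_nth subset_iff)
    then show "l < k" using d l len by (simp add: nth_eq_iff_index_eq)
  next
    assume "l < k"
    show "A \<subseteq> set (take k xs)"
    proof
      fix a assume a: "a \<in> A"
      then obtain j where j: "j < n" "xs ! j = a" using pos by blast
      then have "j < k" using l_max[of j] a \<open>l < k\<close> by auto
      then show "a \<in> set (take k xs)" using j len by (auto simp: in_set_conv_nth)
    qed
  qed
  have "set_completion_time p xs A = sum p (set (take (Suc l) xs))"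
    unfolding set_completion_time_def
  proof (rule Max_eqI)
    show "finite (completion_time p xs ` A)" using A finite_jobs by auto
    show "sum p (set (take (Suc l) xs)) \<in> completion_time p xs ` A"
      using completion_time_nth[OF d(1), of l] l len by (auto intro!: image_eqI[of _ _ "xs ! l"])
    fix y assume "y \<in> completion_time p xs ` A"
    then obtain a where a: "a \<in> A" "y = completion_time p xs a" by auto
    then obtain j where j: "j < n" "xs ! j = a" using pos by blast
    then have "j \<le> l" using l_max a by auto
    then have "set (take (Suc j) xs) \<subseteq> set (take (Suc l) xs)" by (intro set_take_subset_set_take) simp
    then show "y \<le> sum p (set (take (Suc l) xs))"
      using completion_time_nth[OF d(1), of j] j len a sub sum_p_mono by simp
  qed
  then have "h (set_completion_time p xs A) = f (set (take (Suc l) xs))" by (simp add: f_def)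
  also have "\<dots> = f (set (take 0 xs)) + (\<Sum>k<Suc l. f (set (take (Suc k) xs)) - f (set (take k xs)))"
    unfolding sum_lessThan_telescope[of "\<lambda>k. f (set (take k xs))"] by simp
  also have "f (set (take 0 xs)) = h 0" by (simp add: f_def)
  also have "(\<Sum>k<Suc l. f (set (take (Suc k) xs)) - f (set (take k xs))) = (\<Sum>k<n.
     if A \<subseteq> set (take k xs) then 0 else f (set (take (Suc k) xs)) - f (set (take k xs)))"
    using l sub_iff by (intro sum.mono_neutral_cong_left) auto
  finally show ?thesis .
qed

text \<open>After exchanging the sums, the increment of \<open>f\<close> at position
  \<open>k\<close> is paid by all sets not contained in the first \<open>k\<close> jobs, and their
  total weight is a difference of two values of \<open>g\<close>. The empty set lies in every prefix
  and drops out there, hence \<open>w {}\<close> is subtracted only in the constant.\<close>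

lemma objective_eq:
  assumes xs: "xs \<in> permutations_of_set {..<n}"
  shows "objective {..<n} p w h xs = h 0 * (g {..<n} - w {}) + gcost {} xs"
proof -
  have d: "distinct xs" "set xs = {..<n}" using xs by (auto simp: permutations_of_set_def)
  have len: "length xs = n" using d distinct_card by fastforce
  have sub: "set (take k xs) \<subseteq> {..<n}" for k using d set_take_subset by fastforce
  let ?\<Delta> = "\<lambda>k. f (set (take (Suc k) xs)) - f (set (take k xs))"
  let ?P = "Pow {..<n} - {{}}"
  have "objective {..<n} p w h xs =
      (\<Sum>A\<in>?P. w A * h 0 + (\<Sum>k<n. w A * (if A \<subseteq> set (take k xs) then 0 else ?\<Delta> k)))"
    unfolding objective_def
    by (rule sum.cong) (auto simp: h_set_completion_time[OF xs] distrib_left sum_distrib_left)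
  also have "\<dots> = h 0 * (\<Sum>A\<in>?P. w A) +
      (\<Sum>A\<in>?P. \<Sum>k<n. w A * (if A \<subseteq> set (take k xs) then 0 else ?\<Delta> k))"
    by (simp only: sum.distrib sum_distrib_left mult.commute)
  also have "(\<Sum>A\<in>?P. \<Sum>k<n. w A * (if A \<subseteq> set (take k xs) then 0 else ?\<Delta> k)) =
      (\<Sum>k<n. \<Sum>A\<in>?P. w A * (if A \<subseteq> set (take k xs) then 0 else ?\<Delta> k))"
    by (rule sum.swap)
  also have "\<dots> = (\<Sum>k<n. ?\<Delta> k * (\<Sum>A\<in>?P. if A \<subseteq> set (take k xs) then 0 else w A))"
    unfolding sum_distrib_left by (intro sum.cong) auto
  finally have "objective {..<n} p w h xs = h 0 * (\<Sum>A\<in>?P. w A) +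
      (\<Sum>k<n. ?\<Delta> k * (\<Sum>A\<in>?P. if A \<subseteq> set (take k xs) then 0 else w A))" .
  moreover have "(\<Sum>A\<in>?P. w A) = g {..<n} - w {}"
    unfolding subset_weight_def by (subst sum_diff) auto
  moreover have "(\<Sum>A\<in>?P. if A \<subseteq> set (take k xs) then 0 else w A) = g {..<n} - g (set (take k xs))" for k
  proof -
    have "(\<Sum>A\<in>?P. if A \<subseteq> set (take k xs) then 0 else w A) = sum w (Pow {..<n} - Pow (set (take k xs)))"
      by (intro sum.mono_neutral_cong_right) auto
    also have "\<dots> = g {..<n} - g (set (take k xs))"
      unfolding subset_weight_def using sub[of k] by (intro sum_diff) auto
    finally show ?thesis .
  qed
  ultimately show ?thesis by (simp add: gcost_def len)
qed

section \<open>Contraction of a nearly densest block\<close>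

text \<open>Densities are compared after cross multiplication, since \<open>f X = f U\<close> is
  possible. The tolerance \<open>1 / (3 * n)\<close> is what the staircase estimate can pay
  for.\<close>

definition near_dense :: "nat set \<Rightarrow> nat set \<Rightarrow> bool" where
  "near_dense U B \<longleftrightarrow> (\<forall>X. ideal X \<longrightarrow> U \<subseteq> X \<longrightarrow>
     (g X - g U) * (f B - f U) \<le> (1 + 1 / (3 * n)) * (g B - g U) * (f X - f U))"

lemma feasible_prefix_ideal:
  assumes "xs \<in> feasible_orders {..<n} prec"
  shows "ideal (set (take k xs))"
  unfolding ideal_def
proof (intro conjI allI impI ballI)
  have d: "distinct xs" "set xs = {..<n}"
    using assms by (auto simp: feasible_orders_def permutations_of_set_def)
  show sub: "set (take k xs) \<subseteq> {..<n}" using d set_take_subset by fastforce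
  fix i j assume i: "i < n" and j: "j \<in> set (take k xs)" and "prec i j"
  then have "precedes xs i j" using assms sub by (auto simp: feasible_orders_def)
  then obtain a b where ab: "a < b" "b < length xs" "xs ! a = i" "xs ! b = j"
    by (auto simp: precedes_def)
  obtain c where c: "c < k" "c < length xs" "xs ! c = j" using j by (auto simp: in_set_conv_nth)
  then have "c = b" using ab d by (metis nth_eq_iff_index_eq)
  then have "a < length (take k xs)" "take k xs ! a = i" using ab c by auto
  then show "i \<in> set (take k xs)" by (metis nth_mem)
qed

text \<open>A nearly densest block \<open>B - U\<close> may be moved to the front of any feasible order: the cost
  saved by contracting it is at least half of what scheduling it next costs.\<close>

lemma gcost_contract:
  assumes xs: "xs \<in> feasible_orders {..<n} prec" and U: "ideal U" and B: "ideal B" "U \<subseteq> B"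
    and dense: "near_dense U B"
  shows "gcost B xs + (f B - f U) * (g {..<n} - g U) / 2 \<le> gcost U xs"
proof -
  have d: "distinct xs" "set xs = {..<n}"
    using xs by (auto simp: feasible_orders_def permutations_of_set_def)
  have len: "length xs = n" using d distinct_card by fastforce
  define A where "A k = set (take k xs)" for k
  have A: "ideal (A k)" for k unfolding A_def by (rule feasible_prefix_ideal) fact
  have A_mono: "A k \<subseteq> A (Suc k)" for k unfolding A_def by (rule set_take_subset_set_take) simp
  have An: "A n = {..<n}" "A 0 = {}" using d len by (auto simp: A_def)
  note sub = ideal_subset[OF U] ideal_subset[OF B(1)] ideal_subset[OF A]
  have sub': "U \<union> A k \<subseteq> {..<n}" "B \<union> A k \<subseteq> {..<n}" for k using sub by auto
  define F where "F = f B - f U"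
  \<comment> \<open>The growth of \<open>f\<close> along the order splits into
    \<open>\<phi>\<close>, which remains after contracting \<open>B\<close>, and \<open>e\<close>,
    which disappears and rises from 0 to \<open>F\<close>. The open weight splits likewise into
    \<open>d'\<close> and \<open>r\<close>.\<close>
  define e where "e k = (f (U \<union> A k) - f U) - (f (B \<union> A k) - f B)" for k
  define \<phi> where "\<phi> k = f (B \<union> A k) - f B" for k
  define d' where "d' k = g (B \<union> A k) - g (U \<union> A k)" for k
  define r where "r k = g {..<n} - g (B \<union> A k)" for k
  have F0: "0 \<le> F" unfolding F_def using f_mono[OF B(2)] sub by simp
  have e_mono: "e k \<le> e (Suc k)" for k
  proof -
    have "f ((U \<union> A (Suc k)) \<union> (B \<union> A k)) + f ((U \<union> A (Suc k)) \<inter> (B \<union> A k)) \<le> f (U \<union> A (Suc k)) + f (B \<union> A k)"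
      using sub' by (intro f_submodular)
    moreover have "(U \<union> A (Suc k)) \<union> (B \<union> A k) = B \<union> A (Suc k)" using A_mono B by auto
    moreover have "f (U \<union> A k) \<le> f ((U \<union> A (Suc k)) \<inter> (B \<union> A k))"
      using A_mono[of k] B sub'(2)[of k] by (intro f_mono) blast+
    ultimately show ?thesis by (simp add: e_def)
  qed
  have \<phi>_mono: "\<phi> k \<le> \<phi> (Suc k)" for k
    unfolding \<phi>_def using f_mono[of "B \<union> A k" "B \<union> A (Suc k)"] A_mono[of k] sub'(2)[of "Suc k"] by auto
  have d'0: "0 \<le> d' k" for k unfolding d'_def
    using g_mono[of "U \<union> A k" "B \<union> A k"] B(2) sub'(2)[of k] by auto
  have r0: "0 \<le> r k" for k unfolding r_def using g_mono[OF sub'(2)[of k]] by simp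
  have diff: "gcost U xs - gcost B xs =
      (\<Sum>k<n. (\<phi> (Suc k) - \<phi> k) * d' k + (e (Suc k) - e k) * (d' k + r k))"
    unfolding gcost_def len sum_subtractf[symmetric]
    by (intro sum.cong) (auto simp: A_def e_def \<phi>_def d'_def r_def algebra_simps)
  have "F * (g {..<n} - g U) / 2 \<le> gcost U xs - gcost B xs"
  \<comment> \<open>If \<open>B\<close> costs nothing, its density is undefined, but then only
    nonnegativity is claimed.\<close>
  proof (cases "F = 0")
    case True
    have "0 \<le> gcost U xs - gcost B xs"
      unfolding diff using e_mono \<phi>_mono d'0 r0
      by (intro sum_nonneg add_nonneg_nonneg mult_nonneg_nonneg) auto
    then show ?thesis using True by simp
  next
    case False
    then have F: "0 < F" using F0 by simp
    have n: "0 < n" using False sub B by (cases n) (auto simp: F_def)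
    define \<rho> where "\<rho> = (g B - g U) / F"
    have \<rho>F: "\<rho> * F = g B - g U" using F by (simp add: \<rho>_def)
    have \<rho>: "0 \<le> \<rho>" unfolding \<rho>_def using F g_mono[OF B(2)] sub by simp
    define \<epsilon> where "\<epsilon> = 1 / (3 * real n)"
    have dens: "g X - g U \<le> \<rho> * ((1 + \<epsilon>) * (f X - f U))" if X: "ideal X" "U \<subseteq> X" for X
    proof -
      have "(g X - g U) * F \<le> (1 + \<epsilon>) * (g B - g U) * (f X - f U)"
        using dense X by (auto simp: near_dense_def F_def \<epsilon>_def)
      then have "(g X - g U) * F \<le> \<rho> * ((1 + \<epsilon>) * (f X - f U)) * F"
        unfolding \<rho>F[symmetric] by (simp add: mult_ac)
      then show ?thesis using F by simp
    qed
    have "F * (\<rho> * F + (g {..<n} - g B)) / 2 \<le>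
       (\<Sum>k<n. (\<phi> (Suc k) - \<phi> k) * d' k + (e (Suc k) - e k) * (d' k + r k))"
    proof (rule discrete_triangle_bound[where \<epsilon> = \<epsilon>])
      show "e n = F" "e 0 = 0" "\<phi> 0 = 0"
        using sub by (auto simp: e_def \<phi>_def F_def An Un_absorb1)
      show "3 * real n * \<epsilon> \<le> 1" using n by (simp add: \<epsilon>_def)
      show "0 \<le> g {..<n} - g B" using sub g_mono by simp
      fix k
      show "\<rho> * (F - (1 + \<epsilon>) * e k) \<le> d' k"
      proof -
        \<comment> \<open>Uncrossing \<open>B\<close> with \<open>U \<union> A k\<close>: the
          intersection \<open>?Y\<close> is an ideal and so not much denser than \<open>B\<close>.
          Hence the part of \<open>B\<close> not yet processed retains enough weight.\<close>
        let ?Y = "(U \<union> A k) \<inter> B"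
        have Y: "ideal ?Y" "U \<subseteq> ?Y" using U A B by (auto intro: ideal_int ideal_un)
        have "g (U \<union> A k) + g B \<le> g ((U \<union> A k) \<union> B) + g ?Y"
          using sub' sub by (intro g_supermodular)
        moreover have un: "(U \<union> A k) \<union> B = B \<union> A k" using B by auto
        moreover have "f ((U \<union> A k) \<union> B) + f ?Y \<le> f (U \<union> A k) + f B"
          using sub' sub by (intro f_submodular)
        then have "f ?Y - f U \<le> e k" using un by (simp add: e_def)
        then have "\<rho> * ((1 + \<epsilon>) * (f ?Y - f U)) \<le> \<rho> * ((1 + \<epsilon>) * e k)"
          using \<rho> by (intro mult_left_mono) (auto simp: \<epsilon>_def)
        ultimately show ?thesis
          using dens[OF Y] \<rho>F by (simp add: d'_def right_diff_distrib)
      qed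
      \<comment> \<open>Here the density bound is applied to the union
        \<open>B \<union> A k\<close>, which limits the weight completed by then.\<close>
      show "g {..<n} - g B - \<rho> * ((1 + \<epsilon>) * \<phi> k + \<epsilon> * F) \<le> r k"
      proof -
        have "g (B \<union> A k) - g U \<le> \<rho> * ((1 + \<epsilon>) * (f (B \<union> A k) - f U))"
          using A B by (intro dens ideal_un) auto
        also have "f (B \<union> A k) - f U = \<phi> k + F" by (simp add: \<phi>_def F_def)
        finally show ?thesis using \<rho>F by (simp add: r_def algebra_simps)
      qed
    qed (use n e_mono \<phi>_mono d'0 r0 \<rho> in \<open>auto simp: \<epsilon>_def\<close>)
    then show ?thesis using diff \<rho>F by simp
  qed
  then show ?thesis by (simp add: F_def)
qed

text \<open>All increments of \<open>f\<close> inside the appended block are charged at the weight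
  open at its start and telescope. Every order inside the block satisfies this bound, so a
  topological one can be taken.\<close>

lemma gcost_append:
  assumes "set (xs @ ys) \<subseteq> {..<n}"
  shows "gcost {} (xs @ ys) \<le> gcost {} xs + (f (set (xs @ ys)) - f (set xs)) * (g {..<n} - g (set xs))"
proof -
  let ?A = "\<lambda>k. set (take k (xs @ ys))"
  let ?t = "\<lambda>k. (f (?A (Suc k)) - f (?A k)) * (g {..<n} - g (?A k))"
  have sub: "?A k \<subseteq> {..<n}" for k using assms set_take_subset by fastforce
  have "gcost {} (xs @ ys) = (\<Sum>k<length xs + length ys. ?t k)" by (simp add: gcost_def)
  also have "\<dots> = (\<Sum>k<length xs. ?t k) + (\<Sum>k = length xs..<length xs + length ys. ?t k)"
    using sum.atLeastLessThan_concat[of 0 "length xs" "length xs + length ys" ?t]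
    by (simp del: take_append add: atLeast0LessThan)
  also have "(\<Sum>k<length xs. ?t k) = gcost {} xs" by (simp add: gcost_def)
  also have "(\<Sum>k = length xs..<length xs + length ys. ?t k) \<le>
     (\<Sum>k = length xs..<length xs + length ys. (f (?A (Suc k)) - f (?A k)) * (g {..<n} - g (set xs)))"
  proof (rule sum_mono)
    fix k assume "k \<in> {length xs..<length xs + length ys}"
    then have "set xs \<subseteq> ?A k" by auto
    moreover have "?A k \<subseteq> ?A (Suc k)" by (rule set_take_subset_set_take) simp
    ultimately show "?t k \<le> (f (?A (Suc k)) - f (?A k)) * (g {..<n} - g (set xs))"
      using sub by (intro mult_left_mono) (simp_all add: g_mono f_mono del: take_append)
  qed
  also have "\<dots> = (\<Sum>k = length xs..<length xs + length ys. f (?A (Suc k)) - f (?A k)) * (g {..<n} - g (set xs))"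
    by (simp only: sum_distrib_right)
  also have "(\<Sum>k = length xs..<length xs + length ys. f (?A (Suc k)) - f (?A k)) =
      f (set (xs @ ys)) - f (set xs)"
    by (subst sum_Suc_diff') auto
  finally show ?thesis by simp
qed

lemma gcost_all: "set xs \<subseteq> {..<n} \<Longrightarrow> gcost {..<n} xs = 0"
proof -
  assume "set xs \<subseteq> {..<n}"
  then have "{..<n} \<union> set (take k xs) = {..<n}" for k using set_take_subset by fastforce
  then show ?thesis by (simp add: gcost_def)
qed

text \<open>
  The index \<open>n\<close> is a dummy job that precedes all jobs. It carries the constant term of a chord.
\<close>

definition interior :: "nat set \<Rightarrow> nat set \<Rightarrow> nat set" where
  "interior U X = U \<union> {j. j < n \<and> n \<in> X \<and> (\<forall>i<n. i = j \<or> prec i j \<longrightarrow> i \<in> X \<union> U)}"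

text \<open>For \<open>n \<in> X\<close> and an ideal \<open>U\<close>, \<open>interior U X\<close>
  is the largest ideal in \<open>X \<union> U\<close>, so the precedence constraints disappear into
  the set function. Interiors commute with intersections, which keeps \<open>gain\<close>
  supermodular on arbitrary sets.\<close>

definition gain :: "nat set \<Rightarrow> nat set \<Rightarrow> real" where
  "gain U X = g (interior U X) - g U"

text \<open>The square gives \<open>32 * n * accuracy \<le> 1\<close>, by
  \<open>(n - 8)\<^sup>2 \<ge> 0\<close>, which covers the \<open>24 * n\<close> required by the
  tolerance \<open>1 / (3 * n)\<close>. Powers of \<open>n + 8\<close> then count both the grid
  points and the iterations.\<close>

definition accuracy :: real where "accuracy = 1 / (real n + 8)\<^sup>2"

text \<open>\<open>m\<close> is meant to be the longest job of an ideal outside \<open>U\<close>.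
  The total time there lies between \<open>p m\<close> and \<open>n * p m\<close>, so steps of
  \<open>accuracy * p m\<close> are both relatively small and few: \<open>(n + 8) ^ 3\<close> of
  them suffice.\<close>

definition grid :: "nat \<Rightarrow> nat \<Rightarrow> real" where
  "grid m i = p m + real i * (accuracy * p m)"

definition rise :: "nat set \<Rightarrow> real \<Rightarrow> real" where
  "rise U x = h (sum p U + x) - h (sum p U)"

definition slope :: "nat set \<Rightarrow> nat \<Rightarrow> nat \<Rightarrow> real" where
  "slope U m i = (rise U (grid m (Suc i)) - rise U (grid m i)) / (accuracy * p m)"

text \<open>
  The affine function given by a chord of \<open>rise U\<close>, with a small amount added to make all
  capacities positive.
\<close>

definition capacity :: "nat set \<Rightarrow> nat \<Rightarrow> nat \<Rightarrow> nat \<Rightarrow> real" where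
  "capacity U m i j = (if j < n then slope U m i * p j else rise U (grid m i) - slope U m i * grid m i)
     + accuracy * rise U (grid m i) / (real n + 1)"

definition candidate :: "nat set \<Rightarrow> nat \<Rightarrow> nat \<Rightarrow> nat \<Rightarrow> nat \<Rightarrow> nat set" where
  "candidate U m i t k = interior U (threshold (n + 1)
     (weights accuracy (n + 1) (gain U) (capacity U m i) t) k 1)"

definition dominates :: "nat set \<Rightarrow> nat set \<Rightarrow> nat set \<Rightarrow> bool" where
  "dominates U B X \<longleftrightarrow> (g X - g U) * (f B - f U) \<le> (g B - g U) * (f X - f U)"

section \<open>Interiors as ideals and supermodularity of the gain\<close>

lemma interior_mono: "X \<subseteq> Y \<Longrightarrow> interior U X \<subseteq> interior U Y"
  by (auto simp: interior_def)

lemma interior_int: "interior U (X \<inter> Y) = interior U X \<inter> interior U Y"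
  by (auto simp: interior_def)

lemma interior_subset: "U \<subseteq> {..<n} \<Longrightarrow> interior U X \<subseteq> {..<n}"
  by (auto simp: interior_def)

lemma interior_no_dummy: "n \<notin> X \<Longrightarrow> interior U X = U"
  by (auto simp: interior_def)

lemma subset_interior: "U \<subseteq> interior U X"
  by (auto simp: interior_def)

lemma ideal_interior:
  assumes "ideal U"
  shows "ideal (interior U X)"
  unfolding ideal_def
proof (intro conjI allI impI ballI)
  show "interior U X \<subseteq> {..<n}" using assms by (intro interior_subset ideal_subset)
  fix i j assume i: "i < n" and j: "j \<in> interior U X" and ij: "prec i j"
  show "i \<in> interior U X"
  proof (cases "j \<in> U")
    case True
    then show ?thesis using assms i ij by (auto simp: ideal_def interior_def)
  next
    case False
    then have jn: "j < n" "n \<in> X" and pre: "\<forall>k<n. k = j \<or> prec k j \<longrightarrow> k \<in> X \<union> U"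
      using j by (auto simp: interior_def)
    have "k \<in> X \<union> U" if "k < n" "k = i \<or> prec k i" for k
    proof -
      have "prec k j" using that ij i jn transp_onD[OF prec_trans, of k i j] by auto
      then show ?thesis using pre that by blast
    qed
    then show ?thesis using jn i by (auto simp: interior_def)
  qed
qed

lemma subset_interior_insert:
  assumes "ideal X" "U \<subseteq> X"
  shows "X \<subseteq> interior U (insert n (X - U))"
  using assms by (auto simp: interior_def ideal_def)

lemma gain_empty: "gain U {} = 0"
  by (simp add: gain_def interior_no_dummy)

lemma gain_mono: "U \<subseteq> {..<n} \<Longrightarrow> X \<subseteq> Y \<Longrightarrow> gain U X \<le> gain U Y"
  unfolding gain_def by (simp add: g_mono interior_mono interior_subset)

lemma gain_supermodular:
  assumes "U \<subseteq> {..<n}"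
  shows "gain U X + gain U Y \<le> gain U (X \<union> Y) + gain U (X \<inter> Y)"
proof -
  have "g (interior U X) + g (interior U Y) \<le> g (interior U X \<union> interior U Y) + g (interior U X \<inter> interior U Y)"
    using assms by (intro g_supermodular interior_subset)
  also have "g (interior U X \<union> interior U Y) \<le> g (interior U (X \<union> Y))"
    using assms interior_mono[of X "X \<union> Y" U] interior_mono[of Y "X \<union> Y" U]
    by (intro g_mono interior_subset) auto
  finally show ?thesis by (simp add: gain_def interior_int)
qed

lemma accuracy_pos: "0 < accuracy"
  unfolding accuracy_def by (auto intro!: divide_pos_pos zero_less_power)

lemma accuracy_le: "accuracy \<le> 1 / 64" "32 * real n * accuracy \<le> 1"
proof -
  have "64 \<le> (real n + 8)\<^sup>2" "32 * real n \<le> (real n + 8)\<^sup>2"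
    using sum_power2_ge_zero[of "real n - 8" 0] by (auto simp: power2_eq_square algebra_simps)
  then show "accuracy \<le> 1 / 64" "32 * real n * accuracy \<le> 1"
    by (auto simp: accuracy_def divide_simps)
qed

lemma rise_f: "U \<subseteq> X \<Longrightarrow> X \<subseteq> {..<n} \<Longrightarrow> rise U (sum p (X - U)) = f X - f U"
  using finite_jobs[of X] by (simp add: rise_def f_def sum_diff finite_subset)

text \<open>Domination over the candidates says that every threshold met satisfies the bound in
  \<open>multiplicative_weights\<close> with \<open>\<Lambda> = \<rho> * (1 + accuracy)\<close>,
  where \<open>\<rho>\<close> is the density of \<open>B\<close>. Its conclusion, for the chord
  chosen to fit \<open>X\<close>, bounds the density of \<open>X\<close>, although \<open>X\<close>
  itself may not occur among the candidates.\<close>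

lemma near_dense_candidates:
  assumes U: "ideal U" and B: "ideal B" "U \<subseteq> B"
    and zero: "dominates U B (interior U (insert n {j. j < n \<and> p j = 0}))"
    and cand: "\<And>m i t k. m < n \<Longrightarrow> i < (n + 8) ^ 3 \<Longrightarrow> t < (n + 8) ^ 6 \<Longrightarrow> k < n + 1 \<Longrightarrow>
       dominates U B (candidate U m i t k)"
  shows "near_dense U B"
  unfolding near_dense_def
proof (intro allI impI)
  fix X assume X: "ideal X" "U \<subseteq> X"
  note sub = ideal_subset[OF U] ideal_subset[OF B(1)] ideal_subset[OF X(1)]
  let ?H = "rise U"
  define P0 where "P0 = sum p U"
  have P0: "0 \<le> P0" unfolding P0_def using sub by (intro sum_p_nonneg)
  have H0: "?H 0 = 0" by (simp add: rise_def)
  have H_mono: "?H x \<le> ?H y" if "0 \<le> x" "x \<le> y" for x y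
    using that P0 h_mono[of "P0 + x" "P0 + y"] by (simp add: rise_def P0_def)
  have H_nonneg: "0 \<le> ?H x" if "0 \<le> x" for x using H_mono[of 0 x] that H0 by simp
  have chord: "?H x * (z - y) + ?H z * (y - x) \<le> ?H y * (z - x)" if "0 \<le> x" "x \<le> y" "y \<le> z" for x y z
    using concave_chord[OF h_concave, of "P0 + x" "P0 + y" "P0 + z"] that P0
    by (simp add: rise_def P0_def algebra_simps)
  define F where "F = f B - f U"
  have F0: "0 \<le> F" unfolding F_def using f_mono[OF B(2)] sub by simp
  have gBU: "0 \<le> g B - g U" using g_mono[OF B(2)] sub by simp
  have fXU: "0 \<le> f X - f U" using f_mono[OF X(2)] sub by simp
  show "(g X - g U) * (f B - f U) \<le> (1 + 1 / (3 * n)) * (g B - g U) * (f X - f U)"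
  proof (cases "F = 0 \<or> sum p (X - U) = 0")
    case True
    show ?thesis
    proof (cases "F = 0")
      case True
      then show ?thesis using gBU fXU by (simp add: F_def)
    next
      case False
      then have "sum p (X - U) = 0" using True by blast
      then have z: "\<forall>j\<in>X - U. p j = 0"
        using sub p_nonneg finite_jobs[of "X - U"] by (subst (asm) sum_nonneg_eq_0_iff) auto
      \<comment> \<open>\<open>X\<close> is contained in \<open>?Z\<close>, on which
        \<open>f\<close> still has the value \<open>f U\<close>. As \<open>F > 0\<close>, domination
        leaves \<open>?Z\<close> without gain.\<close>
      let ?Z = "interior U (insert n {j. j < n \<and> p j = 0})"
      have "X \<subseteq> ?Z"
        using subset_interior_insert[OF X] interior_mono[of "insert n (X - U)" "insert n {j. j < n \<and> p j = 0}" U] z sub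
        by fastforce
      then have gXZ: "g X \<le> g ?Z" using sub by (intro g_mono interior_subset)
      have "\<forall>j\<in>?Z - U. p j = 0" using sub by (auto simp: interior_def)
      then have "rise U (sum p (?Z - U)) = 0" using H0 by simp
      then have "f ?Z - f U = 0" using rise_f[of U ?Z] subset_interior interior_subset sub by simp
      then have "(g ?Z - g U) * F \<le> 0" using zero by (simp add: dominates_def F_def)
      then have "g ?Z - g U \<le> 0" using False F0 by (simp add: mult_le_0_iff)
      then have "(g X - g U) * F \<le> 0" using gXZ F0 by (simp add: mult_nonpos_nonneg)
      also have "0 \<le> (1 + 1 / (3 * n)) * (g B - g U) * (f X - f U)" using gBU fXU by simp
      finally show ?thesis by (simp add: F_def)
    qed
  next
    case False
    then have F: "0 < F" using F0 by simp
    define P where "P = sum p (X - U)"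
    have XU: "X - U \<subseteq> {..<n}" "finite (X - U)" using sub finite_jobs by auto
    have P: "0 < P" using False sum_p_nonneg[OF XU(1)] by (simp add: P_def)
    have ne: "X - U \<noteq> {}" using P unfolding P_def by (metis less_irrefl sum.empty)
    define v where "v = Max (p ` (X - U))"
    have "v \<in> p ` (X - U)" unfolding v_def using XU ne by (intro Max_in) auto
    then obtain m where m: "m \<in> X - U" "p m = v" by auto
    have mn: "m < n" using m XU by auto
    have pm_max: "p j \<le> p m" if "j \<in> X - U" for j
      unfolding m v_def using that XU by (intro Max_ge) auto
    have "P \<le> card (X - U) * p m"
      unfolding P_def by (rule sum_bounded_above) (use pm_max in auto)
    also have "\<dots> \<le> n * p m"
      using card_mono[OF _ XU(1)] p_nonneg[OF mn] by (intro mult_right_mono) auto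
    finally have P_le: "P \<le> n * p m" .
    have pm: "0 < p m"
    proof (rule ccontr)
      assume "\<not> 0 < p m"
      then have "real n * p m \<le> 0" by (simp add: mult_nonneg_nonpos)
      then show False using P P_le by simp
    qed
    have pmP: "p m \<le> P" unfolding P_def using m XU p_nonneg by (intro member_le_sum) auto
    let ?\<delta> = accuracy
    note \<delta> = accuracy_pos accuracy_le
    have step: "0 < ?\<delta> * p m" using \<delta> pm by simp
    \<comment> \<open>\<open>[q, q']\<close> is the grid interval containing \<open>P\<close>. The
      program cannot round, but it tries all \<open>i\<close>.\<close>
    define i where "i = nat \<lfloor>(P - p m) / (?\<delta> * p m)\<rfloor>"
    have i_le: "real i \<le> (P - p m) / (?\<delta> * p m)"
      unfolding i_def using step pmP by simp
    have i_gt: "(P - p m) / (?\<delta> * p m) < real i + 1"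
      unfolding i_def using step pmP by (simp add: floor_less_iff)
    define q where "q = grid m i"
    define q' where "q' = grid m (Suc i)"
    have q'q: "q' - q = ?\<delta> * p m" by (simp add: q_def q'_def grid_def algebra_simps)
    have qP: "q \<le> P" "P \<le> q'"
      using i_le i_gt step by (auto simp: q_def q'_def grid_def pos_le_divide_eq pos_divide_less_eq algebra_simps)
    have q_pm: "p m \<le> q" using step by (simp add: q_def grid_def)
    have q: "0 < q" using pm q_pm by simp
    have "i < (n + 8) ^ 3"
    proof -
      have "real i * (?\<delta> * p m) \<le> n * p m - p m" using i_le step P_le by (simp add: pos_le_divide_eq)
      also have "\<dots> < n * p m" using pm by simp
      finally have "real i * ?\<delta> < n" using pm by (simp add: mult.assoc[symmetric])
      then have "real i < real n * (real n + 8)\<^sup>2"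
        unfolding accuracy_def by (simp add: pos_divide_less_eq)
      also have "\<dots> \<le> (real n + 8) * (real n + 8)\<^sup>2" by (intro mult_right_mono) auto
      also have "\<dots> = real ((n + 8) ^ 3)" by (simp add: power3_eq_cube power2_eq_square)
      finally show ?thesis by (simp only: of_nat_less_iff)
    qed
    note cand_i = cand[OF mn this]
    \<comment> \<open>Otherwise concavity and \<open>rise U 0 = 0\<close> would make
      \<open>rise U\<close> vanish on all nonnegative arguments, contradicting \<open>F > 0\<close>.
      Positivity here makes the shift \<open>\<kappa>\<close> positive.\<close>
    have Hq: "0 < ?H q"
    proof (rule ccontr)
      assume "\<not> 0 < ?H q"
      then have Hq0: "?H q = 0" using H_nonneg[of q] q by simp
      have FH: "?H (sum p (B - U)) = F" using rise_f B sub by (simp add: F_def)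
      have pB: "0 \<le> sum p (B - U)" using sub by (intro sum_p_nonneg) auto
      show False
      proof (cases "sum p (B - U) \<le> q")
        case True
        then show False using H_mono[OF pB True] FH F Hq0 by simp
      next
        case False
        then have "?H (sum p (B - U)) * q \<le> 0" using chord[of 0 q "sum p (B - U)"] q H0 Hq0 by simp
        then show False using FH F q by (simp add: mult_le_0_iff)
      qed
    qed
    define \<beta> where "\<beta> = slope U m i"
    have \<beta>: "\<beta> * (?\<delta> * p m) = ?H q' - ?H q"
      using \<delta>(1) pm by (simp add: \<beta>_def slope_def q_def q'_def)
    have \<beta>0: "0 \<le> \<beta>"
      unfolding \<beta>_def slope_def using step q q'q H_mono[of q q'] by (simp add: q_def q'_def)
    \<comment> \<open>The chord meets the vertical axis at a nonnegative height because
      \<open>rise U 0 = 0\<close>; up to \<open>\<kappa>\<close>, this height is the capacity of the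
      dummy job.\<close>
    have \<beta>q: "\<beta> * q \<le> ?H q"
    proof -
      have "?H q' * q \<le> ?H q * q'" using chord[of 0 q q'] q q'q step H0 by simp
      then have "(?H q' - ?H q) * q \<le> ?H q * (q' - q)" by (simp add: algebra_simps)
      then have "(\<beta> * q) * (?\<delta> * p m) \<le> ?H q * (?\<delta> * p m)" unfolding q'q \<beta>[symmetric] by (simp add: mult_ac)
      then show ?thesis by (rule mult_right_le_imp_le[OF _ step])
    qed
    define L where "L x = ?H q + \<beta> * (x - q)" for x
    have L_nonneg: "0 \<le> L x" if "0 \<le> x" for x
      using \<beta>q mult_nonneg_nonneg[OF \<beta>0 that] by (simp add: L_def right_diff_distrib)
    have scaled: "L x * (q' - q) = ?H q * (q' - q) + (?H q' - ?H q) * (x - q)" for x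
      unfolding q'q \<beta>[symmetric] L_def by (simp add: algebra_simps)
    have qq': "0 < q' - q" using q'q step by simp
    \<comment> \<open>Outside \<open>[q, q']\<close> the extended chord lies above the concave
      function. Inside, the error is at most the rise over one grid step, which is at most
      \<open>accuracy\<close> times \<open>rise U q\<close> because
      \<open>p m \<le> q\<close>.\<close>
    have HL: "?H x \<le> (1 + ?\<delta>) * L x" if x: "0 \<le> x" for x
    proof -
      consider "x \<le> q" | "q \<le> x" "x \<le> q'" | "q' \<le> x" by linarith
      then show ?thesis
      proof cases
        case 1
        have "?H x * (q' - q) \<le> L x * (q' - q)"
          unfolding scaled using chord[of x q q'] x 1 qq' by (simp add: algebra_simps)
        then have "?H x \<le> L x" by (rule mult_right_le_imp_le[OF _ qq'])
        also have "\<dots> \<le> (1 + ?\<delta>) * L x" using L_nonneg[OF x] \<delta> by (simp add: distrib_right)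
        finally show ?thesis .
      next
        case 2
        have "\<beta> * p m \<le> \<beta> * q" using q_pm \<beta>0 by (intro mult_left_mono)
        then have "?\<delta> * (\<beta> * p m) \<le> ?\<delta> * ?H q" using \<beta>q \<delta> by (intro mult_left_mono) auto
        then have "?H q' \<le> (1 + ?\<delta>) * ?H q" using \<beta> by (simp add: algebra_simps)
        moreover have "?H q \<le> L x" using \<beta>0 2 by (simp add: L_def)
        then have "(1 + ?\<delta>) * ?H q \<le> (1 + ?\<delta>) * L x" using \<delta> by (intro mult_left_mono) auto
        ultimately show ?thesis using H_mono[OF x 2(2)] by linarith
      next
        case 3
        have "?H x * (q' - q) \<le> L x * (q' - q)"
          unfolding scaled using chord[of q q' x] q 3 qq' by (simp add: algebra_simps)
        then have "?H x \<le> L x" by (rule mult_right_le_imp_le[OF _ qq'])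
        also have "\<dots> \<le> (1 + ?\<delta>) * L x" using L_nonneg[OF x] \<delta> by (simp add: distrib_right)
        finally show ?thesis .
      qed
    qed
    have LP: "L P \<le> ?H P"
    proof -
      have "L P * (q' - q) \<le> ?H P * (q' - q)"
        unfolding scaled using chord[of q P q'] q qP by (simp add: algebra_simps)
      then show ?thesis by (rule mult_right_le_imp_le[OF _ qq'])
    qed
    let ?cap = "capacity U m i"
    \<comment> \<open>Over at most \<open>n + 1\<close> elements these shifts add up to no more than
      \<open>accuracy * ?H q\<close>.\<close>
    define \<kappa> where "\<kappa> = ?\<delta> * ?H q / (real n + 1)"
    have \<kappa>: "0 < \<kappa>" unfolding \<kappa>_def using \<delta> Hq by (intro divide_pos_pos mult_pos_pos) auto
    have cap_job: "?cap j = \<beta> * p j + \<kappa>" if "j < n" for j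
      using that by (simp add: capacity_def \<beta>_def \<kappa>_def q_def)
    have cap_dummy: "?cap n = ?H q - \<beta> * q + \<kappa>"
      by (simp add: capacity_def \<beta>_def \<kappa>_def q_def)
    have cap_pos: "0 < ?cap j" if "j < n + 1" for j
    proof (cases "j < n")
      case True
      then show ?thesis using cap_job \<kappa> mult_nonneg_nonneg[OF \<beta>0 p_nonneg[OF True]] by simp
    next
      case False
      then have "j = n" using that by simp
      then show ?thesis using cap_dummy \<kappa> \<beta>q by simp
    qed
    have cap_sum: "sum ?cap (insert n A) = L (sum p A) + (real (card A) + 1) * \<kappa>" if A: "A \<subseteq> {..<n}" for A
    proof -
      have "sum ?cap A = (\<Sum>j\<in>A. \<beta> * p j + \<kappa>)" using A cap_job by (intro sum.cong) auto
      also have "\<dots> = \<beta> * sum p A + card A * \<kappa>" by (simp add: sum.distrib sum_distrib_left)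
      finally have "sum ?cap A = \<beta> * sum p A + card A * \<kappa>" .
      moreover have "n \<notin> A" using A by auto
      ultimately show ?thesis using finite_jobs[OF A] cap_dummy by (simp add: L_def algebra_simps)
    qed
    define \<rho> where "\<rho> = (g B - g U) / F"
    have \<rho>: "0 \<le> \<rho>" unfolding \<rho>_def using gBU F by simp
    have \<rho>F: "\<rho> * F = g B - g U" using F by (simp add: \<rho>_def)
    let ?w = "weights ?\<delta> (n + 1) (gain U) ?cap"
    let ?A = "insert n (X - U)"
    have "(1 - 2 * ?\<delta>) * gain U ?A \<le> (\<rho> * (1 + ?\<delta>)) * sum ?cap ?A"
    proof (rule multiplicative_weights[where N = "n + 1" and K = "(n + 8) ^ 6"])
      fix t k assume tk: "t < (n + 8) ^ 6" "k < n + 1"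
      let ?T = "threshold (n + 1) (?w t) k 1"
      have Tsub: "?T \<subseteq> {..<n + 1}" by (rule threshold_subset)
      have cap_sub: "sum ?cap C \<le> sum ?cap ?T" if "C \<subseteq> ?T" for C
        using that Tsub cap_pos finite_subset[OF Tsub] by (intro sum_mono2) (auto simp: less_imp_le)
      show "gain U ?T \<le> (\<rho> * (1 + ?\<delta>)) * sum ?cap ?T"
      \<comment> \<open>A threshold without the dummy lacks the constant term of the chord, but it
        has no gain either.\<close>
      proof (cases "n \<in> ?T")
        case False
        then have "gain U ?T = 0" by (simp add: gain_def interior_no_dummy)
        also have "0 \<le> (\<rho> * (1 + ?\<delta>)) * sum ?cap ?T"
          using \<rho> \<delta> cap_sub[of "{}"] by simp
        finally show ?thesis .
      next
        case True
        let ?I = "interior U ?T"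
        have I: "?I \<subseteq> {..<n}" "U \<subseteq> ?I" using interior_subset subset_interior sub by auto
        have "(g ?I - g U) * F \<le> (g B - g U) * (f ?I - f U)"
          using cand_i[OF tk] by (simp add: dominates_def candidate_def F_def)
        then have "gain U ?T * F \<le> \<rho> * (f ?I - f U) * F"
          unfolding \<rho>F[symmetric] gain_def by (simp add: mult_ac)
        then have "gain U ?T \<le> \<rho> * (f ?I - f U)" by (rule mult_right_le_imp_le[OF _ F])
        also have "f ?I - f U = ?H (sum p (?I - U))" using rise_f I by simp
        also have "\<rho> * \<dots> \<le> \<rho> * ((1 + ?\<delta>) * sum ?cap ?T)"
        proof (rule mult_left_mono[OF _ \<rho>])
          have IU: "?I - U \<subseteq> {..<n}" using I by auto
          have "?H (sum p (?I - U)) \<le> (1 + ?\<delta>) * L (sum p (?I - U))"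
            using IU by (intro HL sum_p_nonneg)
          also have "L (sum p (?I - U)) \<le> sum ?cap (insert n (?I - U))"
            using cap_sum[OF IU] \<kappa> by simp
          also have "\<dots> \<le> sum ?cap ?T"
            using True by (intro cap_sub) (auto simp: interior_def)
          finally show "?H (sum p (?I - U)) \<le> (1 + ?\<delta>) * sum ?cap ?T" using \<delta> by simp
        qed
        finally show ?thesis by (simp add: mult.assoc)
      qed
    next
      have "(real (n + 1))\<^sup>2 \<le> (real n + 8)\<^sup>2" by (intro power_mono) auto
      also have "\<dots> = real ((n + 8) ^ 6) * accuracy\<^sup>2"
      proof -
        have "real n + 8 \<noteq> 0" by linarith
        then have "(real n + 8) ^ 6 / ((real n + 8)\<^sup>2)\<^sup>2 = (real n + 8)\<^sup>2"
          by (simp add: eval_nat_numeral)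
        then show ?thesis by (simp add: accuracy_def power_divide)
      qed
      finally show "(real (n + 1))\<^sup>2 \<le> real ((n + 8) ^ 6) * accuracy\<^sup>2" .
    qed (use gain_empty gain_mono gain_supermodular sub cap_pos \<delta> \<rho> in auto)
    also have "sum ?cap ?A \<le> (1 + ?\<delta>) * ?H P"
    proof -
      have "sum ?cap ?A = L P + (real (card (X - U)) + 1) * \<kappa>" using cap_sum[OF XU(1)] by (simp add: P_def)
      also have "(real (card (X - U)) + 1) * \<kappa> \<le> (real n + 1) * \<kappa>"
        using card_mono[OF _ XU(1)] \<kappa> by (intro mult_right_mono) auto
      also have "(real n + 1) * \<kappa> = ?\<delta> * ?H q" by (simp add: \<kappa>_def)
      also have "\<dots> \<le> ?\<delta> * ?H P" using H_mono[of q P] q qP \<delta> by (intro mult_left_mono) auto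
      finally show ?thesis using LP by (simp add: distrib_right)
    qed
    then have "(\<rho> * (1 + ?\<delta>)) * sum ?cap ?A \<le> (\<rho> * (1 + ?\<delta>)) * ((1 + ?\<delta>) * ?H P)"
      using \<rho> \<delta> by (intro mult_left_mono) auto
    finally have main: "(1 - 2 * ?\<delta>) * gain U ?A \<le> \<rho> * ?H P * (1 + ?\<delta>)\<^sup>2"
      by (simp add: power2_eq_square mult_ac)
    have "X \<subseteq> interior U ?A" by (rule subset_interior_insert) fact+
    then have "g X - g U \<le> gain U ?A"
      unfolding gain_def using sub by (simp add: g_mono interior_subset)
    then have "(1 - 2 * ?\<delta>) * (g X - g U) \<le> (1 - 2 * ?\<delta>) * gain U ?A"
      using \<delta> by (intro mult_left_mono) auto
    also note main
    \<comment> \<open>Three losses meet here: the packing error \<open>1 - 2 * ?\<delta>\<close>,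
      the chord error and the shift, the latter two giving a factor \<open>1 + ?\<delta>\<close>
      each.\<close>
    also have "(1 + ?\<delta>)\<^sup>2 \<le> (1 - 2 * ?\<delta>) * (1 + 1 / (3 * n))"
    proof -
      have "?\<delta> * ?\<delta> \<le> 1 / 64 * ?\<delta>" using \<delta> by (intro mult_right_mono) auto
      then have "(1 + ?\<delta>)\<^sup>2 \<le> (1 - 2 * ?\<delta>) * (1 + 8 * ?\<delta>)"
        using \<delta> by (simp add: power2_eq_square algebra_simps)
      also have "8 * ?\<delta> \<le> 1 / (3 * real n)" using \<delta> mn by (simp add: field_simps)
      then have "(1 - 2 * ?\<delta>) * (1 + 8 * ?\<delta>) \<le> (1 - 2 * ?\<delta>) * (1 + 1 / (3 * real n))"
        using \<delta> by (intro mult_left_mono) auto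
      finally show ?thesis by simp
    qed
    then have "\<rho> * ?H P * (1 + ?\<delta>)\<^sup>2 \<le> \<rho> * ?H P * ((1 - 2 * ?\<delta>) * (1 + 1 / (3 * n)))"
      using \<rho> H_nonneg[of P] P by (intro mult_left_mono) auto
    finally have "(1 - 2 * ?\<delta>) * (g X - g U) \<le> (1 - 2 * ?\<delta>) * (\<rho> * ?H P * (1 + 1 / (3 * n)))"
      by (simp add: mult_ac)
    then have "g X - g U \<le> \<rho> * ?H P * (1 + 1 / (3 * n))"
      using \<delta> by (subst (asm) mult_le_cancel_left_pos) auto
    then have "(g X - g U) * F \<le> \<rho> * ?H P * (1 + 1 / (3 * n)) * F"
      using F by (intro mult_right_mono) auto
    also have "\<dots> = (1 + 1 / (3 * n)) * (\<rho> * F) * ?H P" by (simp add: mult_ac)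
    also have "?H P = f X - f U" using rise_f X sub by (simp add: P_def)
    finally show ?thesis unfolding \<rho>F by (simp add: F_def)
  qed
qed

end

section \<open>The algorithm\<close>

abbreviation nv :: "vname \<Rightarrow> nexp" where "nv x \<equiv> NVar x []"
abbreviation rv :: "vname \<Rightarrow> rexp" where "rv x \<equiv> RVar x []"
abbreviation flag :: "vname \<Rightarrow> nexp list \<Rightarrow> bexp" where "flag x es \<equiv> NLess (NConst 0) (NVar x es)"
abbreviation rzero :: rexp where "rzero \<equiv> Of_Nat (NConst 0)"
abbreviation rone :: rexp where "rone \<equiv> Of_Nat (NConst 1)"

section \<open>Programs for comparing ideals\<close>

definition sum_prog :: "vname \<Rightarrow> prog" where
  "sum_prog a = (PR ''x'' [] rzero ;;
     PFor ''j'' 0 (PIf (flag a [nv ''j'']) (PR ''x'' [] (RPlus (rv ''x'') (RVar ''p'' [nv ''j''])))))"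

text \<open>Negated because \<open>bexp\<close> has no disjunction and \<open>interior_prog\<close>
  searches for a violation.\<close>

definition not_in_threshold :: "nat \<Rightarrow> bexp" where
  "not_in_threshold e = BAnd
     (BNot (RLess (RVar ''c'' [nv ''k'']) (RVar ''c'' [nv ''i''])))
     (BNot (BAnd (BNot (RLess (RVar ''c'' [nv ''i'']) (RVar ''c'' [nv ''k''])))
        (NLess (nv ''i'') (NPlus (nv ''k'') (NConst e)))))"

text \<open>A job is cleared as soon as some required index \<open>i \<le> n\<close> is missing; the
  loop bound n + 1 reaches the dummy. The table \<open>prec\<close> is expected to be extended by
  the diagonal and a row for the dummy.\<close>

definition interior_prog :: "nat \<Rightarrow> prog" where
  "interior_prog e = PFor ''j'' 0 (PN ''u'' [nv ''j''] (NConst 1) ;;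
     PFor ''i'' 1 (PIf
       (BAnd (BAnd (BNot (flag ''done'' [nv ''j''])) (flag ''prec'' [nv ''i'', nv ''j'']))
             (BAnd (BNot (flag ''done'' [nv ''i''])) (not_in_threshold e)))
       (PN ''u'' [nv ''j''] (NConst 0))))"

text \<open>A strict comparison never replaces the best set by \<open>U\<close> itself, so every
  round schedules a job while some are left.\<close>

definition improve_prog :: prog where
  "improve_prog = PIf (RLess (RTimes (rv ''bg'') (rv ''vf'')) (RTimes (rv ''vg'') (rv ''bf'')))
     (PFor ''j'' 0 (PN ''best'' [nv ''j''] (NVar ''u'' [nv ''j''])) ;;
      PR ''bg'' [] (rv ''vg'') ;; PR ''bf'' [] (rv ''vf''))"

definition candidate_prog :: "nat \<Rightarrow> prog" where
  "candidate_prog e = (interior_prog e ;; PR ''v'' [] (Query_g ''u'' []) ;; sum_prog ''u'' ;;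
     PR ''vg'' [] (RMinus (rv ''v'') (rv ''g0'')) ;;
     PR ''vf'' [] (RMinus (Query_h (rv ''x'')) (rv ''hP'')) ;; improve_prog)"

lemma mods_sum_prog: "set (nmods (sum_prog a)) = {''j''}" "set (rmods (sum_prog a)) = {''x''}"
  by (simp_all add: sum_prog_def)

lemma mods_interior_prog: "set (nmods (interior_prog e)) = {''u'', ''i'', ''j''}" "set (rmods (interior_prog e)) = {}"
  by (auto simp add: interior_prog_def)

lemma mods_improve_prog: "set (nmods improve_prog) = {''best'', ''j''}" "set (rmods improve_prog) = {''bg'', ''bf''}"
  by (auto simp add: improve_prog_def)

lemma mods_candidate_prog:
  "set (nmods (candidate_prog e)) = {''u'', ''i'', ''j'', ''best''}"
  "set (rmods (candidate_prog e)) = {''v'', ''x'', ''vg'', ''vf'', ''bg'', ''bf''}"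
  by (auto simp add: candidate_prog_def mods_sum_prog mods_interior_prog mods_improve_prog)

context scheduling
begin

abbreviation \<Omega> :: oracle_env where "\<Omega> \<equiv> oracles n g h"

lemma oracles_simps [simp]: "jobs \<Omega> = {..<n}" "oracle_g \<Omega> = g" "oracle_h \<Omega> = h"
  by (simp_all add: oracles_def)

section \<open>Correctness of the comparison with the best ideal\<close>

definition flags :: "state \<Rightarrow> vname \<Rightarrow> nat set" where
  "flags s x = {j. j < n \<and> 0 < nats s x [j]}"

lemma query_flags: "{j \<in> {..<n}. nats s x [j] \<noteq> 0} = flags s x" "{j. j < n \<and> nats s x [j] \<noteq> 0} = flags s x"
  "{j. j < n \<and> 0 < nats s x [j]} = flags s x"
  by (auto simp: flags_def)

lemma flags_subset: "flags s x \<subseteq> {..<n}"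
  by (auto simp: flags_def)

definition base :: "nat set \<Rightarrow> state \<Rightarrow> bool" where
  "base U s \<longleftrightarrow> ideal U \<and> nats s ''n'' [] = n \<and>
     (\<forall>i\<le>n. \<forall>j<n. 0 < nats s ''prec'' [i, j] \<longleftrightarrow> i = j \<or> i = n \<or> prec i j) \<and>
     (\<forall>j\<le>n. 0 < nats s ''done'' [j] \<longleftrightarrow> j \<in> U) \<and> (\<forall>j<n. reals s ''p'' [j] = p j) \<and>
     reals s ''P0'' [] = sum p U \<and> reals s ''hP'' [] = f U \<and> reals s ''g0'' [] = g U"

definition best :: "nat set \<Rightarrow> nat set set \<Rightarrow> state \<Rightarrow> bool" where
  "best U D s \<longleftrightarrow> (\<exists>B. flags s ''best'' = B \<and> reals s ''bg'' [] = g B - g U \<and> reals s ''bf'' [] = f B - f U \<and>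
     ideal B \<and> U \<subseteq> B \<and> (B = U \<longrightarrow> U = {..<n}) \<and> (\<forall>X\<in>D. ideal X \<and> U \<subseteq> X \<and> dominates U B X))"

lemma base_cong:
  assumes "base U s" "\<And>x. x \<in> {''n'', ''prec'', ''done''} \<Longrightarrow> nats t x = nats s x"
    "\<And>x. x \<in> {''p'', ''P0'', ''hP'', ''g0''} \<Longrightarrow> reals t x = reals s x"
  shows "base U t"
  using assms by (simp add: base_def)

lemma base_run:
  assumes "base U s" "set (nmods a) \<inter> {''n'', ''prec'', ''done''} = {}"
    "set (rmods a) \<inter> {''p'', ''P0'', ''hP'', ''g0''} = {}"
  shows "base U (run \<Omega> a s)"
  by (rule base_cong[OF assms(1)]) (use assms in \<open>auto intro!: nats_run_other reals_run_other\<close>)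

lemma best_cong:
  assumes "best U D s" "nats t ''best'' = nats s ''best''"
    "reals t ''bg'' = reals s ''bg''" "reals t ''bf'' = reals s ''bf''"
  shows "best U D t"
  using assms by (simp add: best_def flags_def)

lemma best_run:
  assumes "best U D s" "''best'' \<notin> set (nmods a)" "set (rmods a) \<inter> {''bg'', ''bf''} = {}"
  shows "best U D (run \<Omega> a s)"
  by (rule best_cong[OF assms(1)]) (use assms in \<open>auto intro!: nats_run_other reals_run_other\<close>)

lemma run_sum_prog:
  assumes n: "nats s ''n'' [] = n" and p: "\<forall>j<n. reals s ''p'' [j] = p j" and a: "a \<noteq> ''j''"
  shows "reals (run \<Omega> (sum_prog a) s) ''x'' [] = sum p (flags s a)"
proof -
  define s0 where "s0 = rassign ''x'' [] 0 s"
  have "reals (run \<Omega> (PFor ''j'' 0 (PIf (flag a [nv ''j'']) (PR ''x'' [] (RPlus (rv ''x'') (RVar ''p'' [nv ''j'']))))) s0) ''x'' []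
      = sum p (flags s a \<inter> {..<nats s0 ''n'' [] + 0})"
  proof (rule run_For_invariant[where I = "\<lambda>i (u::state). nats u a = nats s a \<and> reals u ''p'' = reals s ''p'' \<and>
      reals u ''x'' [] = sum p (flags s a \<inter> {..<i})", THEN conjunct2, THEN conjunct2])
    fix i and u :: state
    assume i: "i < nats s0 ''n'' [] + 0" and u: "nats u a = nats s a \<and> reals u ''p'' = reals s ''p'' \<and>
      reals u ''x'' [] = sum p (flags s a \<inter> {..<i})"
    have i: "i < n" using i n by (simp add: s0_def)
    have "flags s a \<inter> {..<Suc i} = (if 0 < nats s a [i] then insert i (flags s a \<inter> {..<i}) else flags s a \<inter> {..<i})"
      using i by (auto simp: flags_def less_Suc_eq)
    then show "nats (run \<Omega> (PIf (flag a [nv ''j'']) (PR ''x'' [] (RPlus (rv ''x'') (RVar ''p'' [nv ''j''])))) (nassign ''j'' [] i u)) a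
        = nats s a \<and> reals (run \<Omega> (PIf (flag a [nv ''j'']) (PR ''x'' [] (RPlus (rv ''x'') (RVar ''p'' [nv ''j''])))) (nassign ''j'' [] i u)) ''p''
        = reals s ''p'' \<and> reals (run \<Omega> (PIf (flag a [nv ''j'']) (PR ''x'' [] (RPlus (rv ''x'') (RVar ''p'' [nv ''j''])))) (nassign ''j'' [] i u)) ''x'' [] = sum p (flags s a \<inter> {..<Suc i})"
      using u p i a by (simp add: nats_nassign nats_nassign_other reals_rassign reals_rassign_other)
  qed (use a in \<open>auto simp: s0_def reals_rassign reals_rassign_other nats_nassign_other\<close>)
  moreover have "flags s a \<inter> {..<nats s0 ''n'' [] + 0} = flags s a"
    using n flags_subset by (auto simp: s0_def)
  ultimately show ?thesis by (simp add: sum_prog_def s0_def)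
qed

text \<open>An index missing from both sets is searched for among \<open>j\<close>, its predecessors
  and the dummy; this is the test in the inner loop.\<close>

lemma interior_iff:
  assumes "ideal U" "j < n"
  shows "j \<in> interior U T \<longleftrightarrow>
    \<not> (\<exists>i<n + 1. j \<notin> U \<and> (i = j \<or> i = n \<or> prec i j) \<and> i \<notin> U \<and> i \<notin> T)"
proof -
  have "n \<notin> U" using ideal_subset[OF assms(1)] by auto
  then show ?thesis
    using assms(2) by (auto simp: interior_def less_Suc_eq)
qed

lemma run_interior_prog:
  assumes base: "base U s" and k: "nats s ''k'' [] = k" "k < n + 1"
  shows "flags (run \<Omega> (interior_prog e) s) ''u'' =
    interior U (threshold (n + 1) (\<lambda>i. reals s ''c'' [i]) k e)"
proof -
  let ?T = "threshold (n + 1) (\<lambda>i. reals s ''c'' [i]) k e"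
  have n: "nats s ''n'' [] = n" and U: "ideal U" using base by (auto simp: base_def)
  define bad where "bad i j \<longleftrightarrow> j \<notin> U \<and> (i = j \<or> i = n \<or> prec i j) \<and> i \<notin> U \<and> i \<notin> ?T" for i j
  define ok :: "state \<Rightarrow> bool" where "ok u \<longleftrightarrow> (\<forall>x\<in>{''n'', ''prec'', ''done'', ''k''}. nats u x = nats s x) \<and> reals u = reals s" for u
  have ok_nassign: "ok u \<Longrightarrow> x \<in> {''i'', ''j'', ''u''} \<Longrightarrow> ok (nassign x ks v u)" for u x ks v
    by (auto simp: ok_def nats_nassign_other)
  let ?c = "BAnd (BAnd (BNot (flag ''done'' [nv ''j''])) (flag ''prec'' [nv ''i'', nv ''j'']))
             (BAnd (BNot (flag ''done'' [nv ''i''])) (not_in_threshold e))"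
  have cond: "bval \<Omega> u ?c \<longleftrightarrow> bad i j"
    if "ok u" "nats u ''i'' [] = i" "nats u ''j'' [] = j" "i < n + 1" "j < n" for u i j
  proof -
    have "bval \<Omega> u (not_in_threshold e) \<longleftrightarrow> i \<notin> ?T"
      using that k by (auto simp: not_in_threshold_def threshold_def ok_def)
    moreover have "0 < nats s ''done'' [i] \<longleftrightarrow> i \<in> U" "0 < nats s ''done'' [j] \<longleftrightarrow> j \<in> U"
      "0 < nats s ''prec'' [i, j] \<longleftrightarrow> i = j \<or> i = n \<or> prec i j"
      using base that by (auto simp: base_def)
    ultimately show ?thesis
      using that by (simp add: bad_def ok_def)
  qed
  let ?b = "PN ''u'' [nv ''j''] (NConst 1) ;; PFor ''i'' 1 (PIf ?c (PN ''u'' [nv ''j''] (NConst 0)))"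
  let ?I = "\<lambda>j u. ok u \<and> (\<forall>l<j. 0 < nats u ''u'' [l] \<longleftrightarrow> \<not> (\<exists>i<n + 1. bad i l))"
  have "?I (nats s ''n'' [] + 0) (run \<Omega> (PFor ''j'' 0 ?b) s)"
  proof (rule run_For_invariant)
    show "?I 0 s" by (simp add: ok_def)
    fix i v u assume "?I i u"
    then show "?I i (nassign ''j'' [] v u)" using ok_nassign by (auto simp: nats_nassign)
  next
    fix j u assume j: "j < nats s ''n'' [] + 0" and I: "?I j u"
    have j: "j < n" using j n by simp
    define u1 where "u1 = nassign ''u'' [j] 1 (nassign ''j'' [] j u)"
    let ?J = "\<lambda>i v. ok v \<and> nats v ''j'' [] = j \<and> (\<forall>l<j. 0 < nats v ''u'' [l] \<longleftrightarrow> \<not> (\<exists>i<n + 1. bad i l)) \<and>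
       (0 < nats v ''u'' [j] \<longleftrightarrow> \<not> (\<exists>i'<i. bad i' j))"
    have n1: "nats u1 ''n'' [] = n" using I n by (simp add: u1_def ok_def nats_nassign_other)
    have loop: "?J (nats u1 ''n'' [] + 1) (run \<Omega> (PFor ''i'' 1 (PIf ?c (PN ''u'' [nv ''j''] (NConst 0)))) u1)"
    proof (rule run_For_invariant)
      show "?J 0 u1" using I ok_nassign by (auto simp: u1_def nats_nassign)
      fix i v x assume "?J i v"
      then show "?J i (nassign ''i'' [] x v)" using ok_nassign by (auto simp: nats_nassign)
    next
      fix i v assume i: "i < nats u1 ''n'' [] + 1" and J: "?J i v"
      define v1 where "v1 = nassign ''i'' [] i v"
      have v1: "ok v1" "nats v1 ''i'' [] = i" "nats v1 ''j'' [] = j" "nats v1 ''u'' = nats v ''u''"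
        using J ok_nassign by (auto simp: v1_def nats_nassign nats_nassign_other)
      have c: "bval \<Omega> v1 ?c \<longleftrightarrow> bad i j" using i n1 j v1 by (intro cond) auto
      show "?J (Suc i) (run \<Omega> (PIf ?c (PN ''u'' [nv ''j''] (NConst 0))) (nassign ''i'' [] i v))"
        unfolding v1_def[symmetric] run.simps c
        using J v1 ok_nassign[OF v1(1)] by (auto simp: nats_nassign less_Suc_eq)
    qed
    have body: "run \<Omega> ?b (nassign ''j'' [] j u) =
        run \<Omega> (PFor ''i'' 1 (PIf ?c (PN ''u'' [nv ''j''] (NConst 0)))) u1"
      by (simp add: u1_def nats_nassign del: run.simps(4,5))
    have J: "?J (n + 1) (run \<Omega> ?b (nassign ''j'' [] j u))"
      unfolding body by (rule loop[unfolded n1])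
    then have "0 < nats (run \<Omega> ?b (nassign ''j'' [] j u)) ''u'' [l] \<longleftrightarrow> \<not> (\<exists>i<n + 1. bad i l)"
      if "l < Suc j" for l
      using that by (cases "l = j") (simp_all only: less_Suc_eq, blast+)
    then show "?I (Suc j) (run \<Omega> ?b (nassign ''j'' [] j u))" using J by blast
  qed
  then have "0 < nats (run \<Omega> (interior_prog e) s) ''u'' [l] \<longleftrightarrow> l \<in> interior U ?T" if "l < n" for l
    unfolding interior_prog_def interior_iff[OF U that] bad_def using that n by (simp only: add_0_right)
  then show ?thesis
    using interior_subset[OF ideal_subset[OF U], of ?T] unfolding flags_def by blast
qed

text \<open>Cross-multiplied comparisons can be chained only across a positive middle denominator.
  The strict inequality provides it, as it forces \<open>f U < f B\<close>.\<close>

lemma dominates_trans: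
  assumes "ideal U" "ideal B" "U \<subseteq> B" "ideal X" "U \<subseteq> X" "ideal Y" "U \<subseteq> Y"
    and "dominates U B Y" and X: "(g B - g U) * (f X - f U) < (g X - g U) * (f B - f U)"
  shows "dominates U X Y"
proof -
  have nn: "0 \<le> f C - f U" "0 \<le> g C - g U" if "ideal C" "U \<subseteq> C" for C
    using that f_mono g_mono ideal_subset by auto
  have "f B - f U \<noteq> 0" using X nn[OF assms(2,3)] nn[OF assms(4,5)]
    by (metis mult_nonneg_nonneg mult_zero_right not_less)
  then have B: "0 < f B - f U" using nn[OF assms(2,3)] by simp
  have "((g Y - g U) * (f X - f U)) * (f B - f U) = ((g Y - g U) * (f B - f U)) * (f X - f U)" by simp
  also have "\<dots> \<le> ((g B - g U) * (f Y - f U)) * (f X - f U)"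
    using assms(8) nn[OF assms(4,5)] unfolding dominates_def by (intro mult_right_mono) auto
  also have "\<dots> = ((g B - g U) * (f X - f U)) * (f Y - f U)" by simp
  also have "\<dots> \<le> ((g X - g U) * (f B - f U)) * (f Y - f U)"
    using X nn[OF assms(6,7)] by (intro mult_right_mono) auto
  also have "\<dots> = ((g X - g U) * (f Y - f U)) * (f B - f U)" by simp
  finally show ?thesis unfolding dominates_def by (rule mult_right_le_imp_le[OF _ B])
qed

lemma run_improve_prog:
  assumes n: "nats s ''n'' [] = n" and U: "ideal U" and best: "best U D s"
    and X: "flags s ''u'' = X" "ideal X" "U \<subseteq> X"
    and v: "reals s ''vg'' [] = g X - g U" "reals s ''vf'' [] = f X - f U"
  shows "best U (insert X D) (run \<Omega> improve_prog s)"
proof -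
  obtain B where B: "flags s ''best'' = B" "reals s ''bg'' [] = g B - g U" "reals s ''bf'' [] = f B - f U"
     "ideal B" "U \<subseteq> B" "B = U \<longrightarrow> U = {..<n}" "\<forall>Y\<in>D. ideal Y \<and> U \<subseteq> Y \<and> dominates U B Y"
    using best by (auto simp: best_def)
  show ?thesis
  proof (cases "(g B - g U) * (f X - f U) < (g X - g U) * (f B - f U)")
    case False
    then have "run \<Omega> improve_prog s = s" using B v by (simp add: improve_prog_def)
    moreover have "dominates U B X" using False by (simp add: dominates_def)
    ultimately show ?thesis using B X unfolding best_def by auto
  next
    case True
    let ?a = "PFor ''j'' 0 (PN ''best'' [nv ''j''] (NVar ''u'' [nv ''j'']))"
    let ?I = "\<lambda>i (u::state). nats u ''u'' = nats s ''u'' \<and> reals u = reals s \<and> (\<forall>l<i. nats u ''best'' [l] = nats s ''u'' [l])"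
    have "?I (nats s ''n'' [] + 0) (run \<Omega> ?a s)"
      by (rule run_For_invariant) (auto simp: nats_nassign nats_nassign_other less_Suc_eq)
    then have a: "flags (run \<Omega> ?a s) ''best'' = X" "reals (run \<Omega> ?a s) = reals s"
      using n X(1) by (auto simp: flags_def)
    have "run \<Omega> improve_prog s = rassign ''bf'' [] (f X - f U) (rassign ''bg'' [] (g X - g U) (run \<Omega> ?a s))"
      using True B v a(2) by (simp add: improve_prog_def reals_rassign)
    moreover have "X \<noteq> U" using True by auto
    moreover have "dominates U X Y" if "Y \<in> insert X D" for Y
      using that dominates_trans[OF U B(4,5) X(2,3) _ _ _ True, of Y] B(7) by (auto simp: dominates_def)
    ultimately show ?thesis
      using a X B(7) unfolding best_def flags_def by (auto simp: reals_rassign)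
  qed
qed

lemma run_candidate_prog:
  assumes base: "base U s" and k: "nats s ''k'' [] = k" "k < n + 1" and best: "best U D s"
    and X: "X = interior U (threshold (n + 1) (\<lambda>i. reals s ''c'' [i]) k e)"
  shows "base U (run \<Omega> (candidate_prog e) s)"
    "best U (insert X D) (run \<Omega> (candidate_prog e) s)"
    "reals (run \<Omega> (candidate_prog e) s) ''v'' [] = g X"
proof -
  show "base U (run \<Omega> (candidate_prog e) s)"
    by (rule base_run[OF base]) (auto simp: mods_candidate_prog)
  define s1 where "s1 = run \<Omega> (interior_prog e) s"
  define s2 where "s2 = rassign ''v'' [] (g X) s1"
  define s3 where "s3 = run \<Omega> (sum_prog ''u'') s2"
  define s4 where "s4 = rassign ''vf'' [] (f X - f U) (rassign ''vg'' [] (g X - g U) s3)"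
  have U: "ideal U" using base by (simp add: base_def)
  have b1: "base U s1" unfolding s1_def by (rule base_run[OF base]) (auto simp: mods_interior_prog)
  have t1: "best U D s1" unfolding s1_def by (rule best_run[OF best]) (auto simp: mods_interior_prog)
  have X1: "flags s1 ''u'' = X" unfolding s1_def X using base k by (rule run_interior_prog)
  have b2: "base U s2" by (rule base_cong[OF b1]) (auto simp: s2_def reals_rassign_other)
  have t2: "best U D s2" by (rule best_cong[OF t1]) (auto simp: s2_def reals_rassign_other)
  have X2: "flags s2 ''u'' = X" using X1 by (simp add: s2_def flags_def)
  have b3: "base U s3" unfolding s3_def by (rule base_run[OF b2]) (auto simp: mods_sum_prog)
  have t3: "best U D s3" unfolding s3_def by (rule best_run[OF t2]) (auto simp: mods_sum_prog)
  have X3: "flags s3 ''u'' = X"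
    using X2 nats_run_other[of "''u''" "sum_prog ''u''" \<Omega> s2] by (simp add: s3_def flags_def mods_sum_prog)
  have x3: "reals s3 ''x'' [] = sum p X"
    unfolding s3_def X2[symmetric] using b2 by (intro run_sum_prog) (auto simp: base_def)
  have v3: "reals s3 ''v'' [] = g X"
    using reals_run_other[of "''v''" "sum_prog ''u''" \<Omega> s2]
    by (simp add: s3_def mods_sum_prog s2_def reals_rassign)
  have s4: "run \<Omega> (candidate_prog e) s = run \<Omega> improve_prog s4"
    using X1 x3 v3 b3
    by (simp add: candidate_prog_def s4_def s3_def[symmetric] s2_def[symmetric] s1_def[symmetric]
        query_flags reals_rassign base_def f_def)
  have b4: "base U s4" by (rule base_cong[OF b3]) (auto simp: s4_def reals_rassign_other)
  have t4: "best U D s4" by (rule best_cong[OF t3]) (auto simp: s4_def reals_rassign_other)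
  have X4: "flags s4 ''u'' = X" using X3 by (simp add: s4_def flags_def)
  have "best U (insert X D) (run \<Omega> improve_prog s4)"
    by (rule run_improve_prog[OF _ U t4 X4])
      (use b4 ideal_interior[OF U] subset_interior X in \<open>auto simp: s4_def reals_rassign base_def\<close>)
  then show "best U (insert X D) (run \<Omega> (candidate_prog e) s)" using s4 by simp
  show "reals (run \<Omega> (candidate_prog e) s) ''v'' [] = g X"
    using reals_run_other[of "''v''" improve_prog \<Omega> s4] v3
    by (simp add: s4 mods_improve_prog s4_def reals_rassign)
qed

end

section \<open>Programs for the weights, the capacities and the grid\<close>

definition acc_exp :: rexp where
  "acc_exp = RDivide rone (RTimes (Of_Nat (NPlus (nv ''n'') (NConst 8))) (Of_Nat (NPlus (nv ''n'') (NConst 8))))"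

text \<open>The greedy value is a difference of two gains, in which \<open>g U\<close> cancels, so
  two oracle values suffice. Computing them by \<open>candidate_prog\<close> compares the interiors
  of the thresholds with the best set at the same time.\<close>

definition rates_prog :: prog where
  "rates_prog = PFor ''k'' 1 (candidate_prog 0 ;; PR ''y'' [nv ''k''] (RMinus rzero (rv ''v'')) ;;
     candidate_prog 1 ;; PR ''y'' [nv ''k''] (RPlus (RVar ''y'' [nv ''k'']) (rv ''v'')) ;;
     PIf (RLess (rv ''r'') (RDivide (RVar ''y'' [nv ''k'']) (RVar ''cap'' [nv ''k''])))
       (PR ''r'' [] (RDivide (RVar ''y'' [nv ''k'']) (RVar ''cap'' [nv ''k'']))))"

definition update_prog :: prog where
  "update_prog = PFor ''k'' 1 (PR ''c'' [nv ''k''] (RTimes (RVar ''c'' [nv ''k'']) (RPlus rone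
     (RTimes acc_exp (RDivide (RDivide (RVar ''y'' [nv ''k'']) (RVar ''cap'' [nv ''k''])) (rv ''r''))))))"

text \<open>
  If \<open>g\<close> has no gain left, the rate is \<open>0\<close>, and since \<open>x / 0 = 0\<close> the weights stay unchanged.
\<close>

definition weights_prog :: prog where
  "weights_prog = (PFor ''k'' 1 (PR ''c'' [nv ''k''] (RDivide rone (RVar ''cap'' [nv ''k'']))) ;;
     repeat [''t1'', ''t2'', ''t3'', ''t4'', ''t5'', ''t6''] 8
       (PR ''r'' [] rzero ;; rates_prog ;; update_prog))"

definition capacity_prog :: prog where
  "capacity_prog = (PR ''a'' [] (RTimes acc_exp (RVar ''p'' [nv ''m''])) ;;
     PR ''hq'' [] (RMinus (Query_h (RPlus (rv ''P0'') (rv ''q''))) (rv ''hP'')) ;;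
     PR ''sl'' [] (RDivide (RMinus (RMinus (Query_h (RPlus (rv ''P0'') (RPlus (rv ''q'') (rv ''a'')))) (rv ''hP''))
       (rv ''hq'')) (rv ''a'')) ;;
     PR ''ad'' [] (RDivide (RTimes acc_exp (rv ''hq'')) (Of_Nat (NPlus (nv ''n'') (NConst 1)))) ;;
     PFor ''k'' 0 (PR ''cap'' [nv ''k''] (RPlus (RTimes (rv ''sl'') (RVar ''p'' [nv ''k''])) (rv ''ad''))) ;;
     PR ''cap'' [nv ''n''] (RPlus (RMinus (rv ''hq'') (RTimes (rv ''sl'') (rv ''q''))) (rv ''ad'')))"

definition grid_prog :: prog where
  "grid_prog = (PR ''q'' [] (RVar ''p'' [nv ''m'']) ;;
     repeat [''i1'', ''i2'', ''i3''] 8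
       (capacity_prog ;; weights_prog ;; PR ''q'' [] (RPlus (rv ''q'') (rv ''a''))))"

lemma nmods_repeat: "set (nmods (repeat xs d a)) = set xs \<union> set (nmods a)"
  by (induction xs) (auto simp: repeat_def)

lemma rmods_repeat: "set (rmods (repeat xs d a)) = set (rmods a)"
  by (induction xs) (auto simp: repeat_def)

lemma wf_repeat: "wf_prog a \<Longrightarrow> distinct xs \<Longrightarrow> ''n'' \<notin> set xs \<Longrightarrow> set xs \<inter> set (nmods a) = {} \<Longrightarrow>
    wf_prog (repeat xs d a)"
  by (induction xs) (auto simp: repeat_def nmods_repeat[unfolded repeat_def])

lemma mods_rates_prog:
  "set (nmods rates_prog) = {''u'', ''i'', ''j'', ''k'', ''best''}"
  "set (rmods rates_prog) = {''v'', ''x'', ''vg'', ''vf'', ''bg'', ''bf'', ''y'', ''r''}"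
  by (auto simp add: rates_prog_def mods_candidate_prog)

lemma mods_update_prog: "set (nmods update_prog) = {''k''}" "set (rmods update_prog) = {''c''}"
  by (auto simp add: update_prog_def)

lemma mods_weights_prog:
  "set (nmods weights_prog) = {''t1'', ''t2'', ''t3'', ''t4'', ''t5'', ''t6'', ''u'', ''i'', ''j'', ''k'', ''best''}"
  "set (rmods weights_prog) = {''v'', ''x'', ''vg'', ''vf'', ''bg'', ''bf'', ''y'', ''r'', ''c''}"
  by (auto simp add: weights_prog_def nmods_repeat rmods_repeat mods_rates_prog mods_update_prog)

lemma mods_capacity_prog:
  "set (nmods capacity_prog) = {''k''}"
  "set (rmods capacity_prog) = {''a'', ''hq'', ''sl'', ''ad'', ''cap''}"
  by (auto simp add: capacity_prog_def)

lemma mods_grid_prog: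
  "set (nmods grid_prog) = {''i1'', ''i2'', ''i3'', ''t1'', ''t2'', ''t3'', ''t4'', ''t5'', ''t6'', ''u'', ''i'', ''j'', ''k'', ''best''}"
  "set (rmods grid_prog) = {''a'', ''hq'', ''sl'', ''ad'', ''cap'', ''q'', ''v'', ''x'', ''vg'', ''vf'', ''bg'', ''bf'', ''y'', ''r'', ''c''}"
  by (auto simp add: grid_prog_def nmods_repeat rmods_repeat mods_weights_prog mods_capacity_prog)

context scheduling
begin

section \<open>Correctness of the search for a nearly densest ideal\<close>

lemma best_antimono: "best U D s \<Longrightarrow> D' \<subseteq> D \<Longrightarrow> best U D' s"
  unfolding best_def by blast

lemma base_n: "base U s \<Longrightarrow> nats s ''n'' [] = n"
  by (simp add: base_def)

lemma base_nassign: "base U s \<Longrightarrow> x \<notin> {''n'', ''prec'', ''done''} \<Longrightarrow> base U (nassign x ks v s)"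
  by (rule base_cong[of U s]) (auto intro!: nats_nassign_other)

lemma base_rassign: "base U s \<Longrightarrow> x \<notin> {''p'', ''P0'', ''hP'', ''g0''} \<Longrightarrow> base U (rassign x ks v s)"
  by (rule base_cong[of U s]) (auto intro!: reals_rassign_other)

lemma best_nassign: "best U D s \<Longrightarrow> x \<noteq> ''best'' \<Longrightarrow> best U D (nassign x ks v s)"
  by (rule best_cong[of U D s]) (auto intro!: nats_nassign_other)

lemma best_rassign: "best U D s \<Longrightarrow> x \<notin> {''bg'', ''bf''} \<Longrightarrow> best U D (rassign x ks v s)"
  by (rule best_cong[of U D s]) (auto intro!: reals_rassign_other)

lemma acc_exp: "nats s ''n'' [] = n \<Longrightarrow> rval \<Omega> s acc_exp = accuracy"
  by (simp add: acc_exp_def accuracy_def power2_eq_square)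

abbreviation (input) swept :: "nat set \<Rightarrow> (nat \<Rightarrow> real) \<Rightarrow> nat \<Rightarrow> nat set" where
  "swept U c k \<equiv> interior U (threshold (n + 1) c k 1)"

lemma run_rates_prog:
  assumes base: "base U s" and best: "best U D s" and r: "reals s ''r'' [] = 0"
    and c: "\<forall>k<n + 1. reals s ''c'' [k] = c k" and cap: "\<forall>k<n + 1. reals s ''cap'' [k] = cap k"
  shows "best U (D \<union> swept U c ` {..<n + 1}) (run \<Omega> rates_prog s)"
    "\<forall>k<n + 1. reals (run \<Omega> rates_prog s) ''y'' [k] = greedy (n + 1) (gain U) c k"
    "reals (run \<Omega> rates_prog s) ''r'' [] = rate (n + 1) (gain U) cap c"
proof -
  let ?Y = "greedy (n + 1) (gain U) c"
  let ?b = "candidate_prog 0 ;; PR ''y'' [nv ''k''] (RMinus rzero (rv ''v'')) ;;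
     candidate_prog 1 ;; PR ''y'' [nv ''k''] (RPlus (RVar ''y'' [nv ''k'']) (rv ''v'')) ;;
     PIf (RLess (rv ''r'') (RDivide (RVar ''y'' [nv ''k'']) (RVar ''cap'' [nv ''k''])))
       (PR ''r'' [] (RDivide (RVar ''y'' [nv ''k'']) (RVar ''cap'' [nv ''k''])))"
  let ?I = "\<lambda>i u. base U u \<and> best U (D \<union> swept U c ` {..<i}) u \<and> reals u ''c'' = reals s ''c'' \<and>
      reals u ''cap'' = reals s ''cap'' \<and> (\<forall>k<i. reals u ''y'' [k] = ?Y k) \<and>
      reals u ''r'' [] = Max (insert 0 ((\<lambda>k. ?Y k / cap k) ` {..<i}))"
  have "?I (nats s ''n'' [] + 1) (run \<Omega> (PFor ''k'' 1 ?b) s)"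
  proof (rule run_For_invariant)
    show "?I 0 s" using base best r by simp
    fix i v u assume "?I i u"
    then show "?I i (nassign ''k'' [] v u)" by (simp add: base_nassign best_nassign)
  next
    fix i u assume i: "i < nats s ''n'' [] + 1" and I: "?I i u"
    have i: "i < n + 1" using i base_n[OF base] by simp
    have thr: "threshold (n + 1) (\<lambda>i. reals s ''c'' [i]) i e = threshold (n + 1) c i e" for e
      using c i by (intro threshold_cong) auto
    define v0 where "v0 = nassign ''k'' [] i u"
    define v1 where "v1 = run \<Omega> (candidate_prog 0) v0"
    define X0 where "X0 = interior U (threshold (n + 1) c i 0)"
    define v2 where "v2 = rassign ''y'' [i] (- g X0) v1"
    define v3 where "v3 = run \<Omega> (candidate_prog 1) v2"
    define v4 where "v4 = rassign ''y'' [i] (?Y i) v3"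
    have v0: "base U v0" "best U (D \<union> swept U c ` {..<i}) v0" "nats v0 ''k'' [] = i" "reals v0 = reals u"
      using I by (auto simp: v0_def base_nassign best_nassign nats_nassign)
    have X0': "X0 = interior U (threshold (n + 1) (\<lambda>i. reals v0 ''c'' [i]) i 0)"
      using I thr by (simp add: X0_def v0)
    note cand0 = run_candidate_prog[OF v0(1,3) i v0(2) X0', folded v1_def]
    have f1: "reals v1 y = reals u y" if "y \<in> {''c'', ''cap'', ''y'', ''r''}" for y
      unfolding v1_def v0(4)[symmetric] using that by (intro reals_run_other) (auto simp: mods_candidate_prog)
    have k1: "nats v1 ''k'' [] = i"
      unfolding v1_def using v0(3) nats_run_other[of "''k''" "candidate_prog 0" \<Omega> v0] by (simp add: mods_candidate_prog)
    have v2: "base U v2" "best U (insert X0 (D \<union> swept U c ` {..<i})) v2" "nats v2 ''k'' [] = i"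
      using cand0 k1 by (auto simp: v2_def base_rassign best_rassign)
    have X1: "swept U c i = interior U (threshold (n + 1) (\<lambda>i. reals v2 ''c'' [i]) i 1)"
      using I thr f1 by (simp add: v2_def reals_rassign)
    note cand1 = run_candidate_prog[OF v2(1,3) i v2(2) X1, folded v3_def]
    have f3: "reals v3 y = reals v2 y" if "y \<in> {''c'', ''cap'', ''y'', ''r''}" for y
      unfolding v3_def using that by (intro reals_run_other) (auto simp: mods_candidate_prog)
    have k3: "nats v3 ''k'' [] = i"
      unfolding v3_def using v2(3) nats_run_other[of "''k''" "candidate_prog 1" \<Omega> v2] by (simp add: mods_candidate_prog)
    have Y: "reals v3 ''y'' [i] + reals v3 ''v'' [] = ?Y i"
      using cand1(3) f3[of "''y''"] by (simp add: v2_def reals_rassign greedy_def gain_def X0_def)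
    have v4: "base U v4" "best U (insert (swept U c i) (insert X0 (D \<union> swept U c ` {..<i}))) v4"
      using cand1 by (auto simp: v4_def base_rassign best_rassign)
    \<comment> \<open>The sets with \<open>e = 0\<close> have been compared as well, but the
      invariant records those with \<open>e = 1\<close> only.\<close>
    have D: "D \<union> swept U c ` {..<Suc i} \<subseteq> insert (swept U c i) (insert X0 (D \<union> swept U c ` {..<i}))"
      by (auto simp: less_Suc_eq)
    note v4' = v4(1) best_antimono[OF v4(2) D]
    have y4: "\<forall>k<Suc i. reals v4 ''y'' [k] = ?Y k"
      using I f1 f3 by (auto simp: v4_def v2_def reals_rassign less_Suc_eq)
    define R where "R = Max (insert 0 ((\<lambda>k. ?Y k / cap k) ` {..<i}))"
    have r4: "reals v4 ''r'' [] = R" "reals v4 ''cap'' = reals s ''cap''"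
        "reals v4 ''c'' = reals s ''c''" "nats v4 ''k'' [] = i"
      using I f1 f3 k3 by (auto simp: v4_def v2_def reals_rassign reals_rassign_other R_def)
    have "insert 0 ((\<lambda>k. ?Y k / cap k) ` {..<Suc i}) = insert (?Y i / cap i) (insert 0 ((\<lambda>k. ?Y k / cap k) ` {..<i}))"
      by (auto simp: less_Suc_eq)
    then have max: "Max (insert 0 ((\<lambda>k. ?Y k / cap k) ` {..<Suc i})) =
        max (?Y i / cap i) R"
      by (simp add: R_def)
    have run: "run \<Omega> ?b (nassign ''k'' [] i u) =
       (if R < ?Y i / cap i then rassign ''r'' [] (?Y i / cap i) v4 else v4)"
      using k1 k3 cand0(3) Y r4 y4 cap i
      by (simp add: v0_def[symmetric] v1_def[symmetric] v2_def[symmetric] v3_def[symmetric] v4_def[symmetric]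
          del: One_nat_def)
    show "?I (Suc i) (run \<Omega> ?b (nassign ''k'' [] i u))"
      unfolding run max using v4' y4 r4(1-3)
      by (auto simp: base_rassign best_rassign reals_rassign reals_rassign_other max_def)
  qed
  then show "best U (D \<union> swept U c ` {..<n + 1}) (run \<Omega> rates_prog s)"
    "\<forall>k<n + 1. reals (run \<Omega> rates_prog s) ''y'' [k] = greedy (n + 1) (gain U) c k"
    "reals (run \<Omega> rates_prog s) ''r'' [] = rate (n + 1) (gain U) cap c"
    unfolding rates_prog_def[symmetric] base_n[OF base] rate_def by blast+
qed

lemma run_update_prog:
  assumes n: "nats s ''n'' [] = n"
    and c: "\<forall>k<n + 1. reals s ''c'' [k] = c k" and cap: "\<forall>k<n + 1. reals s ''cap'' [k] = cap k"
    and y: "\<forall>k<n + 1. reals s ''y'' [k] = y k" and r: "reals s ''r'' [] = r"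
  shows "\<forall>k<n + 1. reals (run \<Omega> update_prog s) ''c'' [k] = c k * (1 + accuracy * (y k / cap k / r))"
proof -
  let ?b = "PR ''c'' [nv ''k''] (RTimes (RVar ''c'' [nv ''k'']) (RPlus rone
     (RTimes acc_exp (RDivide (RDivide (RVar ''y'' [nv ''k'']) (RVar ''cap'' [nv ''k''])) (rv ''r'')))))"
  let ?I = "\<lambda>i (u::state). nats u ''n'' [] = n \<and> reals u ''cap'' = reals s ''cap'' \<and> reals u ''y'' = reals s ''y'' \<and>
      reals u ''r'' = reals s ''r'' \<and>
      (\<forall>k<n + 1. reals u ''c'' [k] = (if k < i then c k * (1 + accuracy * (y k / cap k / r)) else c k))"
  have "?I (nats s ''n'' [] + 1) (run \<Omega> (PFor ''k'' 1 ?b) s)"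
  proof (rule run_For_invariant)
    show "?I 0 s" using n c by simp
    fix i v and u :: state assume "?I i u"
    then show "?I i (nassign ''k'' [] v u)" by (simp add: nats_nassign)
  next
    fix i and u :: state assume i: "i < nats s ''n'' [] + 1" and I: "?I i u"
    have i: "i < n + 1" using i n by simp
    have a: "rval \<Omega> (nassign ''k'' [] i u) acc_exp = accuracy"
      by (rule acc_exp) (use I in \<open>simp add: nats_nassign\<close>)
    show "?I (Suc i) (run \<Omega> ?b (nassign ''k'' [] i u))"
      using I i y r cap by (auto simp: nats_nassign reals_rassign reals_rassign_other a less_Suc_eq)
  qed
  then show ?thesis unfolding update_prog_def[symmetric] n by simp
qed

lemma run_weights_prog:
  assumes base: "base U s" and best: "best U D s"
    and cap: "\<forall>k<n + 1. reals s ''cap'' [k] = cap k"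
  shows "base U (run \<Omega> weights_prog s)"
    "best U (D \<union> {swept U (weights accuracy (n + 1) (gain U) cap t) k | t k. t < (n + 8) ^ 6 \<and> k < n + 1})
       (run \<Omega> weights_prog s)"
proof -
  show "base U (run \<Omega> weights_prog s)"
    by (rule base_run[OF base]) (auto simp: mods_weights_prog)
  let ?w = "weights accuracy (n + 1) (gain U) cap"
  let ?init = "PFor ''k'' 1 (PR ''c'' [nv ''k''] (RDivide rone (RVar ''cap'' [nv ''k''])))"
  define s1 where "s1 = run \<Omega> ?init s"
  have "reals s1 ''cap'' = reals s ''cap'' \<and> (\<forall>k<nats s ''n'' [] + 1. reals s1 ''c'' [k] = 1 / reals s ''cap'' [k])"
    unfolding s1_def
  proof (rule run_For_invariant)
    fix i and u :: state
    assume "reals u ''cap'' = reals s ''cap'' \<and> (\<forall>k<i. reals u ''c'' [k] = 1 / reals s ''cap'' [k])"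
    then show "reals (run \<Omega> (PR ''c'' [nv ''k''] (RDivide rone (RVar ''cap'' [nv ''k'']))) (nassign ''k'' [] i u)) ''cap'' =
        reals s ''cap'' \<and>
      (\<forall>k<Suc i. reals (run \<Omega> (PR ''c'' [nv ''k''] (RDivide rone (RVar ''cap'' [nv ''k'']))) (nassign ''k'' [] i u)) ''c'' [k]
        = 1 / reals s ''cap'' [k])"
      by (auto simp: nats_nassign reals_rassign reals_rassign_other less_Suc_eq)
  qed auto
  then have c1: "\<forall>k<n + 1. reals s1 ''c'' [k] = ?w 0 k" "reals s1 ''cap'' = reals s ''cap''"
    using cap base_n[OF base] by auto
  have b1: "base U s1" unfolding s1_def by (rule base_run[OF base]) auto
  have t1: "best U D s1" unfolding s1_def by (rule best_run[OF best]) auto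
  let ?D = "\<lambda>i. D \<union> {swept U (?w t) k | t k. t < i \<and> k < n + 1}"
  let ?I = "\<lambda>i u. base U u \<and> best U (?D i) u \<and> reals u ''cap'' = reals s ''cap'' \<and>
     (\<forall>k<n + 1. reals u ''c'' [k] = ?w i k)"
  let ?b = "PR ''r'' [] rzero ;; rates_prog ;; update_prog"
  let ?xs = "[''t1'', ''t2'', ''t3'', ''t4'', ''t5'', ''t6'']"
  have "?I ((n + 8) ^ length ?xs) (run \<Omega> (repeat ?xs 8 ?b) s1)"
  proof (rule run_repeat_invariant)
    show "?I 0 s1" using b1 t1 c1 by simp
    show "nats u ''n'' [] = n" if "?I i u" for i u using that base_n by blast
    show "?I i (nassign x [] v u)" if "x \<in> set ?xs" "?I i u" for i x v u
      using that by (auto simp: base_nassign best_nassign)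
  next
    fix i u assume I: "?I i u"
    define v0 where "v0 = rassign ''r'' [] 0 u"
    define v1 where "v1 = run \<Omega> rates_prog v0"
    define v2 where "v2 = run \<Omega> update_prog v1"
    have v0: "base U v0" "best U (?D i) v0" "reals v0 ''r'' [] = 0" "\<forall>k<n + 1. reals v0 ''c'' [k] = ?w i k"
      "\<forall>k<n + 1. reals v0 ''cap'' [k] = cap k"
      using I cap by (auto simp: v0_def base_rassign best_rassign reals_rassign)
    note rates = run_rates_prog[OF v0, folded v1_def]
    have b1: "base U v1" unfolding v1_def by (rule base_run[OF v0(1)]) (auto simp: mods_rates_prog)
    have f1: "reals v1 ''c'' = reals v0 ''c''" "reals v1 ''cap'' = reals v0 ''cap''"
      unfolding v1_def by (auto intro!: reals_run_other simp: mods_rates_prog)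
    have "\<forall>k<n + 1. reals v2 ''c'' [k] = ?w (Suc i) k"
      using run_update_prog[OF base_n[OF b1] _ _ rates(2,3), of "?w i" cap] v0 f1 by (simp add: v2_def)
    moreover have "base U v2" unfolding v2_def by (rule base_run[OF b1]) (auto simp: mods_update_prog)
    moreover have "best U (?D i \<union> swept U (?w i) ` {..<n + 1}) v2"
      unfolding v2_def by (rule best_run[OF rates(1)]) (auto simp: mods_update_prog)
    then have "best U (?D (Suc i)) v2" by (rule best_antimono) (auto simp: less_Suc_eq)
    moreover have "reals v2 ''cap'' = reals s ''cap''"
      unfolding v2_def using f1 I reals_run_other[of "''cap''" update_prog \<Omega> v1]
      by (simp add: mods_update_prog v0_def reals_rassign_other)
    ultimately show "?I (Suc i) (run \<Omega> ?b u)"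
      by (simp add: v0_def[symmetric] v1_def[symmetric] v2_def[symmetric] del: weights.simps)
  qed
  moreover have "length ?xs = 6" by simp
  ultimately show "best U (?D ((n + 8) ^ 6)) (run \<Omega> weights_prog s)"
    unfolding weights_prog_def run.simps(3) s1_def[symmetric] by metis
qed

lemma run_capacity_prog:
  assumes base: "base U s" and m: "nats s ''m'' [] = m" "m < n" and q: "reals s ''q'' [] = grid m i"
  shows "\<forall>k<n + 1. reals (run \<Omega> capacity_prog s) ''cap'' [k] = capacity U m i k"
    "reals (run \<Omega> capacity_prog s) ''a'' [] = accuracy * p m"
proof -
  let ?a = "accuracy * p m"
  let ?hq = "rise U (grid m i)"
  let ?ad = "accuracy * ?hq / (real n + 1)"
  let ?sl = "slope U m i"
  define s0 where "s0 = rassign ''ad'' [] ?ad (rassign ''sl'' [] ?sl (rassign ''hq'' [] ?hq (rassign ''a'' [] ?a s)))"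
  have n: "nats s ''n'' [] = n" using base by (rule base_n)
  have acc: "rval \<Omega> (rassign x ks v u) acc_exp = rval \<Omega> u acc_exp" for x ks v u
    by (simp add: acc_exp_def)
  have grid: "grid m i + accuracy * p m = grid m (Suc i)"
    by (simp add: grid_def algebra_simps)
  let ?b = "PR ''cap'' [nv ''k''] (RPlus (RTimes (rv ''sl'') (RVar ''p'' [nv ''k''])) (rv ''ad''))"
  define s1 where "s1 = run \<Omega> (PFor ''k'' 0 ?b) s0"
  have run: "run \<Omega> capacity_prog s = rassign ''cap'' [n] (?hq - ?sl * grid m i + ?ad) s1"
  proof -
    have s0: "run \<Omega> capacity_prog s = run \<Omega> (PFor ''k'' 0 ?b ;;
       PR ''cap'' [nv ''n''] (RPlus (RMinus (rv ''hq'') (RTimes (rv ''sl'') (rv ''q''))) (rv ''ad''))) s0"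
      using base m q acc_exp[OF n] grid
      by (simp add: capacity_prog_def s0_def reals_rassign base_def acc rise_def slope_def f_def n add.assoc
          add.commute[of 1 "real n"]
          del: run.simps(5))
    have f1: "reals s1 x = reals s0 x" if "x \<noteq> ''cap''" for x
      unfolding s1_def using that by (intro reals_run_other) auto
    have n1: "nats s1 ''n'' = nats s0 ''n''"
      unfolding s1_def by (intro nats_run_other) auto
    have v0: "reals s0 ''hq'' [] = ?hq" "reals s0 ''sl'' [] = ?sl" "reals s0 ''ad'' [] = ?ad"
        "reals s0 ''q'' [] = grid m i" "nats s0 ''n'' [] = n"
      using n q by (auto simp: s0_def reals_rassign)
    show ?thesis
      unfolding s0 by (simp add: s1_def[symmetric] n1 f1 v0 del: run.simps(5))
  qed
  have "(\<forall>x. x \<noteq> ''cap'' \<longrightarrow> reals s1 x = reals s0 x) \<and>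
     (\<forall>k<nats s0 ''n'' [] + 0. reals s1 ''cap'' [k] = ?sl * reals s ''p'' [k] + ?ad)"
    unfolding s1_def
  proof (rule run_For_invariant)
    fix i' and u :: state
    assume "(\<forall>x. x \<noteq> ''cap'' \<longrightarrow> reals u x = reals s0 x) \<and>
       (\<forall>k<i'. reals u ''cap'' [k] = ?sl * reals s ''p'' [k] + ?ad)"
    then show "(\<forall>x. x \<noteq> ''cap'' \<longrightarrow> reals (run \<Omega> ?b (nassign ''k'' [] i' u)) x = reals s0 x) \<and>
       (\<forall>k<Suc i'. reals (run \<Omega> ?b (nassign ''k'' [] i' u)) ''cap'' [k] = ?sl * reals s ''p'' [k] + ?ad)"
      by (auto simp: nats_nassign reals_rassign reals_rassign_other less_Suc_eq s0_def)
  qed auto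
  then have s1: "\<forall>k<n. reals s1 ''cap'' [k] = ?sl * p k + ?ad" "reals s1 ''a'' [] = ?a"
    using n base by (auto simp: s0_def base_def reals_rassign)
  show "\<forall>k<n + 1. reals (run \<Omega> capacity_prog s) ''cap'' [k] = capacity U m i k"
    "reals (run \<Omega> capacity_prog s) ''a'' [] = accuracy * p m"
    unfolding run using s1 by (auto simp: reals_rassign capacity_def)
qed

lemma run_grid_prog:
  assumes base: "base U s" and best: "best U D s" and m: "nats s ''m'' [] = m" "m < n"
  shows "best U (D \<union> {candidate U m i t k | i t k. i < (n + 8) ^ 3 \<and> t < (n + 8) ^ 6 \<and> k < n + 1})
       (run \<Omega> grid_prog s)"
proof -
  define s1 where "s1 = rassign ''q'' [] (p m) s"
  let ?D = "\<lambda>l. D \<union> {candidate U m i t k | i t k. i < l \<and> t < (n + 8) ^ 6 \<and> k < n + 1}"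
  let ?I = "\<lambda>i u. base U u \<and> best U (?D i) u \<and> reals u ''q'' [] = grid m i \<and> nats u ''m'' [] = m"
  let ?b = "capacity_prog ;; weights_prog ;; PR ''q'' [] (RPlus (rv ''q'') (rv ''a''))"
  let ?xs = "[''i1'', ''i2'', ''i3'']"
  have "?I ((n + 8) ^ length ?xs) (run \<Omega> (repeat ?xs 8 ?b) s1)"
  proof (rule run_repeat_invariant)
    show "?I 0 s1" using base best m by (simp add: s1_def base_rassign best_rassign reals_rassign grid_def)
    show "nats u ''n'' [] = n" if "?I i u" for i u using that base_n by blast
    show "?I i (nassign x [] v u)" if "x \<in> set ?xs" "?I i u" for i x v u
      using that by (auto simp: base_nassign best_nassign nats_nassign)
  next
    fix i u assume I: "?I i u"
    define v1 where "v1 = run \<Omega> capacity_prog u"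
    define v2 where "v2 = run \<Omega> weights_prog v1"
    have b1: "base U v1" unfolding v1_def by (rule base_run) (use I in \<open>auto simp: mods_capacity_prog\<close>)
    have t1: "best U (?D i) v1" unfolding v1_def by (rule best_run) (use I in \<open>auto simp: mods_capacity_prog\<close>)
    have cap: "\<forall>k<n + 1. reals v1 ''cap'' [k] = capacity U m i k" "reals v1 ''a'' [] = accuracy * p m"
      unfolding v1_def using I m(2) run_capacity_prog by blast+
    have f1: "reals v1 ''q'' = reals u ''q''" "nats v1 ''m'' = nats u ''m''"
      unfolding v1_def by (auto intro!: reals_run_other nats_run_other simp: mods_capacity_prog)
    have f2: "reals v2 ''q'' = reals v1 ''q''" "reals v2 ''a'' = reals v1 ''a''" "nats v2 ''m'' = nats v1 ''m''"
      unfolding v2_def by (auto intro!: reals_run_other nats_run_other simp: mods_weights_prog)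
    note w = run_weights_prog[OF b1 t1 cap(1), folded v2_def]
    have "best U (?D (Suc i)) v2"
      by (rule best_antimono[OF w(2)]) (auto simp: less_Suc_eq candidate_def)
    moreover have "run \<Omega> ?b u = rassign ''q'' [] (grid m (Suc i)) v2"
      using I f1 f2 cap by (simp add: v1_def[symmetric] v2_def[symmetric] grid_def algebra_simps)
    ultimately show "?I (Suc i) (run \<Omega> ?b u)"
      using w I f1 f2 by (simp add: base_rassign best_rassign reals_rassign)
  qed
  moreover have "length ?xs = 3" by simp
  moreover have "run \<Omega> grid_prog s = run \<Omega> (repeat ?xs 8 ?b) s1"
    using base m by (simp add: grid_prog_def s1_def base_def)
  ultimately show ?thesis by metis
qed

end

section \<open>Programs for scheduling a block and for a round\<close>

text \<open>The number of predecessors strictly increases along \<open>prec\<close>, so taking the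
  unscheduled jobs of the block by this number gives a topological order; the loop over
  \<open>d\<close> replaces sorting.\<close>

definition schedule_prog :: prog where
  "schedule_prog = PFor ''d'' 0 (PFor ''j'' 0 (PIf
     (BAnd (BAnd (flag ''best'' [nv ''j'']) (BNot (flag ''done'' [nv ''j''])))
       (BAnd (BNot (NLess (NVar ''depth'' [nv ''j'']) (nv ''d''))) (BNot (NLess (nv ''d'') (NVar ''depth'' [nv ''j''])))))
     (PN ''out'' [nv ''cnt''] (nv ''j'') ;; PN ''cnt'' [] (NPlus (nv ''cnt'') (NConst 1)) ;;
      PN ''done'' [nv ''j''] (NConst 1))))"

text \<open>The search starts from the set of all jobs. It is an ideal and differs from
  \<open>U\<close> until all jobs are scheduled, which secures progress.\<close>

definition header_prog :: prog where
  "header_prog = (sum_prog ''done'' ;; PR ''P0'' [] (rv ''x'') ;; PR ''hP'' [] (Query_h (rv ''x'')) ;;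
     PR ''g0'' [] (Query_g ''done'' []) ;; PFor ''j'' 0 (PN ''best'' [nv ''j''] (NConst 1)) ;;
     sum_prog ''best'' ;; PR ''bf'' [] (RMinus (Query_h (rv ''x'')) (rv ''hP'')) ;;
     PR ''bg'' [] (RMinus (Query_g ''best'' []) (rv ''g0'')))"

text \<open>
  With weights \<open>-p\<close> and \<open>0\<close> for the dummy job, the threshold of the dummy job consists of the jobs
  without processing time. They are treated separately because density is infinite on them.
\<close>

definition zero_prog :: prog where
  "zero_prog = (PFor ''j'' 0 (PR ''c'' [nv ''j''] (RMinus rzero (RVar ''p'' [nv ''j'']))) ;;
     PR ''c'' [nv ''n''] rzero ;; PN ''k'' [] (nv ''n'') ;; candidate_prog 1)"

definition round_prog :: prog where
  "round_prog = (header_prog ;; zero_prog ;; PFor ''m'' 0 grid_prog ;; schedule_prog)"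

text \<open>Depths must be counted before the diagonal and the row of the dummy are written into
  \<open>prec\<close>. The reflexive entries let \<open>interior_prog\<close> treat a job as its own
  predecessor.\<close>

definition init_prog :: prog where
  "init_prog = (PFor ''j'' 0 (PFor ''i'' 0 (PIf (flag ''prec'' [nv ''i'', nv ''j''])
       (PN ''depth'' [nv ''j''] (NPlus (NVar ''depth'' [nv ''j'']) (NConst 1))))) ;;
     PFor ''j'' 0 (PN ''prec'' [nv ''n'', nv ''j''] (NConst 1) ;; PN ''prec'' [nv ''j'', nv ''j''] (NConst 1)))"

definition main_prog :: prog where
  "main_prog = (init_prog ;; PFor ''r'' 0 round_prog)"

lemma mods_schedule_prog:
  "set (nmods schedule_prog) = {''d'', ''j'', ''out'', ''cnt'', ''done''}" "set (rmods schedule_prog) = {}"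
  by (auto simp add: schedule_prog_def)

lemma mods_header_prog:
  "set (nmods header_prog) = {''j'', ''best''}"
  "set (rmods header_prog) = {''x'', ''P0'', ''hP'', ''g0'', ''bf'', ''bg''}"
  by (auto simp add: header_prog_def mods_sum_prog)

lemma mods_zero_prog:
  "set (nmods zero_prog) = {''u'', ''i'', ''j'', ''k'', ''best''}"
  "set (rmods zero_prog) = {''c'', ''v'', ''x'', ''vg'', ''vf'', ''bg'', ''bf''}"
  by (auto simp add: zero_prog_def mods_candidate_prog)

lemma mods_round_prog:
  "set (nmods round_prog) = {''m'', ''d'', ''j'', ''out'', ''cnt'', ''done'', ''best'', ''u'', ''i'', ''k'',
     ''i1'', ''i2'', ''i3'', ''t1'', ''t2'', ''t3'', ''t4'', ''t5'', ''t6''}"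
  "set (rmods round_prog) = {''x'', ''P0'', ''hP'', ''g0'', ''bf'', ''bg'', ''c'', ''v'', ''vg'', ''vf'',
     ''a'', ''hq'', ''sl'', ''ad'', ''cap'', ''q'', ''y'', ''r''}"
  by (auto simp add: round_prog_def mods_schedule_prog mods_header_prog mods_zero_prog mods_grid_prog)

lemma wf_candidate_prog: "wf_prog (candidate_prog e)"
  by (simp add: candidate_prog_def interior_prog_def sum_prog_def improve_prog_def)

lemma wf_grid_prog: "wf_prog grid_prog"
proof -
  have "wf_prog rates_prog" "wf_prog update_prog"
    by (simp_all add: rates_prog_def update_prog_def wf_candidate_prog mods_candidate_prog)
  then have "wf_prog weights_prog"
    by (simp add: weights_prog_def wf_repeat mods_rates_prog mods_update_prog)
  moreover have "wf_prog capacity_prog" by (simp add: capacity_prog_def)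
  ultimately show ?thesis
    by (simp add: grid_prog_def wf_repeat mods_weights_prog mods_capacity_prog)
qed

lemma wf_main_prog: "wf_prog main_prog"
proof -
  have "wf_prog init_prog" by (simp add: init_prog_def)
  moreover have "wf_prog schedule_prog" by (simp add: schedule_prog_def)
  moreover have "wf_prog header_prog" by (simp add: header_prog_def sum_prog_def)
  moreover have "wf_prog zero_prog" by (simp add: zero_prog_def wf_candidate_prog)
  ultimately show ?thesis
    by (simp add: main_prog_def round_prog_def wf_grid_prog mods_grid_prog mods_header_prog mods_zero_prog
        mods_schedule_prog)
qed

context scheduling
begin

section \<open>Topological orders and the scheduling of a block\<close>

definition topo :: "nat list \<Rightarrow> bool" where
  "topo xs \<longleftrightarrow> distinct xs \<and> set xs \<subseteq> {..<n} \<and>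
     (\<forall>k<length xs. \<forall>i<n. prec i (xs ! k) \<longrightarrow> i \<in> set (take k xs))"

lemma topo_Nil: "topo []"
  by (simp add: topo_def)

lemma topo_snoc:
  assumes xs: "topo xs" and j: "j < n" "j \<notin> set xs" and pre: "\<And>i. i < n \<Longrightarrow> prec i j \<Longrightarrow> i \<in> set xs"
  shows "topo (xs @ [j])"
  unfolding topo_def
proof (intro conjI allI impI)
  show "distinct (xs @ [j])" "set (xs @ [j]) \<subseteq> {..<n}" using xs j by (auto simp: topo_def)
  fix k i assume k: "k < length (xs @ [j])" and i: "i < n" "prec i ((xs @ [j]) ! k)"
  show "i \<in> set (take k (xs @ [j]))"
  proof (cases "k < length xs")
    case True
    then show ?thesis using xs i by (simp add: topo_def nth_append)
  next
    case False
    then have "k = length xs" using k by simp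
    then show ?thesis using pre i by simp
  qed
qed

lemma topo_ideal:
  assumes "topo xs"
  shows "ideal (set xs)"
proof -
  have "i \<in> set xs" if "i < n" "j \<in> set xs" "prec i j" for i j
  proof -
    obtain k where "k < length xs" "xs ! k = j" using \<open>j \<in> set xs\<close> by (auto simp: in_set_conv_nth)
    then have "i \<in> set (take k xs)" using assms that by (auto simp: topo_def)
    then show ?thesis by (rule in_set_takeD)
  qed
  then show ?thesis using assms by (auto simp: ideal_def topo_def)
qed

lemma topo_feasible:
  assumes "topo xs" "set xs = {..<n}"
  shows "xs \<in> feasible_orders {..<n} prec"
proof -
  have "precedes xs i j" if "i < n" "j < n" "prec i j" for i j
  proof -
    have "j \<in> set xs" using \<open>j < n\<close> assms(2) by simp
    then obtain k where k: "k < length xs" "xs ! k = j" by (auto simp: in_set_conv_nth)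
    then have "i \<in> set (take k xs)" using assms that by (auto simp: topo_def)
    then obtain a where "a < k" "xs ! a = i" by (auto simp: in_set_conv_nth)
    then show ?thesis using k unfolding precedes_def by blast
  qed
  then show ?thesis
    using assms by (auto simp: feasible_orders_def permutations_of_set_def topo_def)
qed

definition depth :: "nat \<Rightarrow> nat" where
  "depth j = card {i. i < n \<and> prec i j}"

lemma depth_less: "i < n \<Longrightarrow> j < n \<Longrightarrow> prec i j \<Longrightarrow> depth i < depth j"
proof -
  assume ij: "i < n" "j < n" "prec i j"
  have "{k. k < n \<and> prec k i} \<subset> {k. k < n \<and> prec k j}"
  proof
    have "prec k j" if "k < n" "prec k i" for k
      using that ij transp_onD[OF prec_trans, of k i j] by simp
    then show "{k. k < n \<and> prec k i} \<subseteq> {k. k < n \<and> prec k j}" by blast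
    have "\<not> prec i i" using ij irreflp_onD[OF prec_irrefl, of i] by simp
    then show "{k. k < n \<and> prec k i} \<noteq> {k. k < n \<and> prec k j}" using ij by blast
  qed
  then show "depth i < depth j" unfolding depth_def by (intro psubset_card_mono) auto
qed

lemma depth_bound: "j < n \<Longrightarrow> depth j < n"
proof -
  assume j: "j < n"
  have "\<not> prec j j" using j irreflp_onD[OF prec_irrefl, of j] by simp
  then have "{i. i < n \<and> prec i j} \<subseteq> {..<n} - {j}" by blast
  then have "depth j \<le> card ({..<n} - {j})" unfolding depth_def by (intro card_mono) auto
  then show ?thesis using j by simp
qed

definition sequenced :: "nat list \<Rightarrow> state \<Rightarrow> bool" where
  "sequenced xs s \<longleftrightarrow> nats s ''n'' [] = n \<and> nats s ''cnt'' [] = length xs \<and>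
     (\<forall>k<length xs. nats s ''out'' [k] = xs ! k) \<and> (\<forall>j\<le>n. 0 < nats s ''done'' [j] \<longleftrightarrow> j \<in> set xs)"

lemma sequenced_cong:
  assumes "sequenced xs s" "\<And>x. x \<in> {''n'', ''cnt'', ''out'', ''done''} \<Longrightarrow> nats t x = nats s x"
  shows "sequenced xs t"
  using assms by (simp add: sequenced_def)

lemma sequenced_nassign:
  "sequenced xs s \<Longrightarrow> x \<notin> {''n'', ''cnt'', ''out'', ''done''} \<Longrightarrow> sequenced xs (nassign x ks v s)"
  by (rule sequenced_cong[of xs s]) (auto intro!: nats_nassign_other)

lemma flags_rassign: "flags (rassign x ks v s) y = flags s y"
  by (simp add: flags_def)

lemma sequenced_snoc:
  assumes "sequenced xs s" "j < n"
  shows "sequenced (xs @ [j]) (nassign ''done'' [j] 1 (nassign ''cnt'' [] (length xs + 1) (nassign ''out'' [length xs] j s)))"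
proof -
  have "nats s ''out'' [k] = (xs @ [j]) ! k" if "k < length xs" for k
    using assms(1) that by (simp add: sequenced_def nth_append)
  then show ?thesis
    using assms unfolding sequenced_def by (simp add: nats_nassign less_Suc_eq)
qed

lemma run_schedule_prog:
  assumes seq: "sequenced xs s" and xs: "topo xs" and B: "ideal B" "set xs \<subseteq> B" "flags s ''best'' = B"
    and depth: "\<forall>j<n. nats s ''depth'' [j] = depth j"
  shows "\<exists>ys. sequenced (xs @ ys) (run \<Omega> schedule_prog s) \<and> topo (xs @ ys) \<and> set (xs @ ys) = B"
proof -
  have Bn: "B \<subseteq> {..<n}" using B ideal_subset by auto
  \<comment> \<open>The jobs of \<open>B\<close> lexicographically below \<open>(d, j)\<close> by
    depth and index, which are those passed when the counters stand at \<open>d\<close> and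
    \<open>j\<close>.\<close>
  define lev where "lev d j = {i \<in> B. depth i < d \<or> depth i = d \<and> i < j}" for d j
  define J :: "nat \<Rightarrow> nat \<Rightarrow> state \<Rightarrow> bool" where "J d j u \<longleftrightarrow>
    (\<exists>ys. sequenced (xs @ ys) u \<and> topo (xs @ ys) \<and> set (xs @ ys) = set xs \<union> lev d j) \<and>
    nats u ''best'' = nats s ''best'' \<and> nats u ''depth'' = nats s ''depth''" for d j u
  have J_nassign: "J d j (nassign x [] v u)" if "J d j u" "x \<in> {''d'', ''j''}" for d j u x v
    using that sequenced_nassign[of _ u x "[]" v] by (auto simp: J_def nats_nassign_other)
  have n: "nats s ''n'' [] = n" using seq by (simp add: sequenced_def)
  have Jn: "nats u ''n'' [] = n" if "J d j u" for d j u
    using that by (auto simp: J_def sequenced_def)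
  let ?c = "BAnd (BAnd (flag ''best'' [nv ''j'']) (BNot (flag ''done'' [nv ''j''])))
       (BAnd (BNot (NLess (NVar ''depth'' [nv ''j'']) (nv ''d''))) (BNot (NLess (nv ''d'') (NVar ''depth'' [nv ''j'']))))"
  let ?a = "PN ''out'' [nv ''cnt''] (nv ''j'') ;; PN ''cnt'' [] (NPlus (nv ''cnt'') (NConst 1)) ;;
      PN ''done'' [nv ''j''] (NConst 1)"
  have inner: "J d (Suc j) (run \<Omega> (PIf ?c ?a) (nassign ''j'' [] j u)) \<and>
      nats (run \<Omega> (PIf ?c ?a) (nassign ''j'' [] j u)) ''d'' [] = d"
    if j: "j < n" and I: "J d j u" and d: "nats u ''d'' [] = d" for d j u
  proof -
    define v where "v = nassign ''j'' [] j u"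
    have v: "J d j v" "nats v ''j'' [] = j" "nats v ''d'' [] = d"
      using J_nassign[OF I] d by (auto simp: v_def nats_nassign)
    obtain ys where ys: "sequenced (xs @ ys) v" "topo (xs @ ys)" "set (xs @ ys) = set xs \<union> lev d j"
      using v(1) by (auto simp: J_def)
    have fr: "nats v ''best'' = nats s ''best''" "nats v ''depth'' = nats s ''depth''"
      using v(1) by (auto simp: J_def)
    have c: "bval \<Omega> v ?c \<longleftrightarrow> j \<in> B \<and> j \<notin> set (xs @ ys) \<and> depth j = d"
      using v ys(1) fr B(3) depth j by (auto simp: sequenced_def flags_def)
    show ?thesis
    proof (cases "bval \<Omega> v ?c")
      case True
      then have jB: "j \<in> B" "j \<notin> set (xs @ ys)" "depth j = d" using c by auto
      have "topo (xs @ ys @ [j])"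
      proof -
        have "i \<in> set (xs @ ys)" if "i < n" "prec i j" for i
          using that depth_less[OF that(1) j that(2)] jB B(1) unfolding ys(3) lev_def ideal_def by auto
        then show ?thesis using topo_snoc[OF ys(2) j jB(2)] by auto
      qed
      moreover define t where "t = nassign ''done'' [j] 1
          (nassign ''cnt'' [] (length (xs @ ys) + 1) (nassign ''out'' [length (xs @ ys)] j v))"
      moreover have "sequenced (xs @ ys @ [j]) t"
        using sequenced_snoc[OF ys(1) j] by (simp add: t_def)
      moreover have "set (xs @ ys @ [j]) = set xs \<union> lev d (Suc j)"
        using ys(3) jB by (auto simp: lev_def less_Suc_eq)
      moreover have "nats t ''best'' = nats s ''best''" "nats t ''depth'' = nats s ''depth''" "nats t ''d'' [] = d"
        using fr v(3) by (auto simp: t_def nats_nassign nats_nassign_other)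
      ultimately have "J d (Suc j) t" "nats t ''d'' [] = d" unfolding J_def by blast+
      moreover have "run \<Omega> (PIf ?c ?a) v = t"
        using True v ys(1) by (simp add: t_def sequenced_def nats_nassign del: bval.simps)
      ultimately show ?thesis unfolding v_def[symmetric] by (simp del: run.simps)
    next
      case False
      then have "\<not> (j \<in> B \<and> j \<notin> set (xs @ ys) \<and> depth j = d)" unfolding c .
      moreover have "lev d (Suc j) = lev d j \<union> (if j \<in> B \<and> depth j = d then {j} else {})"
        by (auto simp: lev_def less_Suc_eq)
      ultimately have "set xs \<union> lev d (Suc j) = set (xs @ ys)" unfolding ys(3)[symmetric] using ys(3) by auto
      moreover have "run \<Omega> (PIf ?c ?a) v = v" using False by (simp only: run.simps if_False)
      ultimately show ?thesis
        using v ys fr unfolding J_def v_def[symmetric] by metis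
    qed
  qed
  have "J (nats s ''n'' [] + 0) 0 (run \<Omega> (PFor ''d'' 0 (PFor ''j'' 0 (PIf ?c ?a))) s)"
  proof (rule run_For_invariant[where I = "\<lambda>d. J d 0"])
    show "J 0 0 s"
      using seq xs unfolding J_def lev_def by (auto intro!: exI[of _ "[]"])
    show "J d 0 (nassign ''d'' [] v u)" if "J d 0 u" for d v u
      using J_nassign that by simp
  next
    fix d u assume I: "J d 0 u"
    define v where "v = nassign ''d'' [] d u"
    have v: "J d 0 v" "nats v ''d'' [] = d" using J_nassign[OF I] by (auto simp: v_def nats_nassign)
    have "J d (nats v ''n'' [] + 0) (run \<Omega> (PFor ''j'' 0 (PIf ?c ?a)) v) \<and>
        nats (run \<Omega> (PFor ''j'' 0 (PIf ?c ?a)) v) ''d'' [] = d"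
      by (rule run_For_invariant[where I = "\<lambda>j u. J d j u \<and> nats u ''d'' [] = d"])
        (use v inner J_nassign Jn in \<open>auto simp: nats_nassign simp del: run.simps\<close>)
    moreover have "lev d n = lev (Suc d) 0" using Bn by (auto simp: lev_def)
    ultimately show "J (Suc d) 0 (run \<Omega> (PFor ''j'' 0 (PIf ?c ?a)) (nassign ''d'' [] d u))"
      using Jn[OF v(1)] by (simp add: J_def v_def[symmetric] del: run.simps)
  qed
  \<comment> \<open>Depths are below \<open>n\<close>, so \<open>n\<close> levels exhaust the
    block.\<close>
  moreover have "set xs \<union> lev n 0 = B" using B Bn depth_bound by (auto simp: lev_def)
  ultimately show ?thesis by (auto simp: J_def n schedule_prog_def simp del: run.simps)
qed

section \<open>Correctness of a round\<close>

definition prepared :: "state \<Rightarrow> bool" where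
  "prepared s \<longleftrightarrow> (\<forall>j<n. reals s ''p'' [j] = p j) \<and> (\<forall>j<n. nats s ''depth'' [j] = depth j) \<and>
     (\<forall>i\<le>n. \<forall>j<n. 0 < nats s ''prec'' [i, j] \<longleftrightarrow> i = j \<or> i = n \<or> prec i j)"

lemma prepared_cong:
  assumes "prepared s" "reals t ''p'' = reals s ''p''" "nats t ''depth'' = nats s ''depth''"
    "nats t ''prec'' = nats s ''prec''"
  shows "prepared t"
  using assms by (simp add: prepared_def)

lemma prepared_nassign: "prepared s \<Longrightarrow> x \<notin> {''depth'', ''prec''} \<Longrightarrow> prepared (nassign x ks v s)"
  by (rule prepared_cong[of s]) (auto intro!: nats_nassign_other)

lemma run_header_prog:
  assumes seq: "sequenced xs s" and xs: "topo xs" and prep: "prepared s"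
  shows "base (set xs) (run \<Omega> header_prog s)" "best (set xs) {} (run \<Omega> header_prog s)"
proof -
  let ?U = "set xs"
  have U: "ideal ?U" "?U \<subseteq> {..<n}" using topo_ideal[OF xs] ideal_subset by auto
  have n: "nats s ''n'' [] = n" and d: "flags s ''done'' = ?U"
    using seq U by (auto simp: sequenced_def flags_def)
  have p: "\<forall>j<n. reals s ''p'' [j] = p j" using prep by (simp add: prepared_def)
  define s1 where "s1 = run \<Omega> (sum_prog ''done'') s"
  have x1: "reals s1 ''x'' [] = sum p ?U"
    unfolding s1_def d[symmetric] using n p by (intro run_sum_prog) auto
  have f1: "nats s1 x = nats s x" if "x \<noteq> ''j''" for x
    unfolding s1_def using that by (intro nats_run_other) (auto simp: mods_sum_prog)
  have p1: "reals s1 ''p'' = reals s ''p''"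
    unfolding s1_def by (intro reals_run_other) (auto simp: mods_sum_prog)
  define s2 where "s2 = rassign ''g0'' [] (g ?U) (rassign ''hP'' [] (f ?U) (rassign ''P0'' [] (sum p ?U) s1))"
  have b2: "base ?U s2"
    using U prep seq f1 p1 unfolding base_def s2_def
    by (simp add: prepared_def sequenced_def reals_rassign)
  let ?ones = "PFor ''j'' 0 (PN ''best'' [nv ''j''] (NConst 1))"
  define s3 where "s3 = run \<Omega> ?ones s2"
  have b3: "base ?U s3" unfolding s3_def by (rule base_run[OF b2]) auto
  have "\<forall>k<nats s2 ''n'' [] + 0. nats s3 ''best'' [k] = 1"
    unfolding s3_def by (rule run_For_invariant) (auto simp: nats_nassign less_Suc_eq)
  then have best3: "flags s3 ''best'' = {..<n}" using base_n[OF b2] by (auto simp: flags_def)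
  define s4 where "s4 = run \<Omega> (sum_prog ''best'') s3"
  have b4: "base ?U s4" unfolding s4_def by (rule base_run[OF b3]) (auto simp: mods_sum_prog)
  have x4: "reals s4 ''x'' [] = sum p {..<n}"
    unfolding s4_def best3[symmetric] using b3 by (intro run_sum_prog) (auto simp: base_def)
  have best4: "flags s4 ''best'' = {..<n}"
    using best3 nats_run_other[of "''best''" "sum_prog ''best''" \<Omega> s3]
    by (simp add: s4_def flags_def mods_sum_prog)
  have d1: "flags s1 ''done'' = ?U" using d f1 by (simp add: flags_def)
  have "run \<Omega> header_prog s = rassign ''bg'' [] (g {..<n} - g ?U) (rassign ''bf'' [] (f {..<n} - f ?U) s4)"
  proof -
    have "run \<Omega> header_prog s = run \<Omega> (?ones ;; sum_prog ''best'' ;;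
       PR ''bf'' [] (RMinus (Query_h (rv ''x'')) (rv ''hP'')) ;;
       PR ''bg'' [] (RMinus (Query_g ''best'' []) (rv ''g0''))) s2"
      using d1 x1
      by (simp add: header_prog_def s1_def[symmetric] s2_def query_flags flags_rassign reals_rassign f_def
          del: run.simps(5) One_nat_def)
    also have "\<dots> = rassign ''bg'' [] (g {..<n} - g ?U) (rassign ''bf'' [] (f {..<n} - f ?U) s4)"
      using b4 x4 best4
      by (simp add: s3_def[symmetric] s4_def[symmetric] query_flags flags_rassign reals_rassign base_def f_def
          del: run.simps(5) One_nat_def)
    finally show ?thesis .
  qed
  moreover have "ideal {..<n}" by (auto simp: ideal_def)
  ultimately show "base (set xs) (run \<Omega> header_prog s)" "best (set xs) {} (run \<Omega> header_prog s)"
    using b4 best4 U by (auto simp: best_def base_rassign reals_rassign flags_def)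
qed

lemma run_zero_prog:
  assumes base: "base U s" and best: "best U {} s"
  shows "base U (run \<Omega> zero_prog s)"
    "best U {interior U (insert n {j. j < n \<and> p j = 0})} (run \<Omega> zero_prog s)"
proof -
  show "base U (run \<Omega> zero_prog s)" by (rule base_run[OF base]) (auto simp: mods_zero_prog)
  let ?a = "PFor ''j'' 0 (PR ''c'' [nv ''j''] (RMinus rzero (RVar ''p'' [nv ''j''])))"
  define s1 where "s1 = run \<Omega> ?a s"
  define s2 where "s2 = nassign ''k'' [] n (rassign ''c'' [n] 0 s1)"
  have b1: "base U s1" unfolding s1_def by (rule base_run[OF base]) auto
  have t1: "best U {} s1" unfolding s1_def by (rule best_run[OF best]) auto
  have "reals s1 ''p'' = reals s ''p'' \<and> (\<forall>j<nats s ''n'' [] + 0. reals s1 ''c'' [j] = - reals s ''p'' [j])"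
    unfolding s1_def
  proof (rule run_For_invariant)
    fix i and u :: state
    assume "reals u ''p'' = reals s ''p'' \<and> (\<forall>j<i. reals u ''c'' [j] = - reals s ''p'' [j])"
    then show "reals (run \<Omega> (PR ''c'' [nv ''j''] (RMinus rzero (RVar ''p'' [nv ''j'']))) (nassign ''j'' [] i u)) ''p'' = reals s ''p''
      \<and> (\<forall>j<Suc i. reals (run \<Omega> (PR ''c'' [nv ''j''] (RMinus rzero (RVar ''p'' [nv ''j'']))) (nassign ''j'' [] i u)) ''c'' [j]
         = - reals s ''p'' [j])"
      by (auto simp: nats_nassign reals_rassign reals_rassign_other less_Suc_eq)
  qed auto
  then have c1: "\<forall>j<n. reals s1 ''c'' [j] = - p j" using base by (simp add: base_def)
  have b2: "base U s2" "best U {} s2"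
    using b1 t1 by (auto simp: s2_def base_nassign base_rassign best_nassign best_rassign)
  have k2: "nats s2 ''k'' [] = n" by (simp add: s2_def nats_nassign)
  \<comment> \<open>The dummy has weight 0 and the largest index, so its threshold takes all jobs of
    weight at least 0, and \<open>- p j \<ge> 0\<close> means \<open>p j = 0\<close>.\<close>
  have "threshold (n + 1) (\<lambda>i. reals s2 ''c'' [i]) n 1 = insert n {j. j < n \<and> p j = 0}"
    using c1 p_nonneg
    by (auto simp: threshold_def s2_def reals_rassign less_Suc_eq) (smt (verit))+
  then have "best U (insert (interior U (insert n {j. j < n \<and> p j = 0})) {}) (run \<Omega> (candidate_prog 1) s2)"
    by (intro run_candidate_prog(2)[OF b2(1) k2 _ b2(2)]) auto
  moreover have "run \<Omega> zero_prog s = run \<Omega> (candidate_prog 1) s2"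
    using base_n[OF b1] by (simp add: zero_prog_def s1_def[symmetric] s2_def del: run.simps(5) One_nat_def)
  ultimately show "best U {interior U (insert n {j. j < n \<and> p j = 0})} (run \<Omega> zero_prog s)" by simp
qed

lemma bestE:
  assumes "best U D s"
  obtains B where "flags s ''best'' = B" "ideal B" "U \<subseteq> B" "B = U \<longrightarrow> U = {..<n}"
    "\<forall>X\<in>D. dominates U B X"
  using assms unfolding best_def by blast

lemma run_round_prog:
  assumes seq: "sequenced xs s" and xs: "topo xs" and prep: "prepared s"
  shows "\<exists>ys. sequenced (xs @ ys) (run \<Omega> round_prog s) \<and> topo (xs @ ys) \<and> prepared (run \<Omega> round_prog s) \<and>
    near_dense (set xs) (set (xs @ ys)) \<and> (ys = [] \<longrightarrow> set xs = {..<n})"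
proof -
  let ?U = "set xs"
  have U: "ideal ?U" using xs by (rule topo_ideal)
  let ?Z = "interior ?U (insert n {j. j < n \<and> p j = 0})"
  define s1 where "s1 = run \<Omega> header_prog s"
  define s2 where "s2 = run \<Omega> zero_prog s1"
  define s3 where "s3 = run \<Omega> (PFor ''m'' 0 grid_prog) s2"
  note h1 = run_header_prog[OF assms, folded s1_def]
  note z2 = run_zero_prog[OF h1, folded s2_def]
  let ?D = "\<lambda>l. insert ?Z {candidate ?U m i t k | m i t k. m < l \<and> i < (n + 8) ^ 3 \<and> t < (n + 8) ^ 6 \<and> k < n + 1}"
  have "base ?U s3 \<and> best ?U (?D (nats s2 ''n'' [] + 0)) s3"
    unfolding s3_def
  proof (rule run_For_invariant)
    show "base ?U s2 \<and> best ?U (?D 0) s2" using z2 by simp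
    fix i v u assume "base ?U u \<and> best ?U (?D i) u"
    then show "base ?U (nassign ''m'' [] v u) \<and> best ?U (?D i) (nassign ''m'' [] v u)"
      by (simp add: base_nassign best_nassign)
  next
    fix m u assume m: "m < nats s2 ''n'' [] + 0" and I: "base ?U u \<and> best ?U (?D m) u"
    have m: "m < n" using m base_n[OF z2(1)] by simp
    define v where "v = nassign ''m'' [] m u"
    have v: "base ?U v" "best ?U (?D m) v" "nats v ''m'' [] = m"
      using I by (auto simp: v_def base_nassign best_nassign nats_nassign)
    have "base ?U (run \<Omega> grid_prog v)" by (rule base_run[OF v(1)]) (auto simp: mods_grid_prog)
    moreover have "best ?U (?D (Suc m)) (run \<Omega> grid_prog v)"
    proof (rule best_antimono[OF run_grid_prog[OF v m]], rule subsetI)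
      fix Y assume Y: "Y \<in> ?D (Suc m)"
      show "Y \<in> ?D m \<union> {candidate ?U m i t k | i t k. i < (n + 8) ^ 3 \<and> t < (n + 8) ^ 6 \<and> k < n + 1}"
      proof (cases "Y = ?Z")
        case False
        then obtain m' i t k where Y': "Y = candidate ?U m' i t k" "m' < Suc m"
            "i < (n + 8) ^ 3" "t < (n + 8) ^ 6" "k < n + 1"
          using Y by blast
        show ?thesis
        proof (cases "m' = m")
          case True
          then show ?thesis using Y' by blast
        next
          case False
          then have "m' < m" using Y'(2) by simp
          then have "Y \<in> ?D m" using Y' by blast
          then show ?thesis by (rule UnI1)
        qed
      qed simp
    qed
    ultimately show "base ?U (run \<Omega> grid_prog (nassign ''m'' [] m u)) \<and>
        best ?U (?D (Suc m)) (run \<Omega> grid_prog (nassign ''m'' [] m u))"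
      by (simp add: v_def)
  qed
  then have "best ?U (?D n) s3" using base_n[OF z2(1)] by simp
  then obtain B where B: "flags s3 ''best'' = B" "ideal B" "?U \<subseteq> B" "B = ?U \<longrightarrow> ?U = {..<n}"
    and dom: "\<forall>X\<in>?D n. dominates ?U B X"
    by (rule bestE)
  have dense: "near_dense ?U B"
  proof (rule near_dense_candidates[OF U B(2,3)])
    show "dominates ?U B ?Z" using dom by simp
    fix m i t k :: nat
    assume "m < n" "i < (n + 8) ^ 3" "t < (n + 8) ^ 6" "k < n + 1"
    then have "candidate ?U m i t k \<in> ?D n" by (intro insertI2 CollectI exI conjI) (rule refl)
    then show "dominates ?U B (candidate ?U m i t k)" by (rule bspec[OF dom])
  qed
  have f3: "nats s3 x = nats s x" if "x \<in> {''n'', ''cnt'', ''out'', ''done'', ''depth'', ''prec''}" for x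
  proof -
    have "nats s1 x = nats s x"
      unfolding s1_def using that by (intro nats_run_other) (auto simp: mods_header_prog)
    moreover have "nats s2 x = nats s1 x"
      unfolding s2_def using that by (intro nats_run_other) (auto simp: mods_zero_prog)
    moreover have "nats s3 x = nats s2 x"
      unfolding s3_def using that by (intro nats_run_other) (auto simp: mods_grid_prog)
    ultimately show ?thesis by simp
  qed
  have seq3: "sequenced xs s3" using sequenced_cong[OF seq] f3 by blast
  have "\<forall>j<n. nats s3 ''depth'' [j] = depth j" using prep f3 by (simp add: prepared_def)
  from run_schedule_prog[OF seq3 xs B(2,3,1) this] obtain ys where
    ys: "sequenced (xs @ ys) (run \<Omega> schedule_prog s3)" "topo (xs @ ys)" "set (xs @ ys) = B" by blast
  have run: "run \<Omega> round_prog s = run \<Omega> schedule_prog s3"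
    by (simp only: round_prog_def run.simps(3) s1_def s2_def s3_def)
  have "prepared (run \<Omega> round_prog s)"
    by (rule prepared_cong[OF prep]) (auto intro!: nats_run_other reals_run_other simp: mods_round_prog)
  moreover have "ys = [] \<longrightarrow> set xs = {..<n}" using ys(3) B(4) by auto
  ultimately show ?thesis using ys dense by (intro exI[of _ ys]) (simp add: run)
qed

section \<open>Correctness of the whole algorithm\<close>

lemma run_init_prog:
  defines "s \<equiv> initial_state n p prec"
  shows "sequenced [] (run \<Omega> init_prog s)" "prepared (run \<Omega> init_prog s)"
proof -
  let ?c = "PIf (flag ''prec'' [nv ''i'', nv ''j''])
       (PN ''depth'' [nv ''j''] (NPlus (NVar ''depth'' [nv ''j'']) (NConst 1)))"
  let ?I = "\<lambda>j u. (\<forall>x. x \<notin> {''i'', ''j'', ''depth''} \<longrightarrow> nats u x = nats s x) \<and> reals u = reals s \<and>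
     (\<forall>l<n. nats u ''depth'' [l] = (if l < j then depth l else 0))"
  have sn: "nats s ''n'' [] = n" and sp: "\<forall>i<n. \<forall>j<n. 0 < nats s ''prec'' [i, j] \<longleftrightarrow> prec i j"
    by (auto simp: s_def initial_state_def)
  define s1 where "s1 = run \<Omega> (PFor ''j'' 0 (PFor ''i'' 0 ?c)) s"
  have I: "?I (nats s ''n'' [] + 0) s1"
    unfolding s1_def
  proof (rule run_For_invariant)
    show "?I 0 s" by (simp add: s_def initial_state_def)
    fix i v and u :: state assume "?I i u"
    then show "?I i (nassign ''j'' [] v u)" by (simp add: nats_nassign nats_nassign_other)
  next
    fix j and u :: state assume j: "j < nats s ''n'' [] + 0" and I: "?I j u"
    have j: "j < n" using j sn by simp
    define u1 where "u1 = nassign ''j'' [] j u"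
    let ?J = "\<lambda>i u. (\<forall>x. x \<notin> {''i'', ''j'', ''depth''} \<longrightarrow> nats u x = nats s x) \<and> reals u = reals s \<and>
      nats u ''j'' [] = j \<and>
      (\<forall>l<n. nats u ''depth'' [l] = (if l < j then depth l else if l = j then card {i'. i' < i \<and> prec i' j} else 0))"
    have n1: "nats u1 ''n'' [] = n" using I sn by (simp add: u1_def nats_nassign)
    have loop: "?J (nats u1 ''n'' [] + 0) (run \<Omega> (PFor ''i'' 0 ?c) u1)"
    proof (rule run_For_invariant)
      show "?J 0 u1" using I by (simp add: u1_def nats_nassign nats_nassign_other)
      fix i v and u :: state assume "?J i u"
      then show "?J i (nassign ''i'' [] v u)" by (simp add: nats_nassign nats_nassign_other)
    next
      fix i and u :: state assume i: "i < nats u1 ''n'' [] + 0" and J: "?J i u"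
      have i: "i < n" using i n1 by simp
      have "{i'. i' < Suc i \<and> prec i' j} =
          (if prec i j then insert i {i'. i' < i \<and> prec i' j} else {i'. i' < i \<and> prec i' j})"
        by (auto simp: less_Suc_eq)
      then have card: "card {i'. i' < Suc i \<and> prec i' j} =
          (if prec i j then Suc (card {i'. i' < i \<and> prec i' j}) else card {i'. i' < i \<and> prec i' j})"
        by simp
      show "?J (Suc i) (run \<Omega> ?c (nassign ''i'' [] i u))"
        using J i j sp unfolding card by (auto simp: nats_nassign nats_nassign_other)
    qed
    then show "?I (Suc j) (run \<Omega> (PFor ''i'' 0 ?c) (nassign ''j'' [] j u))"
      unfolding u1_def[symmetric] n1 by (simp add: depth_def less_Suc_eq del: run.simps)
  qed
  note I = I[unfolded sn add_0_right]
  then have s1: "\<forall>x. x \<notin> {''i'', ''j'', ''depth''} \<longrightarrow> nats s1 x = nats s x" "reals s1 = reals s" by blast+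
  have s1': "\<forall>l<n. nats s1 ''depth'' [l] = depth l" using I by simp
  let ?b = "PN ''prec'' [nv ''n'', nv ''j''] (NConst 1) ;; PN ''prec'' [nv ''j'', nv ''j''] (NConst 1)"
  define s2 where "s2 = run \<Omega> (PFor ''j'' 0 ?b) s1"
  let ?K = "\<lambda>j u. (\<forall>x. x \<notin> {''j'', ''prec''} \<longrightarrow> nats u x = nats s1 x) \<and> reals u = reals s \<and>
     (\<forall>i\<le>n. \<forall>l<n. 0 < nats u ''prec'' [i, l] \<longleftrightarrow> (i < n \<and> prec i l \<or> l < j \<and> (i = l \<or> i = n)))"
  have n1: "nats s1 ''n'' [] = n" using s1 sn by simp
  have K: "?K (nats s1 ''n'' [] + 0) s2"
    unfolding s2_def
  proof (rule run_For_invariant)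
    show "?K 0 s1" using s1 by (auto simp: s_def initial_state_def)
    fix i v and u :: state assume "?K i u"
    then show "?K i (nassign ''j'' [] v u)" by (simp add: nats_nassign nats_nassign_other)
  next
    fix j and u :: state assume j: "j < nats s1 ''n'' [] + 0" and K: "?K j u"
    have j: "j < n" using j n1 by simp
    have "nats u ''n'' [] = n" using K n1 by simp
    then show "?K (Suc j) (run \<Omega> ?b (nassign ''j'' [] j u))"
      using K j by (auto simp: nats_nassign nats_nassign_other less_Suc_eq)
  qed
  note K = K[unfolded n1 add_0_right]
  then have s2: "\<forall>x. x \<notin> {''j'', ''prec''} \<longrightarrow> nats s2 x = nats s1 x" "reals s2 = reals s" by blast+
  have s2': "\<forall>i\<le>n. \<forall>l<n. 0 < nats s2 ''prec'' [i, l] \<longleftrightarrow> (i = l \<or> i = n \<or> prec i l)"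
    using K le_neq_implies_less[of _ n] by blast
  have "run \<Omega> init_prog s = s2"
    by (simp only: init_prog_def run.simps(3) s1_def s2_def)
  moreover have "sequenced [] s2"
    using s1 s2 by (simp add: sequenced_def s_def initial_state_def)
  moreover have "prepared s2"
    using s1 s1' s2 s2' by (simp add: prepared_def s_def initial_state_def)
  ultimately show "sequenced [] (run \<Omega> init_prog s)" "prepared (run \<Omega> init_prog s)" by auto
qed

text \<open>The accounting runs over blocks: contraction lowers \<open>gcost\<close> of any fixed
  feasible order by at least half of the bound on what the appended block adds, and the contracted
  cost ends at 0. Adding up gives the factor 2 against every order simultaneously.\<close>

lemma run_main_prog:
  "\<exists>xs. sequenced xs (run \<Omega> main_prog (initial_state n p prec)) \<and> topo xs \<and> set xs = {..<n} \<and>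
     (\<forall>\<pi>\<in>feasible_orders {..<n} prec. gcost {} xs \<le> 2 * gcost {} \<pi>)"
proof -
  define s where "s = run \<Omega> init_prog (initial_state n p prec)"
  have s: "sequenced [] s" "prepared s" using run_init_prog by (auto simp: s_def)
  have n: "nats s ''n'' [] = n" using s by (simp add: sequenced_def)
  \<comment> \<open>Each round adds at least one job unless all are scheduled, so \<open>n\<close>
    rounds suffice.\<close>
  let ?I = "\<lambda>r u. \<exists>xs. sequenced xs u \<and> topo xs \<and> prepared u \<and> (r \<le> length xs \<or> set xs = {..<n}) \<and>
     (\<forall>\<pi>\<in>feasible_orders {..<n} prec. gcost {} xs + 2 * gcost (set xs) \<pi> \<le> 2 * gcost {} \<pi>)"
  have "?I (nats s ''n'' [] + 0) (run \<Omega> (PFor ''r'' 0 round_prog) s)"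
  proof (rule run_For_invariant)
    show "?I 0 s"
      using s topo_Nil by (intro exI[of _ "[]"]) (auto simp: gcost_def)
    fix i v u assume "?I i u"
    then show "?I i (nassign ''r'' [] v u)"
      using sequenced_nassign[of _ u "''r''" "[]" v] prepared_nassign[of u "''r''" "[]" v] by auto
  next
    fix r u assume "?I r u"
    then obtain xs where xs: "sequenced xs u" "topo xs" "prepared u" "r \<le> length xs \<or> set xs = {..<n}"
      and bound: "\<forall>\<pi>\<in>feasible_orders {..<n} prec. gcost {} xs + 2 * gcost (set xs) \<pi> \<le> 2 * gcost {} \<pi>"
      by blast
    define v where "v = nassign ''r'' [] r u"
    have v: "sequenced xs v" "prepared v"
      using sequenced_nassign[OF xs(1)] prepared_nassign[OF xs(3)] by (auto simp: v_def)
    obtain ys where ys: "sequenced (xs @ ys) (run \<Omega> round_prog v)" "topo (xs @ ys)" "prepared (run \<Omega> round_prog v)"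
      "near_dense (set xs) (set (xs @ ys))" "ys = [] \<longrightarrow> set xs = {..<n}"
      using run_round_prog[OF v(1) xs(2) v(2)] by blast
    have sub: "set (xs @ ys) \<subseteq> {..<n}" using ys(2) by (simp add: topo_def)
    have "Suc r \<le> length (xs @ ys) \<or> set (xs @ ys) = {..<n}"
    proof (cases "ys = [] \<or> set xs = {..<n}")
      case True
      then have "set xs = {..<n}" using ys(5) by blast
      then show ?thesis using sub by auto
    next
      case False
      then show ?thesis using xs(4) by (cases ys) auto
    qed
    moreover have "gcost {} (xs @ ys) + 2 * gcost (set (xs @ ys)) \<pi> \<le> 2 * gcost {} \<pi>"
      if \<pi>: "\<pi> \<in> feasible_orders {..<n} prec" for \<pi>
    proof -
      have "gcost (set (xs @ ys)) \<pi> + (f (set (xs @ ys)) - f (set xs)) * (g {..<n} - g (set xs)) / 2 \<le> gcost (set xs) \<pi>"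
        by (rule gcost_contract[OF \<pi> topo_ideal[OF xs(2)] topo_ideal[OF ys(2)] _ ys(4)]) auto
      then show ?thesis using gcost_append[OF sub] bound[rule_format, OF \<pi>] by simp
    qed
    ultimately show "?I (Suc r) (run \<Omega> round_prog (nassign ''r'' [] r u))"
      using ys unfolding v_def by blast
  qed
  then obtain xs where xs: "sequenced xs (run \<Omega> (PFor ''r'' 0 round_prog) s)" "topo xs"
    "n \<le> length xs \<or> set xs = {..<n}"
    "\<forall>\<pi>\<in>feasible_orders {..<n} prec. gcost {} xs + 2 * gcost (set xs) \<pi> \<le> 2 * gcost {} \<pi>"
    unfolding n by auto
  have "set xs = {..<n}"
  proof (rule ccontr)
    assume "set xs \<noteq> {..<n}"
    then have "set xs \<subset> {..<n}" "n \<le> length xs" using xs by (auto simp: topo_def)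
    then have "card (set xs) < n" using psubset_card_mono[of "{..<n}" "set xs"] by simp
    then show False using xs(2) \<open>n \<le> length xs\<close> distinct_card[of xs] by (simp add: topo_def)
  qed
  moreover have "gcost {} xs \<le> 2 * gcost {} \<pi>" if "\<pi> \<in> feasible_orders {..<n} prec" for \<pi>
  proof -
    have "set \<pi> \<subseteq> {..<n}" using that by (auto simp: feasible_orders_def permutations_of_set_def)
    then show ?thesis using xs(4) that gcost_all[of \<pi>] \<open>set xs = {..<n}\<close> by auto
  qed
  moreover have "run \<Omega> main_prog (initial_state n p prec) = run \<Omega> (PFor ''r'' 0 round_prog) s"
    by (simp only: main_prog_def run.simps(3) s_def)
  ultimately show ?thesis using xs(1,2) by auto
qed

lemma main_prog_approximation:
  "is_approximation 2 {..<n} p prec w h (output_order n (run \<Omega> main_prog (initial_state n p prec)))"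
proof -
  obtain xs where xs: "sequenced xs (run \<Omega> main_prog (initial_state n p prec))" "topo xs" "set xs = {..<n}"
    "\<forall>\<pi>\<in>feasible_orders {..<n} prec. gcost {} xs \<le> 2 * gcost {} \<pi>"
    using run_main_prog by blast
  have len: "length xs = n" using xs(2,3) distinct_card[of xs] by (simp add: topo_def)
  have out: "output_order n (run \<Omega> main_prog (initial_state n p prec)) = xs"
    unfolding output_order_def using xs(1) len by (intro nth_equalityI) (auto simp: sequenced_def)
  have feas: "xs \<in> feasible_orders {..<n} prec" using xs by (intro topo_feasible)
  have perm: "\<pi> \<in> permutations_of_set {..<n}" if "\<pi> \<in> feasible_orders {..<n} prec" for \<pi>
    using that by (simp add: feasible_orders_def)
  let ?O = "objective {..<n} p w h"
  have le: "?O xs \<le> 2 * ?O \<pi>" if "\<pi> \<in> feasible_orders {..<n} prec" for \<pi>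
  proof -
    \<comment> \<open>The constant part of the objective is nonnegative, so the factor 2 for
      \<open>gcost\<close> carries over.\<close>
    have "w {} \<le> g {..<n}" unfolding subset_weight_def using w_nonneg by (intro member_le_sum) auto
    then have "0 \<le> h 0 * (g {..<n} - w {})" using h_nonneg[of 0] by simp
    then show ?thesis using xs(4) that perm feas by (auto simp: objective_eq)
  qed
  have "finite (feasible_orders {..<n} prec)" unfolding feasible_orders_def by simp
  then have "Min (?O ` feasible_orders {..<n} prec) \<in> ?O ` feasible_orders {..<n} prec"
    using feas by (intro Min_in) auto
  then have "?O xs \<le> 2 * Min (?O ` feasible_orders {..<n} prec)" using le by auto
  then show ?thesis unfolding out is_approximation_def using feas by simp
qed

end

theorem theorem5:
  shows "\<exists>(alg :: com) (P :: nat poly).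
    \<forall>(n :: nat) (p :: nat \<Rightarrow> real) (prec :: nat \<Rightarrow> nat \<Rightarrow> bool)
      (w :: nat set \<Rightarrow> real) (h :: real \<Rightarrow> real).
      (\<forall>j<n. 0 \<le> p j) \<longrightarrow>
      irreflp_on {..<n} prec \<longrightarrow> transp_on {..<n} prec \<longrightarrow>
      (\<forall>A\<subseteq>{..<n}. 0 \<le> w A) \<longrightarrow>
      h \<in> {0..} \<rightarrow> {0..} \<longrightarrow> mono_on {0..} h \<longrightarrow> concave_on {0..} h \<longrightarrow>
      (\<exists>k t. exec (oracles n (subset_weight w) h) alg (initial_state n p prec) k t \<and>
             k \<le> poly P n \<and>
             is_approximation 2 {..<n} p prec w h (output_order n t))"
proof (rule exI[of _ "com_of main_prog"], rule exI[of _ "time_bound main_prog"], intro allI impI)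
  fix n :: nat and p :: "nat \<Rightarrow> real" and prec :: "nat \<Rightarrow> nat \<Rightarrow> bool"
    and w :: "nat set \<Rightarrow> real" and h :: "real \<Rightarrow> real"
  assume "\<forall>j<n. 0 \<le> p j" "irreflp_on {..<n} prec" "transp_on {..<n} prec" "\<forall>A\<subseteq>{..<n}. 0 \<le> w A"
    "h \<in> {0..} \<rightarrow> {0..}" "mono_on {0..} h" "concave_on {0..} h"
  then interpret scheduling n p prec w h
    by unfold_locales (auto simp: mono_on_def)
  have "nats (initial_state n p prec) ''n'' [] = n" by (simp add: initial_state_def)
  with exec_run[OF wf_main_prog, of \<Omega> "initial_state n p prec"] main_prog_approximation
  show "\<exists>k t. exec \<Omega> (com_of main_prog) (initial_state n p prec) k t \<and> k \<le> poly (time_bound main_prog) n \<and>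
      is_approximation 2 {..<n} p prec w h (output_order n t)"
    by auto
qed

end
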